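(* Let $p_\Gamma$ be empty (discontinuous pressures, $Q_\Gamma=\{0\}$, $Q=Q_I$), let $G=B_\Delta\widetilde R_\Delta\widetilde A^{-1}\widetilde R_\Delta^TB_\Delta^T$ be the FETI-DP operator on the Lagrange multiplier space $\Lambda$, and let $M_L^{-1}=B_{\Delta,D}\widetilde R_\Delta\widetilde A\widetilde R_\Delta^TB_{\Delta,D}^T$ be the lumped preconditioner. Then there is a constant $c>0$, independent of the mesh size $h$ and the subdomain size $H$, such that for all $x=\lambda\in R_{M_L^{-1}G}$ (the range of $M_L^{-1}G$), $$c\,\beta^2\langle M_Lx,x\rangle\le\langle Gx,x\rangle\le\Phi_1(H/h)\,\langle M_Lx,x\rangle ,$$ where $\beta$ is the inf-sup constant of the mixed finite element and $\Phi_1$ is the function in the stability bound of the jump operator $P_{D,1}$ (in the present two-dimensional setting, $\Phi_1(H/h)=C(H/h)(1+\log(H/h))$).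
   Context: Discretization. $\Omega\subset\mathbb R^2$ is a bounded polygonal domain, triangulated into shape-regular elements of characteristic size $h$. The Stokes problem $-\Delta\mathbf u+\nabla p=\mathbf f$, $-\nabla\cdot\mathbf u=0$ in $\Omega$, $\mathbf u=0$ on $\partial\Omega$, is discretized with a space $\mathbf W\subset(H_0^1(\Omega))^2$ of continuous velocities and a pressure space $Q\subset L^2(\Omega)$; here the pressures are discontinuous (for example: piecewise linear velocity on a uniform triangular mesh and pressure constant on unions of four triangles). $A,B$ are the matrices of $a(\mathbf u,\mathbf v)=\int_\Omega\nabla\mathbf u\cdot\nabla\mathbf v$ and $b(\mathbf u,q)=-\int_\Omega(\nabla\cdot\mathbf u)q$. The same symbol denotes a finite element function and its vector of nodal values, and $\langle\cdot,\cdot\rangle$ is the inner product of vectors; for a symmetric matrix $K$, $\langle u,v\rangle_K=\langle Ku,v\rangle$. $\mathrm{Ker}(B^T)$ is the space of constant pressures, and elements of $Q/\mathrm{Ker}(B^T)$ are taken with zero average. $Z$ is the pressure mass matrix, $\|q\|_{L^2}^2=\langle q,Zq\rangle$, and $ch^2I\le Z\le Ch^2I$. The element is inf-sup stable: there is $\beta>0$ independent of $h$ with $\sup_{\mathbf w\in\mathbf W}\langle q,B\mathbf w\rangle^2/\langle\mathbf w,A\mathbf w\rangle\ge\beta^2\langle q,Zq\rangle$ for all $q\in Q/\mathrm{Ker}(B^T)$. $c,C$ denote generic positive constants independent of $h$ and $H$. Decomposition. $\Omega$ is split into $N$ nonoverlapping polygonal subdomains $\Omega_i$ of diameter of order $H$,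 each a union of elements, with matching nodes on the interface $\Gamma=(\cup\partial\Omega_i)\setminus\partial\Omega$, which consists of open edges $\Gamma^{ij}$ (shared by $\Omega_i,\Omega_j$) and subdomain vertices (corners), the end points of edges. $\mathbf W=\mathbf W_I\oplus\mathbf W_\Gamma$ (subdomain interior / subdomain boundary velocities). Since $p_\Gamma$ is empty, $Q=Q_I=\bigoplus_iQ_I^{(i)}$ contains all pressure degrees of freedom. The partially sub-assembled interface velocity space is $\widetilde{\mathbf W}_\Gamma=\mathbf W_\Pi\oplus\mathbf W_\Delta$, $\mathbf W_\Delta=\bigoplus_i\mathbf W_\Delta^{(i)}$, where $\mathbf W_\Pi$ is the continuous coarse level primal velocity space and $\mathbf W_\Delta^{(i)}$ is spanned by the remaining interface velocity basis functions of $\Omega_i$, which vanish at the primal degrees of freedom. $\mathbf W_\Pi$ is either (first choice, sufficient here) spanned by all subdomain corner velocity nodal basis functions, or (second choice) additionally spanned, on each edge $\Gamma^{ij}$, by an edge-average basis function such that $\int_{\Gamma^{ij}}\mathbf w_\Delta^{(i)}\cdot\mathbf n_{ij}=0$ for all $\mathbf w_\Delta^{(i)}\in\mathbf W_\Delta^{(i)}$ ($\mathbf n_{ij}$ a fixed normal to $\Gamma^{ij}$). $B_\Delta$ is the matrix with entries in $\{0,1,-1\}$ whose rows each have exactly one $1$ and one $-1$, corresponding to the same dual velocity degree of freedom on the interface taken from two neighboring subdomains, so that $B_\Delta\mathbf w_\Delta=0$ means continuity; non-redundant constraints are used, so $B_\Delta$ has full row rank. $\Lambda$ is the range of $B_\Delta$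 on $\mathbf W_\Delta$. $B_{\Delta,D}$ is $B_\Delta$ with each nonzero entry, corresponding to interface node $x$, multiplied by $\delta^\dagger(x)=1/\mathcal N_x$, $\mathcal N_x$ being the number of subdomains sharing $x$. Operators. $W=\mathbf W_I\oplus Q_I\oplus\mathbf W_\Delta\oplus\mathbf W_\Pi$, and, with all blocks computed subdomain by subdomain from $a$ and $b$ (i.e. from $\sum_i\int_{\Omega_i}\nabla\mathbf w\cdot\nabla\mathbf v$ and $-\sum_i\int_{\Omega_i}(\nabla\cdot\mathbf w)q$), $$\widetilde A=\begin{bmatrix}A_{II}&B_{II}^T&A_{I\Delta}&A_{I\Pi}\\ B_{II}&0&B_{I\Delta}&B_{I\Pi}\\ A_{\Delta I}&B_{I\Delta}^T&A_{\Delta\Delta}&A_{\Delta\Pi}\\ A_{\Pi I}&B_{I\Pi}^T&A_{\Pi\Delta}&A_{\Pi\Pi}\end{bmatrix},$$ where the first subscript of a $B$ block refers to the pressure and the second to the velocity. $\widetilde R_\Delta:W\to\mathbf W_\Delta$ is the restriction $(\mathbf w_I,p_I,\mathbf w_\Delta,\mathbf w_\Pi)\mapsto\mathbf w_\Delta$. If $\widetilde A$ is singular (which happens for the second choice of $\mathbf W_\Pi$; its kernel then consists of vectors with zero velocity), $\widetilde A^{-1}v$ denotes any solution of $\widetilde Az=v$; $G$ is still well defined. $M_L$ is the inverse of the symmetric positive definite $M_L^{-1}$. Function $\Phi_1$. $\widetilde W_0=\{w=(\mathbf w_I,p_I,\mathbf w_\Delta,\mathbf w_\Pi)\in W: B_{II}\mathbf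 w_I+B_{I\Delta}\mathbf w_\Delta+B_{I\Pi}\mathbf w_\Pi=0\}$; on $\widetilde W_0$ one has $\langle w,w\rangle_{\widetilde A}=\sum_i|\mathbf w^{(i)}|^2_{H^1(\Omega_i)}$, where $\mathbf w^{(i)}$ is the restriction to $\Omega_i$ of the velocity part of $w$. The jump operator is $P_{D,1}=\widetilde R_\Delta^TB_{\Delta,D}^TB_\Delta\widetilde R_\Delta:W\to W$. $\Phi_1(H/h)$ is the function such that $\langle P_{D,1}w,P_{D,1}w\rangle_{\widetilde A}\le\Phi_1(H/h)\langle w,w\rangle_{\widetilde A}$ for all $w\in\widetilde W_0$; for two-dimensional problems with $\mathbf W_\Pi$ containing the subdomain corner velocities it is known that $\Phi_1(H/h)=C(H/h)(1+\log(H/h))$. *)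

theory Defs
  imports "HOL-Analysis.Analysis"
begin

section \<open>Vectors and matrices over finite index sets\<close>

text \<open>The numbers of degrees of freedom vary with the discretization, so vectors and matrices are
  real functions on explicit finite index sets; vectors are zero off their index set.\<close>

definition vecs :: "'i set \<Rightarrow> ('i \<Rightarrow> real) set" where
  "vecs I = {x. \<forall>i. i \<notin> I \<longrightarrow> x i = 0}"

definition dot :: "'i set \<Rightarrow> ('i \<Rightarrow> real) \<Rightarrow> ('i \<Rightarrow> real) \<Rightarrow> real" where
  "dot I x y = (\<Sum>i\<in>I. x i * y i)"

definition mv :: "'i set \<Rightarrow> 'j set \<Rightarrow> ('i \<Rightarrow> 'j \<Rightarrow> real) \<Rightarrow> ('j \<Rightarrow> real) \<Rightarrow> ('i \<Rightarrow> real)" where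
  "mv I J K x = (\<lambda>i. if i \<in> I then \<Sum>j\<in>J. K i j * x j else 0)"

definition tr :: "('i \<Rightarrow> 'j \<Rightarrow> real) \<Rightarrow> 'j \<Rightarrow> 'i \<Rightarrow> real" where
  "tr K = (\<lambda>j i. K i j)"


section \<open>Plane domains and differential operators\<close>

type_synonym plane = "real^2"

text \<open>\<open>S = interior (closure S)\<close> says that \<open>S\<close> is open and rules out slits and punctures.\<close>

definition polygonal_domain :: "plane set \<Rightarrow> bool" where
  "polygonal_domain S \<longleftrightarrow>
     S \<noteq> {} \<and> connected S \<and> bounded S \<and> S = interior (closure S) \<and>
     (\<exists>F. finite F \<and> (\<forall>s\<in>F. \<exists>a b. s = closed_segment a b) \<and> frontier S = \<Union>F)"

definition divergence :: "(plane \<Rightarrow> plane) \<Rightarrow> plane \<Rightarrow> real" where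
  "divergence u y = trace (jacobian u (at y))"

text \<open>The forms \<open>a\<close> and \<open>b\<close> on a region \<open>S\<close>. The inner product of \<open>real^2^2\<close> is the
  Frobenius product. Finite element functions are differentiable off the element boundaries, a
  negligible set, so the values of the derivatives there are irrelevant.\<close>

definition form_a :: "plane set \<Rightarrow> (plane \<Rightarrow> plane) \<Rightarrow> (plane \<Rightarrow> plane) \<Rightarrow> real" where
  "form_a S u v = integral S (\<lambda>y. jacobian u (at y) \<bullet> jacobian v (at y))"

definition form_b :: "plane set \<Rightarrow> (plane \<Rightarrow> plane) \<Rightarrow> (plane \<Rightarrow> real) \<Rightarrow> real" where
  "form_b S u q = - integral S (\<lambda>y. divergence u y * q y)"

text \<open>Integral of \<open>v \<bullet> n\<close> over the arc \<open>g\<close>: the tangent \<open>g'\<close> rotated by a right angle is the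
  normal times the line element; its orientation is fixed by that of \<open>g\<close>.\<close>

definition flux :: "(real \<Rightarrow> plane) \<Rightarrow> (plane \<Rightarrow> plane) \<Rightarrow> real" where
  "flux g v = integral {0..1} (\<lambda>t. let d = vector_derivative g (at t) in
                                 v (g t) \<bullet> (vector [d $ 2, - (d $ 1)] :: plane))"


section \<open>Discretization and decomposition data\<close>

text \<open>
  \<^item> \<open>sub i\<close> for \<open>i < nsub\<close> are the subdomains; \<open>edge e\<close> for \<open>e < nedge\<close> parametrizes the closed
    edges \<open>e\<close> of the interface.
  \<^item> \<open>nodes\<close> are the velocity nodes in the open domain (the others are eliminated by the
    Dirichlet condition), \<open>phi x\<close> the scalar nodal basis function of the node \<open>x\<close>,
    extended by zero to the plane.
  \<^item> \<open>pfn m\<close> for \<open>m < npres\<close> is the pressure basis.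
  \<^item> \<open>use_avg\<close> selects the second choice of the primal space; \<open>theta e\<close> is then the edge average
    basis function of the edge \<open>e\<close>.
  \<^item> \<open>dual\<close> indexes the (continuous) dual velocity degrees of freedom by node and component and
    \<open>psi d\<close> is the basis function of \<open>d\<close>. Under the second choice the nodal basis on each edge is
    replaced by \<open>theta e\<close> and one function less than the number of nodal degrees of
    freedom; the remaining functions keep node labels on that edge.
  \<^item> \<open>Bdelta\<close> is the jump matrix with rows \<open>r < nmult\<close>; its column \<open>(i, d)\<close> is the copy of the
    dual degree of freedom \<open>d\<close> belonging to the subdomain \<open>i\<close>.\<close>

type_synonym ndof = "plane \<times> 2"

record fetidp =
  dom :: "plane set"
  mesh :: "plane set set"
  nodes :: "plane set"
  phi :: "plane \<Rightarrow> plane \<Rightarrow> real"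
  npres :: nat
  pfn :: "nat \<Rightarrow> plane \<Rightarrow> real"
  nsub :: nat
  sub :: "nat \<Rightarrow> plane set"
  nedge :: nat
  edge :: "nat \<Rightarrow> real \<Rightarrow> plane"
  use_avg :: bool
  theta :: "nat \<Rightarrow> plane \<Rightarrow> plane"
  dual :: "ndof set"
  psi :: "ndof \<Rightarrow> plane \<Rightarrow> plane"
  nmult :: nat
  Bdelta :: "nat \<Rightarrow> nat \<times> ndof \<Rightarrow> real"


subsection \<open>The mixed finite element\<close>

text \<open>\<open>\<kappa>\<close> stands for all the generic constants \<open>c\<close>, \<open>C\<close> of the standing assumptions.\<close>

definition mesh_ok :: "real \<Rightarrow> real \<Rightarrow> fetidp \<Rightarrow> bool" where
  "mesh_ok \<kappa> h D \<longleftrightarrow>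
     triangulation (mesh D) \<and> (\<forall>T\<in>mesh D. 2 simplex T) \<and> \<Union>(mesh D) = closure (dom D) \<and>
     (\<forall>T\<in>mesh D. h / \<kappa> \<le> diameter T \<and> diameter T \<le> \<kappa> * h \<and>
        (\<exists>y. ball y (diameter T / \<kappa>) \<subseteq> T))"

definition velocity_ok :: "fetidp \<Rightarrow> bool" where
  "velocity_ok D \<longleftrightarrow>
     finite (nodes D) \<and> nodes D \<subseteq> dom D \<and>
     (\<forall>x\<in>nodes D.
        continuous_on UNIV (phi D x) \<and>
        (\<forall>y. y \<notin> dom D \<longrightarrow> phi D x y = 0) \<and>
        (\<forall>T\<in>mesh D. \<exists>p. real_polynomial_function p \<and> (\<forall>y\<in>T. phi D x y = p y)) \<and>
        (\<forall>y\<in>nodes D. phi D x y = (if y = x then 1 else 0)) \<and>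
        (\<forall>T\<in>mesh D. x \<notin> T \<longrightarrow> (\<forall>y\<in>T. phi D x y = 0)))"

text \<open>All pressure degrees of freedom are interior to a subdomain (there is no interface pressure);
  no continuity is required of the pressures.\<close>

definition pressure_ok :: "fetidp \<Rightarrow> bool" where
  "pressure_ok D \<longleftrightarrow>
     (\<forall>m<npres D.
        (\<forall>T\<in>mesh D. \<exists>p. real_polynomial_function p \<and> (\<forall>y\<in>interior T. pfn D m y = p y)) \<and>
        (\<exists>i<nsub D. \<forall>y. y \<notin> sub D i \<longrightarrow> pfn D m y = 0))"

definition vphi :: "fetidp \<Rightarrow> plane \<Rightarrow> 2 \<Rightarrow> plane \<Rightarrow> plane" where
  "vphi D x k = (\<lambda>y. phi D x y *\<^sub>R axis k 1)"

definition vidx :: "fetidp \<Rightarrow> ndof set" where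
  "vidx D = nodes D \<times> UNIV"

definition pres :: "fetidp \<Rightarrow> (nat \<Rightarrow> real) \<Rightarrow> plane \<Rightarrow> real" where
  "pres D q = (\<lambda>y. \<Sum>m<npres D. q m * pfn D m y)"

definition matA :: "fetidp \<Rightarrow> ndof \<Rightarrow> ndof \<Rightarrow> real" where
  "matA D = (\<lambda>(x, k) (y, l). form_a (dom D) (vphi D x k) (vphi D y l))"

definition matB :: "fetidp \<Rightarrow> nat \<Rightarrow> ndof \<Rightarrow> real" where
  "matB D = (\<lambda>m (x, k). form_b (dom D) (vphi D x k) (pfn D m))"

definition matZ :: "fetidp \<Rightarrow> nat \<Rightarrow> nat \<Rightarrow> real" where
  "matZ D = (\<lambda>m n. integral (dom D) (\<lambda>y. pfn D m y * pfn D n y))"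

definition mass_ok :: "real \<Rightarrow> real \<Rightarrow> fetidp \<Rightarrow> bool" where
  "mass_ok \<kappa> h D \<longleftrightarrow>
     (\<forall>q\<in>vecs {..<npres D}.
        let P = {..<npres D}; z = dot P q (mv P P (matZ D) q)
        in h^2 / \<kappa> * dot P q q \<le> z \<and> z \<le> \<kappa> * h^2 * dot P q q)"

text \<open>\<open>Ker(B\<^sup>T)\<close> is the (one-dimensional) space of constant pressures; in particular the
  constants belong to the pressure space. Pressures have no significant values on the element
  boundaries.\<close>

definition pres_const :: "fetidp \<Rightarrow> (nat \<Rightarrow> real) \<Rightarrow> real \<Rightarrow> bool" where
  "pres_const D q c \<longleftrightarrow> (\<forall>T\<in>mesh D. \<forall>y\<in>interior T. pres D q y = c)"

definition kernel_ok :: "fetidp \<Rightarrow> bool" where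
  "kernel_ok D \<longleftrightarrow>
     (\<forall>q\<in>vecs {..<npres D}.
        mv (vidx D) {..<npres D} (tr (matB D)) q = (\<lambda>_. 0) \<longleftrightarrow> (\<exists>c. pres_const D q c)) \<and>
     (\<exists>q\<in>vecs {..<npres D}. pres_const D q 1)"

text \<open>The supremum is over a set of reals that is nonempty and bounded above; \<open>w = 0\<close> contributes
  \<open>0 / 0 = 0\<close>.\<close>

definition inf_sup_stable :: "real \<Rightarrow> fetidp \<Rightarrow> bool" where
  "inf_sup_stable \<beta> D \<longleftrightarrow>
     (\<forall>q\<in>vecs {..<npres D}. integral (dom D) (pres D q) = 0 \<longrightarrow>
        (SUP w\<in>vecs (vidx D).
            (dot {..<npres D} q (mv {..<npres D} (vidx D) (matB D) w))\<^sup>2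
              / dot (vidx D) w (mv (vidx D) (vidx D) (matA D) w))
        \<ge> \<beta>\<^sup>2 * dot {..<npres D} q (mv {..<npres D} {..<npres D} (matZ D) q))"


subsection \<open>Subdomains and interface\<close>

definition interface :: "fetidp \<Rightarrow> plane set" where
  "interface D = (\<Union>i<nsub D. frontier (sub D i)) - frontier (dom D)"

definition open_edge :: "fetidp \<Rightarrow> nat \<Rightarrow> plane set" where
  "open_edge D e = path_image (edge D e) - {pathstart (edge D e), pathfinish (edge D e)}"

definition corners :: "fetidp \<Rightarrow> plane set" where
  "corners D = (\<Union>e<nedge D. {pathstart (edge D e), pathfinish (edge D e)}) - frontier (dom D)"

definition subdomains_ok :: "real \<Rightarrow> real \<Rightarrow> fetidp \<Rightarrow> bool" where
  "subdomains_ok \<kappa> H D \<longleftrightarrow>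
     (\<forall>i<nsub D. polygonal_domain (sub D i) \<and> sub D i \<subseteq> dom D \<and>
        closure (sub D i) = \<Union>{T\<in>mesh D. T \<subseteq> closure (sub D i)} \<and>
        H / \<kappa> \<le> diameter (sub D i) \<and> diameter (sub D i) \<le> \<kappa> * H) \<and>
     disjoint_family_on (sub D) {..<nsub D} \<and>
     (\<Union>i<nsub D. closure (sub D i)) = closure (dom D)"

definition edges_ok :: "fetidp \<Rightarrow> bool" where
  "edges_ok D \<longleftrightarrow>
     (\<forall>e<nedge D. arc (edge D e) \<and> edge D e piecewise_C1_differentiable_on {0..1} \<and>
        (\<exists>i<nsub D. \<exists>j<nsub D. i \<noteq> j \<and>
           open_edge D e \<subseteq> frontier (sub D i) \<inter> frontier (sub D j) \<and>
           (\<forall>k<nsub D. k \<noteq> i \<longrightarrow> k \<noteq> j \<longrightarrow> open_edge D e \<inter> closure (sub D k) = {}))) \<and>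
     disjoint_family_on (open_edge D) {..<nedge D} \<and>
     (\<Union>e<nedge D. open_edge D e) \<inter> corners D = {} \<and>
     interface D = (\<Union>e<nedge D. open_edge D e) \<union> corners D"


subsection \<open>Primal and dual velocities\<close>

definition edge_nodes :: "fetidp \<Rightarrow> nat \<Rightarrow> plane set" where
  "edge_nodes D e = nodes D \<inter> open_edge D e"

definition edge_space :: "fetidp \<Rightarrow> nat \<Rightarrow> (plane \<Rightarrow> plane) set" where
  "edge_space D e =
     {v. \<exists>c. v = (\<lambda>y. \<Sum>(x, k)\<in>edge_nodes D e \<times> UNIV. c (x, k) *\<^sub>R vphi D x k y)}"

definition edge_dual :: "fetidp \<Rightarrow> nat \<Rightarrow> ndof set" where
  "edge_dual D e = {d\<in>dual D. fst d \<in> edge_nodes D e}"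

definition first_choice :: "fetidp \<Rightarrow> bool" where
  "first_choice D \<longleftrightarrow>
     dual D = (\<Union>e<nedge D. edge_nodes D e) \<times> UNIV \<and>
     (\<forall>(x, k)\<in>dual D. psi D (x, k) = vphi D x k)"

text \<open>On each edge carrying nodes, \<open>theta e\<close> and the \<open>psi d\<close> form a basis of the space spanned by
  the nodal basis functions of that edge.\<close>

definition second_choice :: "fetidp \<Rightarrow> bool" where
  "second_choice D \<longleftrightarrow>
     dual D \<subseteq> (\<Union>e<nedge D. edge_nodes D e) \<times> UNIV \<and>
     (\<forall>e<nedge D. edge_nodes D e \<noteq> {} \<longrightarrow>
        theta D e \<in> edge_space D e \<and> flux (edge D e) (theta D e) \<noteq> 0 \<and>
        (\<forall>d\<in>edge_dual D e. psi D d \<in> edge_space D e \<and> flux (edge D e) (psi D d) = 0) \<and>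
        (\<forall>v\<in>edge_space D e. \<exists>!(s, t). t \<in> vecs (edge_dual D e) \<and>
            v = (\<lambda>y. s *\<^sub>R theta D e y + (\<Sum>d\<in>edge_dual D e. t d *\<^sub>R psi D d y))))"

definition primal_ok :: "fetidp \<Rightarrow> bool" where
  "primal_ok D \<longleftrightarrow>
     corners D \<subseteq> nodes D \<and> (if use_avg D then second_choice D else first_choice D)"


section \<open>Partially sub-assembled operators\<close>

text \<open>Degrees of freedom of \<open>W = W\<^sub>I \<oplus> Q\<^sub>I \<oplus> W\<^sub>\<Delta> \<oplus> W\<^sub>\<Pi>\<close>.\<close>

datatype dof = IntV plane 2 | IntP nat | Dual nat ndof | CornerV plane 2 | EdgeV nat

definition wdelta :: "fetidp \<Rightarrow> (nat \<times> ndof) set" where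
  "wdelta D = {(i, d). i < nsub D \<and> d \<in> dual D \<and> fst d \<in> closure (sub D i)}"

definition vdofs :: "fetidp \<Rightarrow> dof set" where
  "vdofs D =
     {IntV x k |x k. x \<in> nodes D \<and> (\<exists>i<nsub D. x \<in> sub D i)} \<union>
     {Dual i d |i d. (i, d) \<in> wdelta D} \<union>
     {CornerV x k |x k. x \<in> corners D} \<union>
     {EdgeV e |e. use_avg D \<and> e < nedge D \<and> edge_nodes D e \<noteq> {}}"

definition dofs :: "fetidp \<Rightarrow> dof set" where
  "dofs D = vdofs D \<union> IntP ` {..<npres D}"

text \<open>Velocity and pressure of a basis vector of \<open>W\<close>; \<open>vel D u j\<close> is the velocity in the
  subdomain \<open>j\<close>. Only the dual functions are discontinuous across the interface.\<close>

fun vel :: "fetidp \<Rightarrow> dof \<Rightarrow> nat \<Rightarrow> plane \<Rightarrow> plane" where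
  "vel D (IntV x k) j = vphi D x k"
| "vel D (IntP m) j = (\<lambda>y. 0)"
| "vel D (Dual i d) j = (if j = i then psi D d else (\<lambda>y. 0))"
| "vel D (CornerV x k) j = vphi D x k"
| "vel D (EdgeV e) j = theta D e"

fun prs :: "fetidp \<Rightarrow> dof \<Rightarrow> plane \<Rightarrow> real" where
  "prs D (IntP m) = pfn D m"
| "prs D _ = (\<lambda>y. 0)"

text \<open>For given \<open>u\<close> and \<open>v\<close> at most one of the three summands is nonzero: they are the
  velocity-velocity blocks, the \<open>B\<^sup>T\<close> blocks and the \<open>B\<close> blocks.\<close>

definition Atilde :: "fetidp \<Rightarrow> dof \<Rightarrow> dof \<Rightarrow> real" where
  "Atilde D u v =
     (\<Sum>j<nsub D. form_a (sub D j) (vel D u j) (vel D v j)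
                 + form_b (sub D j) (vel D u j) (prs D v)
                 + form_b (sub D j) (vel D v j) (prs D u))"

definition Aop :: "fetidp \<Rightarrow> (dof \<Rightarrow> real) \<Rightarrow> dof \<Rightarrow> real" where
  "Aop D = mv (dofs D) (dofs D) (Atilde D)"

definition Aform :: "fetidp \<Rightarrow> (dof \<Rightarrow> real) \<Rightarrow> (dof \<Rightarrow> real) \<Rightarrow> real" where
  "Aform D v w = dot (dofs D) (Aop D v) w"

definition Rdelta :: "nat \<times> ndof \<Rightarrow> dof \<Rightarrow> real" where
  "Rdelta = (\<lambda>(i, d) u. if u = Dual i d then 1 else 0)"

definition Rop :: "fetidp \<Rightarrow> (dof \<Rightarrow> real) \<Rightarrow> nat \<times> ndof \<Rightarrow> real" where
  "Rop D = mv (wdelta D) (dofs D) Rdelta"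

definition RopT :: "fetidp \<Rightarrow> (nat \<times> ndof \<Rightarrow> real) \<Rightarrow> dof \<Rightarrow> real" where
  "RopT D = mv (dofs D) (wdelta D) (tr Rdelta)"


subsection \<open>Jump matrices\<close>

definition BDelta :: "fetidp \<Rightarrow> (nat \<times> ndof \<Rightarrow> real) \<Rightarrow> nat \<Rightarrow> real" where
  "BDelta D = mv {..<nmult D} (wdelta D) (Bdelta D)"

definition BDeltaT :: "fetidp \<Rightarrow> (nat \<Rightarrow> real) \<Rightarrow> nat \<times> ndof \<Rightarrow> real" where
  "BDeltaT D = mv (wdelta D) {..<nmult D} (tr (Bdelta D))"

definition jump_matrix_ok :: "fetidp \<Rightarrow> bool" where
  "jump_matrix_ok D \<longleftrightarrow>
     (\<forall>r<nmult D. \<exists>d i j. i \<noteq> j \<and> (i, d) \<in> wdelta D \<and> (j, d) \<in> wdelta D \<and>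
        (\<forall>c\<in>wdelta D. Bdelta D r c = (if c = (i, d) then 1 else if c = (j, d) then -1 else 0))) \<and>
     (\<forall>w\<in>vecs (wdelta D). BDelta D w = (\<lambda>_. 0) \<longleftrightarrow>
        (\<forall>d i j. (i, d) \<in> wdelta D \<longrightarrow> (j, d) \<in> wdelta D \<longrightarrow> w (i, d) = w (j, d))) \<and>
     (\<forall>y\<in>vecs {..<nmult D}. BDeltaT D y = (\<lambda>_. 0) \<longrightarrow> y = (\<lambda>_. 0))"

definition mult_space :: "fetidp \<Rightarrow> (nat \<Rightarrow> real) set" where
  "mult_space D = BDelta D ` vecs (wdelta D)"

definition delta_dagger :: "fetidp \<Rightarrow> plane \<Rightarrow> real" where
  "delta_dagger D x = 1 / real (card {i. i < nsub D \<and> x \<in> closure (sub D i)})"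

definition BdeltaD :: "fetidp \<Rightarrow> nat \<Rightarrow> nat \<times> ndof \<Rightarrow> real" where
  "BdeltaD D r = (\<lambda>(i, d). delta_dagger D (fst d) * Bdelta D r (i, d))"

definition BDeltaD :: "fetidp \<Rightarrow> (nat \<times> ndof \<Rightarrow> real) \<Rightarrow> nat \<Rightarrow> real" where
  "BDeltaD D = mv {..<nmult D} (wdelta D) (BdeltaD D)"

definition BDeltaDT :: "fetidp \<Rightarrow> (nat \<Rightarrow> real) \<Rightarrow> nat \<times> ndof \<Rightarrow> real" where
  "BDeltaDT D = mv (wdelta D) {..<nmult D} (tr (BdeltaD D))"


subsection \<open>The FETI-DP operator, the lumped preconditioner and the jump operator\<close>

text \<open>\<open>Asolve D v\<close> is an arbitrary solution, since \<open>Atilde D\<close> may be singular.\<close>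

definition Asolve :: "fetidp \<Rightarrow> (dof \<Rightarrow> real) \<Rightarrow> dof \<Rightarrow> real" where
  "Asolve D v = (SOME z. z \<in> vecs (dofs D) \<and> Aop D z = v)"

definition Gop :: "fetidp \<Rightarrow> (nat \<Rightarrow> real) \<Rightarrow> nat \<Rightarrow> real" where
  "Gop D x = BDelta D (Rop D (Asolve D (RopT D (BDeltaT D x))))"

definition lumped :: "fetidp \<Rightarrow> (nat \<Rightarrow> real) \<Rightarrow> nat \<Rightarrow> real" where
  "lumped D x = BDeltaD D (Rop D (Aop D (RopT D (BDeltaDT D x))))"

definition lumped_inv :: "fetidp \<Rightarrow> (nat \<Rightarrow> real) \<Rightarrow> nat \<Rightarrow> real" where
  "lumped_inv D = inv_into (mult_space D) (lumped D)"

definition jump_op :: "fetidp \<Rightarrow> (dof \<Rightarrow> real) \<Rightarrow> dof \<Rightarrow> real" where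
  "jump_op D w = RopT D (BDeltaDT D (BDelta D (Rop D w)))"

definition W0 :: "fetidp \<Rightarrow> (dof \<Rightarrow> real) set" where
  "W0 D = {w\<in>vecs (dofs D). \<forall>m<npres D. (\<Sum>u\<in>vdofs D. Atilde D (IntP m) u * w u) = 0}"

definition jump_stable :: "real \<Rightarrow> fetidp \<Rightarrow> bool" where
  "jump_stable b D \<longleftrightarrow> (\<forall>w\<in>W0 D. Aform D (jump_op D w) (jump_op D w) \<le> b * Aform D w w)"


section \<open>Admissible discretizations\<close>

definition fetidp_setting :: "plane set \<Rightarrow> real \<Rightarrow> real \<Rightarrow> real \<Rightarrow> fetidp \<Rightarrow> bool" where
  "fetidp_setting \<Omega> \<kappa> h H D \<longleftrightarrow>
     0 < h \<and> 0 < H \<and> dom D = \<Omega> \<and>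
     mesh_ok \<kappa> h D \<and> velocity_ok D \<and> pressure_ok D \<and> mass_ok \<kappa> h D \<and> kernel_ok D \<and>
     subdomains_ok \<kappa> H D \<and> edges_ok D \<and> primal_ok D \<and> jump_matrix_ok D"

end

theory Submission
  imports Defs
begin

text \<open>
  Let \<open>x = M\<^sub>L\<^sup>-\<^sup>1 \<mu>\<close> with \<open>\<mu> = G y\<close>, so that \<open>\<langle>M\<^sub>L x, x\<rangle> = \<langle>M\<^sub>L\<^sup>-\<^sup>1 \<mu>, \<mu>\<rangle>\<close>, the energy of the scaled dual
  vector \<open>B\<^sub>\<Delta>\<^sub>,\<^sub>D\<^sup>T \<mu>\<close> (\<open>lumped_form\<close>). Let \<open>z\<close> solve the partially sub-assembled
  problem with right-hand side \<open>R\<^sub>\<Delta>\<^sup>T B\<^sub>\<Delta>\<^sup>T x\<close> (\<open>multiplier_response\<close>). It satisfies the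
  divergence constraint, its jump is \<open>G x\<close>, and pairing the jump of any \<open>w\<close> with \<open>x\<close> gives the
  energy product of \<open>z\<close> and \<open>w\<close> (\<open>dot_jump_eq_Aform\<close>). In particular \<open>\<langle>G x, x\<rangle>\<close> is the energy of
  \<open>z\<close>. Both bounds are now Cauchy-Schwarz inequalities in a semidefinite energy.

  Upper bound: \<open>\<langle>G x, x\<rangle> = \<langle>M\<^sub>L\<^sup>-\<^sup>1 \<mu>, G x\<rangle>\<close>, and \<open>\<langle>M\<^sub>L\<^sup>-\<^sup>1 G x, G x\<rangle>\<close> is the energy of the jump operator
  applied to \<open>z\<close>, hence at most \<open>\<Phi>\<^sub>1\<close> times the energy of \<open>z\<close>.

  Lower bound: \<open>\<langle>M\<^sub>L x, x\<rangle> = \<langle>\<mu>, x\<rangle>\<close> is the energy product of \<open>z\<close> with any constrained \<open>w\<close> of jump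
  \<open>\<mu>\<close>, so it is enough to find such a \<open>w\<close> whose energy is at most \<open>8 / \<beta>\<^sup>2\<close> times \<open>\<langle>M\<^sub>L x, x\<rangle>\<close>
  (\<open>divergence_free_extension\<close>). The vector \<open>r = R\<^sub>\<Delta>\<^sup>T B\<^sub>\<Delta>\<^sub>,\<^sub>D\<^sup>T \<mu>\<close> has jump \<open>\<mu>\<close> and the right energy,
  but it violates the constraint. Because \<open>\<mu>\<close> lies in the range of \<open>G\<close>, it is also the jump of a
  constrained vector; the difference of the two is continuous, so the divergence of \<open>r\<close> coincides,
  when tested with discrete pressures, with that of a finite element function. Inf-sup stability
  then yields a continuous \<open>u\<close> with the same tested divergence and energy at most \<open>2 / \<beta>\<^sup>2\<close> times
  that of \<open>r\<close> (\<open>inf_sup_lifting\<close>), and \<open>w = r - u\<close>. The sum of the two energies is absorbed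
  into a single factor \<open>1 / \<beta>\<^sup>2\<close> by \<open>\<beta>\<^sup>2 \<le> 2\<close> (\<open>inf_sup_constant_le\<close>): as soon as there are two
  subdomains, some pressure is not constant, and the divergence of a vector field is pointwise
  bounded by \<open>\<surd>2\<close> times the norm of its gradient.

  The operator \<open>G\<close> is built on an arbitrary solution \<open>z\<close>, so solvability has to be
  established. By the Fredholm alternative it suffices that kernel vectors have no jump. By jump
  stability the scaled jump of a kernel vector has no energy, and the dual block is definite
  (\<open>dual_block_definite\<close>): a velocity without energy is constant on each subdomain, and dual
  velocities vanish at the end points of the edges.\<close>

section \<open>Linear algebra on finite index sets\<close>

lemma dot_commute: "dot I x y = dot I y x"
  by (simp add: dot_def mult.commute)

lemma dot_add_left: "dot I (\<lambda>i. x i + y i) z = dot I x z + dot I y z"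
  by (simp add: dot_def distrib_right sum.distrib)

lemma dot_diff_left: "dot I (\<lambda>i. x i - y i) z = dot I x z - dot I y z"
  by (simp add: dot_def left_diff_distrib sum_subtractf)

lemma dot_scale_left: "dot I (\<lambda>i. c * x i) z = c * dot I x z"
  by (simp add: dot_def sum_distrib_left mult.assoc)

lemma dot_self_nonneg: "0 \<le> dot I x x"
  unfolding dot_def by (rule sum_nonneg) simp

lemma dot_self_eq_0: "finite I \<Longrightarrow> dot I x x = 0 \<Longrightarrow> i \<in> I \<Longrightarrow> x i = 0"
  unfolding dot_def by (subst (asm) sum_nonneg_eq_0_iff) auto

lemma dot_mv_tr: "dot I (mv I J K x) y = dot J x (mv J I (tr K) y)"
proof -
  have "dot I (mv I J K x) y = (\<Sum>i\<in>I. \<Sum>j\<in>J. K i j * x j * y i)"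
    unfolding dot_def mv_def by (rule sum.cong) (simp_all add: sum_distrib_right)
  also have "\<dots> = (\<Sum>j\<in>J. \<Sum>i\<in>I. K i j * x j * y i)" by (rule sum.swap)
  also have "\<dots> = dot J x (mv J I (tr K) y)"
    unfolding dot_def mv_def tr_def
    by (rule sum.cong) (auto simp: sum_distrib_left intro!: sum.cong)
  finally show ?thesis .
qed

lemma tr_tr [simp]: "tr (tr K) = K"
  by (simp add: tr_def)

lemma mv_vecs [simp]: "mv I J K x \<in> vecs I"
  by (simp add: mv_def vecs_def)

lemma mv_diff: "mv I J K (\<lambda>j. x j - y j) = (\<lambda>i. mv I J K x i - mv I J K y i)"
  by (auto simp: mv_def right_diff_distrib sum_subtractf)

lemma mv_add: "mv I J K (\<lambda>j. x j + y j) = (\<lambda>i. mv I J K x i + mv I J K y i)"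
  by (auto simp: mv_def distrib_left sum.distrib)

lemma mv_scale: "mv I J K (\<lambda>j. c * x j) = (\<lambda>i. c * mv I J K x i)"
  by (auto simp: mv_def sum_distrib_left mult.left_commute intro!: sum.cong)

lemma vecs_eqI: "x \<in> vecs I \<Longrightarrow> y \<in> vecs I \<Longrightarrow> (\<And>i. i \<in> I \<Longrightarrow> x i = y i) \<Longrightarrow> x = y"
proof
  fix i
  assume "x \<in> vecs I" "y \<in> vecs I" "\<And>i. i \<in> I \<Longrightarrow> x i = y i"
  then show "x i = y i" by (cases "i \<in> I") (simp_all add: vecs_def)
qed

lemma vecs_zero [simp]: "(\<lambda>_. 0) \<in> vecs I"
  by (simp add: vecs_def)

lemma vecs_add: "x \<in> vecs I \<Longrightarrow> y \<in> vecs I \<Longrightarrow> (\<lambda>i. x i + y i) \<in> vecs I"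
  by (simp add: vecs_def)

lemma vecs_diff: "x \<in> vecs I \<Longrightarrow> y \<in> vecs I \<Longrightarrow> (\<lambda>i. x i - y i) \<in> vecs I"
  by (simp add: vecs_def)

lemma vecs_scale: "x \<in> vecs I \<Longrightarrow> (\<lambda>i. c * x i) \<in> vecs I"
  by (simp add: vecs_def)

text \<open>One step of the Gram-Schmidt process per vector: the new vector is replaced by
  its residual against the previous ones.\<close>
lemma orthogonal_projection_exists:
  fixes V :: "'j \<Rightarrow> 'i \<Rightarrow> real"
  assumes "finite I" "finite J"
  shows "\<exists>c. \<forall>k\<in>J. dot I (\<lambda>i. b i - (\<Sum>j\<in>J. c j * V j i)) (V k) = 0"
  using assms(2)
proof (induction J arbitrary: b rule: finite_induct)
  case empty
  show ?case by simp
next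
  case (insert l J)
  obtain a where a: "\<And>k. k \<in> J \<Longrightarrow> dot I (\<lambda>i. V l i - (\<Sum>j\<in>J. a j * V j i)) (V k) = 0"
    using insert.IH[of "V l"] by blast
  obtain c where c: "\<And>k. k \<in> J \<Longrightarrow> dot I (\<lambda>i. b i - (\<Sum>j\<in>J. c j * V j i)) (V k) = 0"
    using insert.IH[of b] by blast
  define r where "r = (\<lambda>i. V l i - (\<Sum>j\<in>J. a j * V j i))"
  define s where "s = (\<lambda>i. b i - (\<Sum>j\<in>J. c j * V j i))"
  \<comment> \<open>If \<open>r = 0\<close>, then \<open>V l\<close> is redundant, and the totalized quotient \<open>t = 0\<close> leaves \<open>s\<close> alone.\<close>
  define t where "t = dot I s r / dot I r r"
  define c' where "c' = (\<lambda>j. if j = l then t else c j - t * a j)"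
  have sum_c': "(\<Sum>j\<in>insert l J. c' j * V j i) = (\<Sum>j\<in>J. c j * V j i) + t * r i" for i
  proof -
    have "(\<Sum>j\<in>J. c' j * V j i) = (\<Sum>j\<in>J. c j * V j i - t * (a j * V j i))"
      by (rule sum.cong) (use insert.hyps in \<open>auto simp: c'_def algebra_simps\<close>)
    then show ?thesis
      using insert.hyps
      by (simp add: c'_def r_def sum_subtractf sum_distrib_left right_diff_distrib)
  qed
  have res: "(\<lambda>i. b i - (\<Sum>j\<in>insert l J. c' j * V j i)) = (\<lambda>i. s i - t * r i)"
    unfolding sum_c' by (simp add: s_def fun_eq_iff)
  have orth_J: "dot I (\<lambda>i. s i - t * r i) (V k) = 0" if "k \<in> J" for k
    using a[OF that] c[OF that] by (simp add: dot_diff_left dot_scale_left r_def s_def)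
  have orth_r: "dot I (\<lambda>i. s i - t * r i) r = 0"
  proof (cases "dot I r r = 0")
    case True
    then have "r i = 0" if "i \<in> I" for i using dot_self_eq_0[OF assms(1)] that by blast
    then have "dot I x r = 0" for x by (simp add: dot_def)
    then show ?thesis by simp
  next
    case False
    have "dot I (\<lambda>i. s i - t * r i) r = dot I s r - t * dot I r r"
      by (simp only: dot_diff_left dot_scale_left)
    with False show ?thesis by (simp add: t_def)
  qed
  have "dot I x (V l) = dot I x r + (\<Sum>j\<in>J. a j * dot I x (V j))" for x
  proof -
    have "dot I (\<lambda>i. \<Sum>j\<in>J. a j * V j i) x = (\<Sum>j\<in>J. a j * dot I (V j) x)"
      unfolding dot_def sum_distrib_right sum_distrib_left
      by (subst sum.swap) (simp add: mult.assoc)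
    moreover have "dot I r x = dot I (V l) x - dot I (\<lambda>i. \<Sum>j\<in>J. a j * V j i) x"
      by (simp add: r_def dot_diff_left)
    ultimately show ?thesis by (simp add: dot_commute[of I x])
  qed
  then have "dot I (\<lambda>i. s i - t * r i) (V l) = 0"
    using orth_r orth_J by simp
  then show ?case
    unfolding res[symmetric] using orth_J[folded res] by (intro exI[of _ c']) auto
qed

text \<open>The Fredholm alternative. The residual of the least squares solution is orthogonal to the
  columns of \<open>K\<close>, hence a kernel vector by symmetry; being orthogonal to \<open>b\<close> as well, it vanishes.\<close>
lemma symmetric_system_solvable:
  assumes fin: "finite I" and sym: "\<And>i j. i \<in> I \<Longrightarrow> j \<in> I \<Longrightarrow> K i j = K j i"
    and b: "b \<in> vecs I"
    and orth: "\<And>r. r \<in> vecs I \<Longrightarrow> mv I I K r = (\<lambda>_. 0) \<Longrightarrow> dot I r b = 0"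
  shows "\<exists>z\<in>vecs I. mv I I K z = b"
proof -
  obtain c where c: "\<And>k. k \<in> I \<Longrightarrow> dot I (\<lambda>i. b i - (\<Sum>j\<in>I. c j * K i j)) (\<lambda>i. K i k) = 0"
    using orthogonal_projection_exists[OF fin fin, of b "\<lambda>j i. K i j"] by blast
  define z where "z = (\<lambda>i. if i \<in> I then c i else 0)"
  define r where "r = (\<lambda>i. b i - mv I I K z i)"
  have z: "z \<in> vecs I" by (simp add: z_def vecs_def)
  have r: "r \<in> vecs I" unfolding r_def by (rule vecs_diff[OF b mv_vecs])
  have r_eq: "r i = b i - (\<Sum>j\<in>I. c j * K i j)" if "i \<in> I" for i
    using that by (auto simp: r_def mv_def z_def mult.commute intro!: sum.cong)
  have "mv I I K r = (\<lambda>_. 0)"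
  proof (rule vecs_eqI[OF mv_vecs vecs_zero])
    fix k assume k: "k \<in> I"
    have "mv I I K r k = (\<Sum>i\<in>I. r i * K i k)"
      using k sym by (auto simp: mv_def mult.commute intro!: sum.cong)
    also have "\<dots> = dot I (\<lambda>i. b i - (\<Sum>j\<in>I. c j * K i j)) (\<lambda>i. K i k)"
      unfolding dot_def by (rule sum.cong) (simp_all add: r_eq)
    finally show "mv I I K r k = 0" using c[OF k] by simp
  qed
  then have rb: "dot I r b = 0" and rK: "dot I (mv I I K r) z = 0"
    using orth[OF r] by (simp_all add: dot_def)
  have "mv I I (tr K) z = mv I I K z"
    using sym by (auto simp: mv_def tr_def fun_eq_iff intro!: sum.cong)
  then have "dot I r (mv I I K z) = 0"
    using rK by (simp add: dot_mv_tr)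
  moreover have "dot I r r = dot I b r - dot I (mv I I K z) r"
    using dot_diff_left[of I b "mv I I K z" r] by (simp flip: r_def)
  ultimately have "dot I r r = 0"
    using rb dot_commute[of I r b] dot_commute[of I r "mv I I K z"] by linarith
  then have "\<And>i. i \<in> I \<Longrightarrow> r i = 0" using dot_self_eq_0[OF fin] by blast
  then have "mv I I K z = b"
    by (intro vecs_eqI[OF mv_vecs b]) (auto simp: r_def)
  with z show ?thesis by blast
qed

text \<open>The Cauchy-Schwarz inequality for semidefinite forms in the shape in which
  it is used: the quadratic polynomial is the form evaluated at \<open>v + t w\<close>.\<close>
lemma discriminant_le:
  fixes a b c :: real
  assumes "\<And>t. 0 \<le> a + 2 * t * b + t\<^sup>2 * c"
  shows "b\<^sup>2 \<le> a * c"
proof (cases "c = 0")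
  case True
  have "b = 0"
  proof (rule ccontr)
    assume "b \<noteq> 0"
    then show False using assms[of "- (a + 1) / (2 * b)"] True by (simp add: field_simps)
  qed
  with True show ?thesis by simp
next
  case False
  have "c > 0"
  proof (rule ccontr)
    assume "\<not> c > 0"
    then have c: "c < 0" using False by simp
    have a: "0 \<le> a" using assms[of 0] by simp
    have "0 \<le> 2 * a + 2 * t\<^sup>2 * c" for t
      using assms[of t] assms[of "-t"] by simp
    from this[of "sqrt ((a + 1) / (- c))"] show False
      using c a by (simp add: field_simps)
  qed
  then show ?thesis using assms[of "- b / c"] by (simp add: field_simps power2_eq_square)
qed

lemma psd_cauchy_schwarz:
  assumes sym: "\<And>i j. i \<in> I \<Longrightarrow> j \<in> I \<Longrightarrow> A i j = A j i"
    and psd: "\<And>u. u \<in> vecs I \<Longrightarrow> 0 \<le> dot I u (mv I I A u)"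
    and u: "u \<in> vecs I" and w: "w \<in> vecs I"
  shows "(dot I w (mv I I A u))\<^sup>2 \<le> dot I w (mv I I A w) * dot I u (mv I I A u)"
proof (rule discriminant_le)
  fix t
  have "mv I I (tr A) x = mv I I A x" for x
    using sym by (auto simp: mv_def tr_def fun_eq_iff intro!: sum.cong)
  then have comm: "dot I x (mv I I A y) = dot I y (mv I I A x)" for x y
    by (subst dot_commute) (simp add: dot_mv_tr)
  have "dot I (\<lambda>i. w i + t * u i) (mv I I A (\<lambda>i. w i + t * u i))
      = dot I w (mv I I A (\<lambda>i. w i + t * u i)) + t * dot I u (mv I I A (\<lambda>i. w i + t * u i))"
    by (simp add: dot_add_left dot_scale_left)
  also have "\<dots> = dot I w (mv I I A w) + 2 * t * dot I w (mv I I A u) + t\<^sup>2 * dot I u (mv I I A u)"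
    unfolding comm[of _ "\<lambda>i. w i + t * u i"]
    by (simp add: dot_add_left dot_scale_left comm[of u w] power2_eq_square algebra_simps)
  finally show "0 \<le> dot I w (mv I I A w) + 2 * t * dot I w (mv I I A u) + t\<^sup>2 * dot I u (mv I I A u)"
    using psd[OF vecs_add[OF w vecs_scale[OF u]], of t] by simp
qed

text \<open>The right-hand side lies in the range of \<open>B\<close>, which makes the singular saddle point system
  consistent: for a kernel vector \<open>(u, p)\<close> the energy of \<open>u\<close> is zero, so \<open>A u = 0\<close>, so \<open>B\<^sup>T p = 0\<close>,
  and \<open>p\<close> is orthogonal to \<open>B v\<close>.\<close>
lemma saddle_point_solvable:
  fixes A :: "'a \<Rightarrow> 'a \<Rightarrow> real" and B :: "'b \<Rightarrow> 'a \<Rightarrow> real"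
  assumes I: "finite I" and P: "finite P"
    and sym: "\<And>i j. i \<in> I \<Longrightarrow> j \<in> I \<Longrightarrow> A i j = A j i"
    and psd: "\<And>u. u \<in> vecs I \<Longrightarrow> 0 \<le> dot I u (mv I I A u)"
  obtains u p where "u \<in> vecs I" "p \<in> vecs P" "mv P I B u = mv P I B v"
    "\<And>i. i \<in> I \<Longrightarrow> mv I I A u i + mv I P (tr B) p i = 0"
proof -
  define J where "J = I <+> P"
  define K where "K = (\<lambda>a b. case a of
      Inl i \<Rightarrow> (case b of Inl j \<Rightarrow> A i j | Inr n \<Rightarrow> B n i)
    | Inr m \<Rightarrow> (case b of Inl j \<Rightarrow> B m j | Inr n \<Rightarrow> 0))"
  define g :: "'a + 'b \<Rightarrow> real" where "g = case_sum (\<lambda>_. 0) (mv P I B v)"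
  have rows: "mv J J K r (Inl i) = mv I I A (r \<circ> Inl) i + mv I P (tr B) (r \<circ> Inr) i" if "i \<in> I" for r i
    using that I P by (simp add: mv_def J_def K_def tr_def sum.Plus InlI)
  have rowsP: "mv J J K r (Inr m) = mv P I B (r \<circ> Inl) m" if "m \<in> P" for r m
    using that I P by (simp add: mv_def J_def K_def sum.Plus InrI)
  have "\<exists>z\<in>vecs J. mv J J K z = g"
  proof (rule symmetric_system_solvable)
    show "finite J" using I P by (simp add: J_def)
    show "K a b = K b a" if "a \<in> J" "b \<in> J" for a b
      using that sym by (auto simp: J_def K_def)
    show "g \<in> vecs J"
      by (auto simp: vecs_def g_def J_def mv_def split: sum.splits)
    fix r assume r: "r \<in> vecs J" and Kr: "mv J J K r = (\<lambda>_. 0)"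
    define u where "u = r \<circ> Inl"
    define p where "p = r \<circ> Inr"
    have u: "u \<in> vecs I" using r by (auto simp: u_def vecs_def J_def)
    have Au: "mv I I A u i = - mv I P (tr B) p i" if "i \<in> I" for i
      using rows[OF that, of r] Kr by (simp add: u_def p_def)
    have Bu: "mv P I B u = (\<lambda>_. 0)"
      by (rule vecs_eqI[of _ P]) (use rowsP[of _ r] Kr in \<open>simp_all add: u_def\<close>)
    have "dot I u (mv I I A u) = - dot I u (mv I P (tr B) p)"
      unfolding dot_def sum_negf[symmetric] by (rule sum.cong) (simp_all add: Au)
    also have "dot I u (mv I P (tr B) p) = dot P (mv P I B u) p" by (simp add: dot_mv_tr)
    finally have "dot I u (mv I I A u) = 0" by (simp add: Bu dot_def)
    then have "(dot I (mv I I A u) (mv I I A u))\<^sup>2 \<le> 0"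
      using psd_cauchy_schwarz[OF sym psd u mv_vecs[of I I A u]] by simp
    then have Au0: "mv I I A u i = 0" if "i \<in> I" for i
      using dot_self_eq_0[OF I _ that] by simp
    have "dot J r g = dot P p (mv P I B v)"
      using I P by (simp add: dot_def J_def g_def p_def sum.Plus)
    also have "\<dots> = dot I v (mv I P (tr B) p)"
      by (subst dot_commute) (simp add: dot_mv_tr)
    also have "\<dots> = 0" using Au Au0 by (auto simp: dot_def intro!: sum.neutral)
    finally show "dot J r g = 0" .
  qed
  then obtain z where z: "z \<in> vecs J" "mv J J K z = g" by blast
  show ?thesis
  proof (rule that)
    show "z \<circ> Inl \<in> vecs I" "z \<circ> Inr \<in> vecs P" using z(1) by (auto simp: vecs_def J_def)
    show "mv P I B (z \<circ> Inl) = mv P I B v"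
      by (rule vecs_eqI[of _ P]) (use rowsP[of _ z] z(2) in \<open>simp_all add: g_def\<close>)
    show "mv I I A (z \<circ> Inl) i + mv I P (tr B) (z \<circ> Inr) i = 0" if "i \<in> I" for i
      using rows[OF that, of z] z(2) by (simp add: g_def)
  qed
qed


section \<open>Jacobians and piecewise smooth functions on a mesh\<close>

lemma jacobian_eqI:
  fixes f :: "plane \<Rightarrow> plane"
  assumes "(f has_derivative (\<lambda>h. M *v h)) (at y)"
  shows "jacobian f (at y) = M"
  using frechet_derivative_at[OF assms] by (simp add: jacobian_def matrix_of_matrix_vector_mul flip: frechet_derivative_at[OF assms])

lemma jacobian_add:
  fixes f g :: "plane \<Rightarrow> plane"
  assumes "f differentiable at y" "g differentiable at y"
  shows "jacobian (\<lambda>x. f x + g x) (at y) = jacobian f (at y) + jacobian g (at y)"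
  using has_derivative_add[OF assms[unfolded jacobian_works]]
  by (intro jacobian_eqI) (simp add: matrix_vector_mult_add_rdistrib)

lemma jacobian_scale:
  fixes f :: "plane \<Rightarrow> plane"
  assumes "f differentiable at y"
  shows "jacobian (\<lambda>x. c *\<^sub>R f x) (at y) = c *\<^sub>R jacobian f (at y)"
  using has_derivative_scaleR_right[OF assms[unfolded jacobian_works], of c]
  by (intro jacobian_eqI) (simp add: scaleR_matrix_vector_assoc)

lemma jacobian_zero: "jacobian (\<lambda>_. 0 :: plane) (at (y :: plane)) = 0"
  by (rule jacobian_eqI) simp

lemma jacobian_cong_open:
  fixes f g :: "plane \<Rightarrow> plane"
  assumes "open S" "y \<in> S" "\<And>x. x \<in> S \<Longrightarrow> f x = g x"
  shows "jacobian f (at y) = jacobian g (at y)"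
proof -
  have "(f has_derivative d) (at y) \<longleftrightarrow> (g has_derivative d) (at y)" for d
    using has_derivative_transform_within_open[OF _ assms(1,2), of f d UNIV g]
      has_derivative_transform_within_open[OF _ assms(1,2), of g d UNIV f] assms(3) by auto
  then show ?thesis by (simp add: jacobian_def frechet_derivative_def)
qed

lemma trace_sq_le: "(trace (M :: real^2^2))\<^sup>2 \<le> 2 * (M \<bullet> M)"
proof -
  \<comment> \<open>The difference of the two sides.\<close>
  have "0 \<le> (M$1$1 - M$2$2)\<^sup>2 + 2 * (M$1$2)\<^sup>2 + 2 * (M$2$1)\<^sup>2" by simp
  then show ?thesis
    by (simp add: trace_def inner_vec_def sum_2 power2_eq_square algebra_simps)
qed

lemma real_polynomial_gradient:
  fixes p :: "plane \<Rightarrow> real"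
  assumes "real_polynomial_function p"
  shows "\<exists>g. continuous_on UNIV g \<and> (\<forall>y. (p has_derivative (\<lambda>v. g y \<bullet> v)) (at y))"
  using assms
proof induction
  case (linear f)
  define a where "a = (\<Sum>b\<in>Basis. f b *\<^sub>R b)"
  have "f v = a \<bullet> v" for v
  proof -
    interpret bounded_linear f by (rule linear)
    have "f v = f (\<Sum>b\<in>Basis. (v \<bullet> b) *\<^sub>R b)" by (simp add: euclidean_representation)
    also have "\<dots> = (\<Sum>b\<in>Basis. (v \<bullet> b) * f b)" by (simp add: sum scaleR)
    also have "\<dots> = a \<bullet> v" by (simp add: a_def inner_sum_left inner_commute[of v] mult.commute)
    finally show ?thesis .
  qed
  then have "f = (\<lambda>v. a \<bullet> v)" by auto
  then show ?case
    by (intro exI[of _ "\<lambda>_. a"]) (auto intro: bounded_linear_imp_has_derivative bounded_linear_inner_right)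
next
  case (const c)
  then show ?case by (intro exI[of _ "\<lambda>_. 0"]) auto
next
  case (add f g)
  then obtain F G where
    "continuous_on UNIV F" "\<forall>y. (f has_derivative (\<lambda>v. F y \<bullet> v)) (at y)"
    "continuous_on UNIV G" "\<forall>y. (g has_derivative (\<lambda>v. G y \<bullet> v)) (at y)" by blast
  then show ?case
    by (intro exI[of _ "\<lambda>y. F y + G y"])
      (auto intro!: continuous_intros derivative_eq_intros simp: inner_add_left)
next
  case (mult f g)
  then obtain F G where FG:
    "continuous_on UNIV F" "\<And>y. (f has_derivative (\<lambda>v. F y \<bullet> v)) (at y)"
    "continuous_on UNIV G" "\<And>y. (g has_derivative (\<lambda>v. G y \<bullet> v)) (at y)" by blast
  have "continuous_on UNIV f" "continuous_on UNIV g"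
    using FG(2,4) by (meson has_derivative_continuous continuous_at_imp_continuous_on)+
  moreover have "((\<lambda>y. f y * g y) has_derivative (\<lambda>v. (f y *\<^sub>R G y + g y *\<^sub>R F y) \<bullet> v)) (at y)" for y
    using has_derivative_mult[OF FG(2,4), of y]
    by (simp add: inner_add_left mult.commute)
  ultimately show ?case
    using FG(1,3) by (intro exI[of _ "\<lambda>y. f y *\<^sub>R G y + g y *\<^sub>R F y"]) (auto intro!: continuous_intros)
qed

text \<open>Only values in the interior of the cells count, since derivatives of finite element functions
  and pressures are not controlled on the skeleton of the mesh. The extension to the closed cell
  provides boundedness.\<close>
definition pw_continuous :: "plane set set \<Rightarrow> (plane \<Rightarrow> real) \<Rightarrow> bool" where
  "pw_continuous \<T> F \<longleftrightarrow> (\<forall>T\<in>\<T>. \<exists>g. continuous_on T g \<and> (\<forall>y\<in>interior T. F y = g y))"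

definition pw_smooth :: "plane set set \<Rightarrow> (plane \<Rightarrow> plane) \<Rightarrow> bool" where
  "pw_smooth \<T> f \<longleftrightarrow> (\<forall>T\<in>\<T>. \<forall>y\<in>interior T. f differentiable at y) \<and>
     (\<forall>i k. pw_continuous \<T> (\<lambda>y. jacobian f (at y) $ i $ k))"

lemma pw_continuous_cong:
  assumes "pw_continuous \<T> F" "\<And>T y. T \<in> \<T> \<Longrightarrow> y \<in> interior T \<Longrightarrow> G y = F y"
  shows "pw_continuous \<T> G"
  using assms unfolding pw_continuous_def by metis

lemma pw_continuous_const: "pw_continuous \<T> (\<lambda>_. c)"
  unfolding pw_continuous_def by (intro ballI exI[of _ "\<lambda>_. c"]) auto

lemma pw_continuous_add:
  assumes "pw_continuous \<T> F" "pw_continuous \<T> G"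
  shows "pw_continuous \<T> (\<lambda>y. F y + G y)"
  unfolding pw_continuous_def
proof
  fix T assume "T \<in> \<T>"
  then obtain f g where "continuous_on T f" "\<forall>y\<in>interior T. F y = f y"
    "continuous_on T g" "\<forall>y\<in>interior T. G y = g y"
    using assms unfolding pw_continuous_def by metis
  then show "\<exists>g. continuous_on T g \<and> (\<forall>y\<in>interior T. F y + G y = g y)"
    by (intro exI[of _ "\<lambda>y. f y + g y"]) (auto intro!: continuous_intros)
qed

lemma pw_continuous_mult:
  assumes "pw_continuous \<T> F" "pw_continuous \<T> G"
  shows "pw_continuous \<T> (\<lambda>y. F y * G y)"
  unfolding pw_continuous_def
proof
  fix T assume "T \<in> \<T>"
  then obtain f g where "continuous_on T f" "\<forall>y\<in>interior T. F y = f y"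
    "continuous_on T g" "\<forall>y\<in>interior T. G y = g y"
    using assms unfolding pw_continuous_def by metis
  then show "\<exists>g. continuous_on T g \<and> (\<forall>y\<in>interior T. F y * G y = g y)"
    by (intro exI[of _ "\<lambda>y. f y * g y"]) (auto intro!: continuous_intros)
qed

lemma pw_continuous_sum:
  "(\<And>i. i \<in> I \<Longrightarrow> pw_continuous \<T> (F i)) \<Longrightarrow> pw_continuous \<T> (\<lambda>y. \<Sum>i\<in>I. F i y)"
  by (induction I rule: infinite_finite_induct)
    (auto intro: pw_continuous_const pw_continuous_add)

lemmas pw_continuous_intros =
  pw_continuous_const pw_continuous_add pw_continuous_mult pw_continuous_sum

lemma pw_smooth_zero: "pw_smooth \<T> (\<lambda>_. 0)"
  by (simp add: pw_smooth_def jacobian_zero pw_continuous_const)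

lemma pw_smooth_differentiable:
  "pw_smooth \<T> f \<Longrightarrow> T \<in> \<T> \<Longrightarrow> y \<in> interior T \<Longrightarrow> f differentiable at y"
  by (auto simp: pw_smooth_def)

lemma pw_smooth_jacobian: "pw_smooth \<T> f \<Longrightarrow> pw_continuous \<T> (\<lambda>y. jacobian f (at y) $ i $ k)"
  by (auto simp: pw_smooth_def)

lemma pw_smooth_add:
  assumes "pw_smooth \<T> f" "pw_smooth \<T> g"
  shows "pw_smooth \<T> (\<lambda>y. f y + g y)"
  unfolding pw_smooth_def
proof (intro conjI ballI allI)
  show "(\<lambda>y. f y + g y) differentiable at y" if "T \<in> \<T>" "y \<in> interior T" for T y
    using assms that by (auto intro: differentiable_add pw_smooth_differentiable)
  show "pw_continuous \<T> (\<lambda>y. jacobian (\<lambda>y. f y + g y) (at y) $ i $ k)" for i k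
    by (rule pw_continuous_cong[OF pw_continuous_add[OF assms[THEN pw_smooth_jacobian]]])
      (use assms in \<open>simp add: jacobian_add[OF assms[THEN pw_smooth_differentiable]]\<close>)
qed

lemma pw_smooth_scale:
  assumes "pw_smooth \<T> f"
  shows "pw_smooth \<T> (\<lambda>y. c *\<^sub>R f y)"
  unfolding pw_smooth_def
proof (intro conjI ballI allI)
  show "(\<lambda>y. c *\<^sub>R f y) differentiable at y" if "T \<in> \<T>" "y \<in> interior T" for T y
    using pw_smooth_differentiable[OF assms that] by simp
  show "pw_continuous \<T> (\<lambda>y. jacobian (\<lambda>y. c *\<^sub>R f y) (at y) $ i $ k)" for i k
    by (rule pw_continuous_cong[OF pw_continuous_mult[OF pw_continuous_const[of _ c]
            pw_smooth_jacobian[OF assms, of i k]]])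
      (use assms in \<open>simp add: jacobian_scale[OF pw_smooth_differentiable[OF assms]]\<close>)
qed

lemma pw_smooth_sum:
  "(\<And>i. i \<in> I \<Longrightarrow> pw_smooth \<T> (f i)) \<Longrightarrow> pw_smooth \<T> (\<lambda>y. \<Sum>i\<in>I. c i *\<^sub>R f i y)"
  by (induction I rule: infinite_finite_induct)
    (simp_all add: pw_smooth_zero pw_smooth_add pw_smooth_scale)

text \<open>The continuity of the jacobian up to the boundary of a cell comes from the gradient of the
  polynomial that represents the function there.\<close>
lemma pw_smooth_polynomial:
  fixes f :: "plane \<Rightarrow> real"
  assumes "\<And>T. T \<in> \<T> \<Longrightarrow> \<exists>p. real_polynomial_function p \<and> (\<forall>y\<in>T. f y = p y)"
  shows "pw_smooth \<T> (\<lambda>y. f y *\<^sub>R a)"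
proof -
  have local_form: "\<exists>g. continuous_on UNIV g \<and> (\<forall>y\<in>interior T. (\<lambda>y. f y *\<^sub>R a) differentiable at y \<and>
      jacobian (\<lambda>y. f y *\<^sub>R a) (at y) = (\<chi> i k. g y $ k * a $ i))" if T: "T \<in> \<T>" for T
  proof -
    obtain p where p: "real_polynomial_function p" "\<And>y. y \<in> T \<Longrightarrow> f y = p y"
      using assms[OF T] by blast
    obtain g where g: "continuous_on UNIV g" "\<And>y. (p has_derivative (\<lambda>v. g y \<bullet> v)) (at y)"
      using real_polynomial_gradient[OF p(1)] by blast
    have d: "((\<lambda>y. f y *\<^sub>R a) has_derivative (\<lambda>v. (\<chi> i k. g y $ k * a $ i) *v v)) (at y)"
      if y: "y \<in> interior T" for y
    proof -
      have eq: "(\<lambda>v. (\<chi> i k. g y $ k * a $ i) *v v) = (\<lambda>v. (g y \<bullet> v) *\<^sub>R a)"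
        by (auto simp: matrix_vector_mult_def vec_eq_iff inner_vec_def sum_distrib_left
            sum_distrib_right mult_ac)
      have "((\<lambda>y. p y *\<^sub>R a) has_derivative (\<lambda>v. (g y \<bullet> v) *\<^sub>R a)) (at y)"
        using has_derivative_scaleR_left[OF g(2)] .
      then show ?thesis
        unfolding eq
        by (rule has_derivative_transform_within_open[OF _ open_interior y])
          (use p(2) interior_subset[of T] in \<open>auto simp: subset_iff\<close>)
    qed
    show ?thesis
      using g(1) d jacobian_eqI[OF d] by (intro exI[of _ g]) (auto simp: differentiable_def)
  qed
  show ?thesis
    unfolding pw_smooth_def pw_continuous_def
  proof (intro conjI ballI allI)
    show "(\<lambda>y. f y *\<^sub>R a) differentiable at y" if "T \<in> \<T>" "y \<in> interior T" for T y
      using local_form[OF that(1)] that(2) by blast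
    show "\<exists>h. continuous_on T h \<and> (\<forall>y\<in>interior T. jacobian (\<lambda>y. f y *\<^sub>R a) (at y) $ i $ k = h y)"
      if T: "T \<in> \<T>" for T i k
    proof -
      obtain g where "continuous_on UNIV g"
        "\<forall>y\<in>interior T. jacobian (\<lambda>y. f y *\<^sub>R a) (at y) = (\<chi> i k. g y $ k * a $ i)"
        using local_form[OF T] by blast
      then show ?thesis
        by (intro exI[of _ "\<lambda>y. g y $ k * a $ i"])
          (auto intro!: continuous_intros intro: continuous_on_subset)
    qed
  qed
qed


section \<open>The forms on unions of mesh cells\<close>

text \<open>The subdomains and the whole domain are treated alike: a region is an open set filled by
  cells up to a negligible set.\<close>
definition region :: "plane set set \<Rightarrow> plane set \<Rightarrow> bool" where
  "region \<T> S \<longleftrightarrow> open S \<and> negligible (frontier S) \<and> closure S = \<Union>{T\<in>\<T>. T \<subseteq> closure S}"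

lemma polygonal_domain_open: "polygonal_domain S \<Longrightarrow> open S"
  unfolding polygonal_domain_def by (metis open_interior)

lemma negligible_segment: "negligible (closed_segment a (b :: plane))"
proof -
  have "interior (closed_segment a b) = {}"
    by (simp add: interior_closed_segment_ge2)
  then show ?thesis
    using negligible_convex_frontier[OF convex_closed_segment[of a b]] by (simp add: frontier_def)
qed

lemma polygonal_domain_negligible_frontier: "polygonal_domain S \<Longrightarrow> negligible (frontier S)"
  unfolding polygonal_domain_def by (auto intro!: negligible_Union negligible_segment)

locale plane_mesh =
  fixes \<T> :: "plane set set"
  assumes finite_mesh: "finite \<T>"
    and convex_cell: "T \<in> \<T> \<Longrightarrow> convex T"
    and compact_cell: "T \<in> \<T> \<Longrightarrow> compact T"
    and interior_cell: "T \<in> \<T> \<Longrightarrow> interior T \<noteq> {}"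
begin

lemma cell_closure_interior: "T \<in> \<T> \<Longrightarrow> closure (interior T) = T"
  using convex_closure_interior[OF convex_cell interior_cell] compact_cell
  by (metis closure_closed compact_imp_closed)

definition skeleton :: "plane set" where
  "skeleton = (\<Union>T\<in>\<T>. frontier T)"

lemma negligible_skeleton: "negligible skeleton"
  unfolding skeleton_def
  using finite_mesh convex_cell by (auto intro!: negligible_Union negligible_convex_frontier)

lemma region_off_skeleton:
  assumes "region \<T> S" "y \<in> S" "y \<notin> skeleton"
  obtains T where "T \<in> \<T>" "T \<subseteq> closure S" "y \<in> interior T"
proof -
  have "y \<in> \<Union>{T\<in>\<T>. T \<subseteq> closure S}"
    using assms(1,2) closure_subset[of S] unfolding region_def by blast
  then obtain T where T: "T \<in> \<T>" "T \<subseteq> closure S" "y \<in> T" by blast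
  then have "y \<in> interior T"
    using assms(3) closure_subset[of T] by (auto simp: skeleton_def frontier_def)
  with T that show ?thesis by blast
qed

lemma region_integral_cong:
  assumes "region \<T> S"
    and "\<And>T y. T \<in> \<T> \<Longrightarrow> y \<in> S \<Longrightarrow> y \<in> interior T \<Longrightarrow> F y = G y"
  shows "integral S F = integral S G"
proof (rule integral_spike[OF negligible_skeleton])
  fix y assume "y \<in> S - skeleton"
  then obtain T where "T \<in> \<T>" "y \<in> S" "y \<in> interior T"
    using region_off_skeleton[OF assms(1), of y] by blast
  then show "G y = F y" using assms(2) by simp
qed

lemma cell_integrable:
  assumes "pw_continuous \<T> F" "T \<in> \<T>"
  shows "F absolutely_integrable_on T"
proof -
  obtain g where g: "continuous_on T g" "\<And>y. y \<in> interior T \<Longrightarrow> F y = g y"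
    using assms unfolding pw_continuous_def by blast
  have "integrable lborel (\<lambda>x. indicator T x *\<^sub>R g x)"
    by (rule borel_integrable_compact[OF compact_cell[OF assms(2)] g(1)])
  then have "g absolutely_integrable_on T"
    unfolding set_integrable_def using borel_measurable_integrable
    by (subst integrable_completion) auto
  then show ?thesis
    by (rule absolutely_integrable_spike[OF _ negligible_convex_frontier[OF convex_cell[OF assms(2)]]])
      (use g(2) closure_subset[of T] in \<open>auto simp: frontier_def\<close>)
qed

lemma pw_continuous_absolutely_integrable:
  assumes "pw_continuous \<T> F" "region \<T> S"
  shows "F absolutely_integrable_on S"
proof -
  have "F absolutely_integrable_on (\<Union>T\<in>{T\<in>\<T>. T \<subseteq> closure S}. T)"
    using finite_mesh compact_cell cell_integrable[OF assms(1)]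
    by (intro set_integrable_UN) (auto simp: lmeasurable_compact fmeasurableD)
  then have "F absolutely_integrable_on closure S"
    using assms(2) by (simp add: region_def)
  then show ?thesis
    by (rule absolutely_integrable_spike_set)
      (use assms(2) closure_subset[of S] interior_open[of S] in
        \<open>auto simp: region_def frontier_def intro: negligible_subset\<close>)
qed

lemma pw_continuous_integrable:
  "pw_continuous \<T> F \<Longrightarrow> region \<T> S \<Longrightarrow> F integrable_on S"
  using pw_continuous_absolutely_integrable absolutely_integrable_on_def by blast

lemma region_integral_nonneg:
  assumes "pw_continuous \<T> F" "region \<T> S" "\<And>y. 0 \<le> F y"
  shows "0 \<le> integral S F"
  using assms pw_continuous_integrable by (blast intro: integral_nonneg)

lemma region_integral_lin:
  assumes "pw_continuous \<T> F" "pw_continuous \<T> G" "region \<T> S"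
  shows "integral S (\<lambda>y. c * F y + d * G y) = c * integral S F + d * integral S G"
proof -
  have "(\<lambda>y. c * F y) integrable_on S" "(\<lambda>y. d * G y) integrable_on S"
    using assms pw_continuous_mult[OF pw_continuous_const] pw_continuous_integrable by blast+
  then show ?thesis by (simp add: integral_add)
qed

lemma integral_decomposition:
  fixes n :: nat
  assumes F: "pw_continuous \<T> F" and reg: "\<And>j. j < n \<Longrightarrow> region \<T> (S j)" and \<Omega>: "region \<T> \<Omega>"
    and sub: "\<And>j. j < n \<Longrightarrow> S j \<subseteq> \<Omega>" and disj: "disjoint_family_on S {..<n}"
    and cover: "(\<Union>j<n. closure (S j)) = closure \<Omega>"
  shows "integral \<Omega> F = (\<Sum>j<n. integral (S j) F)"
proof -
  have "(F has_integral (\<Sum>j<n. integral (S j) F)) (\<Union>j\<in>{..<n}. S j)"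
    by (rule has_integral_UN[OF finite_lessThan])
      (use reg pw_continuous_integrable[OF F] disj in
        \<open>auto simp: pairwise_def disjoint_family_on_def intro: integrable_integral\<close>)
  moreover have "negligible (\<Union>j<n. frontier (S j))"
    using reg by (auto intro!: negligible_Union simp: region_def)
  moreover have "\<Omega> - (\<Union>j\<in>{..<n}. S j) \<subseteq> (\<Union>j<n. frontier (S j))"
  proof
    fix y assume y: "y \<in> \<Omega> - (\<Union>j\<in>{..<n}. S j)"
    then have "y \<in> (\<Union>j<n. closure (S j))" unfolding cover using closure_subset[of \<Omega>] by blast
    then obtain j where j: "j < n" "y \<in> closure (S j)" by blast
    moreover have "y \<notin> interior (S j)" using y j(1) interior_subset[of "S j"] by blast
    ultimately show "y \<in> (\<Union>j<n. frontier (S j))" by (auto simp: frontier_def)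
  qed
  ultimately have int: "(F has_integral (\<Sum>j<n. integral (S j) F)) (\<Union>j\<in>{..<n}. S j)"
    and negl: "negligible (\<Omega> - (\<Union>j\<in>{..<n}. S j))"
    by (auto intro: negligible_subset)
  have "(F has_integral (\<Sum>j<n. integral (S j) F)) \<Omega>"
  proof (rule has_integral_spike_set_eq[THEN iffD1, OF _ _ int])
    show "negligible {x \<in> (\<Union>j\<in>{..<n}. S j) - \<Omega>. F x \<noteq> 0}"
      using sub by (auto intro: negligible_subset[OF negligible_empty])
    show "negligible {x \<in> \<Omega> - (\<Union>j\<in>{..<n}. S j). F x \<noteq> 0}"
      by (rule negligible_subset[OF negl]) blast
  qed
  then show ?thesis by (rule integral_unique)
qed


lemma pw_continuous_jacobian_inner:
  assumes "pw_smooth \<T> u" "pw_smooth \<T> v"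
  shows "pw_continuous \<T> (\<lambda>y. jacobian u (at y) \<bullet> jacobian v (at y))"
  unfolding inner_vec_def using assms
  by (auto intro!: pw_continuous_intros pw_smooth_jacobian)

lemma pw_continuous_divergence:
  assumes "pw_smooth \<T> u"
  shows "pw_continuous \<T> (divergence u)"
  unfolding divergence_def trace_def using assms
  by (auto intro!: pw_continuous_intros pw_smooth_jacobian)

lemma form_a_commute: "form_a S u v = form_a S v u"
  by (simp add: form_a_def inner_commute)

lemma form_a_zero [simp]: "form_a S (\<lambda>_. 0) v = 0" "form_a S v (\<lambda>_. 0) = 0"
  by (simp_all add: form_a_def jacobian_zero)

lemma form_a_lin:
  assumes "region \<T> S" "pw_smooth \<T> u" "pw_smooth \<T> u'" "pw_smooth \<T> v"
  shows "form_a S (\<lambda>y. c *\<^sub>R u y + d *\<^sub>R u' y) v = c * form_a S u v + d * form_a S u' v"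
proof -
  have "form_a S (\<lambda>y. c *\<^sub>R u y + d *\<^sub>R u' y) v =
      integral S (\<lambda>y. c * (jacobian u (at y) \<bullet> jacobian v (at y)) + d * (jacobian u' (at y) \<bullet> jacobian v (at y)))"
    unfolding form_a_def
    by (rule region_integral_cong[OF assms(1)])
      (use assms in \<open>simp add: jacobian_add jacobian_scale pw_smooth_differentiable inner_add_left\<close>)
  then show ?thesis
    unfolding form_a_def using assms by (simp add: region_integral_lin pw_continuous_jacobian_inner)
qed

lemma form_a_sum_left:
  assumes "region \<T> S" "\<And>i. i \<in> I \<Longrightarrow> pw_smooth \<T> (u i)" "pw_smooth \<T> v"
  shows "form_a S (\<lambda>y. \<Sum>i\<in>I. c i *\<^sub>R u i y) v = (\<Sum>i\<in>I. c i * form_a S (u i) v)"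
  using assms(2)
proof (induction I rule: infinite_finite_induct)
  case (insert i I)
  then show ?case
    using form_a_lin[OF assms(1) _ pw_smooth_sum[of I \<T> u c] assms(3), of "u i" "c i" 1] by simp
qed simp_all

lemma form_a_sum_right:
  assumes "region \<T> S" "\<And>i. i \<in> I \<Longrightarrow> pw_smooth \<T> (u i)" "pw_smooth \<T> v"
  shows "form_a S v (\<lambda>y. \<Sum>i\<in>I. c i *\<^sub>R u i y) = (\<Sum>i\<in>I. c i * form_a S v (u i))"
  using form_a_sum_left[OF assms] by (simp add: form_a_commute[of S v])

lemma form_a_nonneg: "region \<T> S \<Longrightarrow> pw_smooth \<T> u \<Longrightarrow> 0 \<le> form_a S u u"
  unfolding form_a_def by (simp add: region_integral_nonneg pw_continuous_jacobian_inner)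

lemma form_b_zero [simp]: "form_b S (\<lambda>_. 0) q = 0" "form_b S u (\<lambda>_. 0) = 0"
  by (simp_all add: form_b_def divergence_def jacobian_zero trace_def)

lemma form_b_lin_left:
  assumes "region \<T> S" "pw_smooth \<T> u" "pw_smooth \<T> u'" "pw_continuous \<T> q"
  shows "form_b S (\<lambda>y. c *\<^sub>R u y + d *\<^sub>R u' y) q = c * form_b S u q + d * form_b S u' q"
proof -
  have "integral S (\<lambda>y. divergence (\<lambda>y. c *\<^sub>R u y + d *\<^sub>R u' y) y * q y) =
      integral S (\<lambda>y. c * (divergence u y * q y) + d * (divergence u' y * q y))"
    by (rule region_integral_cong[OF assms(1)])
      (use assms in \<open>simp add: divergence_def trace_def jacobian_add jacobian_scale
        pw_smooth_differentiable sum_2 algebra_simps\<close>)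
  also have "\<dots> = c * integral S (\<lambda>y. divergence u y * q y) + d * integral S (\<lambda>y. divergence u' y * q y)"
    using assms by (simp add: region_integral_lin pw_continuous_mult pw_continuous_divergence)
  finally show ?thesis by (simp add: form_b_def)
qed

lemma form_b_sum_left:
  assumes "region \<T> S" "\<And>i. i \<in> I \<Longrightarrow> pw_smooth \<T> (u i)" "pw_continuous \<T> q"
  shows "form_b S (\<lambda>y. \<Sum>i\<in>I. c i *\<^sub>R u i y) q = (\<Sum>i\<in>I. c i * form_b S (u i) q)"
  using assms(2)
proof (induction I rule: infinite_finite_induct)
  case (insert i I)
  then show ?case
    using form_b_lin_left[OF assms(1) _ pw_smooth_sum[of I \<T> u c] assms(3), of "u i" "c i" 1] by simp
qed simp_all

lemma form_b_sum_right:
  assumes "region \<T> S" "pw_smooth \<T> u" "\<And>i. i \<in> I \<Longrightarrow> pw_continuous \<T> (q i)"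
  shows "form_b S u (\<lambda>y. \<Sum>i\<in>I. c i * q i y) = (\<Sum>i\<in>I. c i * form_b S u (q i))"
  using assms(3)
proof (induction I rule: infinite_finite_induct)
  case (insert i I)
  then have "pw_continuous \<T> (\<lambda>y. divergence u y * q i y)"
    "pw_continuous \<T> (\<lambda>y. divergence u y * (\<Sum>i\<in>I. c i * q i y))"
    using assms(2) by (auto intro!: pw_continuous_intros pw_continuous_divergence)
  from region_integral_lin[OF this assms(1), of "c i" 1] show ?case
    using insert by (simp add: form_b_def algebra_simps)
qed simp_all

text \<open>The constant \<open>2\<close> is the dimension, through \<open>trace_sq_le\<close>.\<close>
lemma form_b_square_le:
  assumes "region \<T> S" "pw_smooth \<T> u" "pw_continuous \<T> q"
  shows "(form_b S u q)\<^sup>2 \<le> 2 * form_a S u u * integral S (\<lambda>y. q y * q y)"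
proof -
  let ?d = "divergence u"
  have d: "pw_continuous \<T> ?d" by (rule pw_continuous_divergence[OF assms(2)])
  have nonneg: "0 \<le> integral S (\<lambda>y. ?d y * ?d y) + 2 * t * integral S (\<lambda>y. ?d y * q y)
      + t\<^sup>2 * integral S (\<lambda>y. q y * q y)" for t
  proof -
    have "0 \<le> integral S (\<lambda>y. (?d y + t * q y) * (?d y + t * q y))"
      using assms d by (intro region_integral_nonneg) (auto intro!: pw_continuous_intros)
    also have "\<dots> = integral S (\<lambda>y. 1 * (1 * (?d y * ?d y) + (2 * t) * (?d y * q y)) + t\<^sup>2 * (q y * q y))"
      by (rule arg_cong[of _ _ "integral S"]) (simp add: fun_eq_iff algebra_simps power2_eq_square)
    also have "\<dots> = integral S (\<lambda>y. ?d y * ?d y) + 2 * t * integral S (\<lambda>y. ?d y * q y)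
      + t\<^sup>2 * integral S (\<lambda>y. q y * q y)"
      using assms d by (simp only: region_integral_lin pw_continuous_intros) simp
    finally show ?thesis .
  qed
  have "(form_b S u q)\<^sup>2 \<le> integral S (\<lambda>y. ?d y * ?d y) * integral S (\<lambda>y. q y * q y)"
    using discriminant_le[OF nonneg] by (simp add: form_b_def)
  also have "integral S (\<lambda>y. ?d y * ?d y) \<le> 2 * form_a S u u"
  proof -
    have "integral S (\<lambda>y. ?d y * ?d y) \<le> integral S (\<lambda>y. 2 * (jacobian u (at y) \<bullet> jacobian u (at y)))"
    proof (rule integral_le)
      show "(\<lambda>y. ?d y * ?d y) integrable_on S"
        by (rule pw_continuous_integrable[OF pw_continuous_mult[OF d d] assms(1)])
      show "(\<lambda>y. 2 * (jacobian u (at y) \<bullet> jacobian u (at y))) integrable_on S"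
        by (rule pw_continuous_integrable[OF pw_continuous_mult[OF pw_continuous_const
                pw_continuous_jacobian_inner[OF assms(2,2)]] assms(1)])
      show "?d y * ?d y \<le> 2 * (jacobian u (at y) \<bullet> jacobian u (at y))" for y
        using trace_sq_le[of "jacobian u (at y)"] by (simp add: divergence_def power2_eq_square)
    qed
    then show ?thesis by (simp add: form_a_def)
  qed
  finally show ?thesis
    using region_integral_nonneg[OF pw_continuous_mult[OF assms(3,3)] assms(1)]
    by (simp add: mult_right_mono)
qed

lemma form_a_cong:
  assumes "open S" "\<And>y. y \<in> S \<Longrightarrow> u y = u' y" "\<And>y. y \<in> S \<Longrightarrow> v y = v' y"
  shows "form_a S u v = form_a S u' v'"
  unfolding form_a_def
  by (rule integral_cong) (use jacobian_cong_open[OF assms(1)] assms in metis)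

lemma form_b_cong:
  assumes "open S" "\<And>y. y \<in> S \<Longrightarrow> u y = u' y"
  shows "form_b S u q = form_b S u' q"
proof -
  have "divergence u y = divergence u' y" if "y \<in> S" for y
    unfolding divergence_def using jacobian_cong_open[OF assms(1) that assms(2)] by simp
  then show ?thesis unfolding form_b_def by (auto intro: integral_cong)
qed

text \<open>On each cell the gradient vanishes, so the function is constant there. Being continuous with
  finitely many values on a connected set, it is constant.\<close>
lemma form_a_eq_0_imp_constant:
  assumes reg: "region \<T> S" and conn: "connected S" and u: "pw_smooth \<T> u"
    and cont: "continuous_on UNIV u" and zero: "form_a S u u = 0"
  shows "\<exists>c. \<forall>y\<in>closure S. u y = c"
proof -
  define F where "F = (\<lambda>y. jacobian u (at y) \<bullet> jacobian u (at y))"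
  have F: "pw_continuous \<T> F" unfolding F_def by (rule pw_continuous_jacobian_inner[OF u u])
  have F0: "F y = 0" if T: "T \<in> \<T>" "T \<subseteq> closure S" and y: "y \<in> interior T" for T y
  proof -
    obtain a b where ab: "y \<in> box a b" "cbox a b \<subseteq> interior T"
      by (rule open_contains_cbox[OF open_interior y])
    obtain g where g: "continuous_on T g" "\<And>y. y \<in> interior T \<Longrightarrow> F y = g y"
      using F T(1) unfolding pw_continuous_def by blast
    have sub: "cbox a b \<subseteq> closure S" using ab(2) interior_subset T(2) by blast
    have cF: "continuous_on (cbox a b) F"
      by (rule continuous_on_eq[OF continuous_on_subset[OF g(1)]])
        (use ab(2) g(2) interior_subset[of T] in \<open>auto simp: subset_iff\<close>)
    have negl: "negligible (closure S - S)" "negligible (S - closure S)"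
      using reg closure_subset[of S] interior_open[of S]
      by (auto simp: region_def frontier_def intro: negligible_subset)
    have "(F has_integral 0) S"
      using integrable_integral[OF pw_continuous_integrable[OF F reg]] zero
      by (simp add: F_def form_a_def)
    then have int: "(F has_integral 0) (closure S)"
      by (subst (asm) has_integral_spike_set_eq[of S "closure S"])
        (use negl in \<open>auto intro: negligible_subset\<close>)
    have "integral (cbox a b) F \<le> integral (closure S) F"
      by (rule integral_subset_le[OF sub])
        (use int cF in \<open>auto intro: integrable_continuous simp: F_def\<close>)
    moreover have "0 \<le> integral (cbox a b) F"
      by (rule integral_nonneg) (use cF in \<open>auto intro: integrable_continuous simp: F_def\<close>)
    ultimately have "integral (cbox a b) F = 0"
      using integral_unique[OF int] by simp
    then have "(F has_integral 0) (cbox a b)"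
      using integrable_integral[OF integrable_continuous[OF cF]] by simp
    then show ?thesis
      using has_integral_0_cbox_imp_0[OF cF, of y] ab(1) box_subset_cbox[of a b]
      by (auto simp: F_def)
  qed
  have cell_const: "\<exists>c. \<forall>y\<in>T. u y = c" if T: "T \<in> \<T>" "T \<subseteq> closure S" for T
  proof -
    have "(u has_derivative (\<lambda>h. 0)) (at y within interior T)" if y: "y \<in> interior T" for y
    proof -
      have "jacobian u (at y) = 0" using F0[OF T y] by (simp add: F_def)
      then have "(u has_derivative (\<lambda>h. 0)) (at y)"
        using pw_smooth_differentiable[OF u T(1) y] by (simp add: jacobian_works)
      then show ?thesis by (rule has_derivative_at_withinI)
    qed
    then obtain c where c: "\<forall>y\<in>interior T. u y = c"
      using has_derivative_zero_constant[OF convex_interior[OF convex_cell[OF T(1)]]] by blast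
    have "u y = c" if "y \<in> closure (interior T)" for y
      by (rule continuous_constant_on_closure[OF _ _ that])
        (use c cont in \<open>auto intro: continuous_on_subset\<close>)
    then show ?thesis using cell_closure_interior[OF T(1)] by auto
  qed
  then obtain c where c: "\<And>T y. T \<in> \<T> \<Longrightarrow> T \<subseteq> closure S \<Longrightarrow> y \<in> T \<Longrightarrow> u y = c T" by metis
  have "finite (u ` closure S)"
  proof (rule finite_subset)
    show "u ` closure S \<subseteq> c ` \<T>"
    proof (rule image_subsetI)
      fix y assume "y \<in> closure S"
      then obtain T where "T \<in> \<T>" "T \<subseteq> closure S" "y \<in> T" using reg unfolding region_def by blast
      with c show "u y \<in> c ` \<T>" by auto
    qed
    show "finite (c ` \<T>)" using finite_mesh by simp
  qed
  then have fin: "finite ((\<lambda>y. u y $ i) ` closure S)" for i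
    using finite_imageI[of "u ` closure S" "\<lambda>x. x $ i"] by (simp add: image_image)
  have "(\<lambda>y. u y $ i) constant_on closure S" for i
    by (rule continuous_finite_range_constant[OF connected_imp_connected_closure[OF conn] _ fin])
      (use cont in \<open>auto intro!: continuous_intros intro: continuous_on_subset\<close>)
  then have "\<forall>i. \<exists>d. \<forall>y\<in>closure S. u y $ i = d" by (simp add: constant_on_def)
  then obtain d where "\<forall>i. \<forall>y\<in>closure S. u y $ i = d i" by (rule choice[THEN exE])
  then have "\<forall>y\<in>closure S. u y = (\<chi> i. d i)" by (simp add: vec_eq_iff)
  then show ?thesis by blast
qed

end


section \<open>Nodal functions and the geometry of the interface\<close>

definition nodal :: "fetidp \<Rightarrow> ndof \<Rightarrow> plane \<Rightarrow> plane" where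
  "nodal D p = vphi D (fst p) (snd p)"

definition fe_function :: "fetidp \<Rightarrow> (ndof \<Rightarrow> real) \<Rightarrow> plane \<Rightarrow> plane" where
  "fe_function D u = (\<lambda>y. \<Sum>p\<in>vidx D. u p *\<^sub>R nodal D p y)"

definition velocity :: "fetidp \<Rightarrow> (dof \<Rightarrow> real) \<Rightarrow> nat \<Rightarrow> plane \<Rightarrow> plane" where
  "velocity D w j = (\<lambda>y. \<Sum>u\<in>dofs D. w u *\<^sub>R vel D u j y)"

definition pressure :: "fetidp \<Rightarrow> (dof \<Rightarrow> real) \<Rightarrow> plane \<Rightarrow> real" where
  "pressure D w = (\<lambda>y. \<Sum>u\<in>dofs D. w u * prs D u y)"

lemma edge_space_alt:
  "edge_space D e = {v. \<exists>c. v = (\<lambda>y. \<Sum>p\<in>edge_nodes D e \<times> UNIV. c p *\<^sub>R nodal D p y)}"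
  by (simp add: edge_space_def nodal_def case_prod_beta)

text \<open>The end points of an edge thus inherit from the open edge the membership in a closed
  subdomain.\<close>
lemma pathstart_in_closure_open_edge:
  assumes "arc g"
  shows "pathstart g \<in> closure (path_image g - {pathstart g, pathfinish g})"
proof -
  have inj: "inj_on g {0..1}" and cont: "continuous_on {0..1} g"
    using assms by (auto simp: arc_def path_def)
  have "g ` {0<..<1} \<subseteq> path_image g - {pathstart g, pathfinish g}"
  proof
    fix y assume "y \<in> g ` {0<..<1}"
    then obtain t where t: "0 < t" "t < 1" "y = g t" by auto
    then have "g t \<noteq> g 0" "g t \<noteq> g 1"
      using inj_onD[OF inj, of t 0] inj_onD[OF inj, of t 1] by auto
    with t show "y \<in> path_image g - {pathstart g, pathfinish g}"
      by (auto simp: path_image_def pathstart_def pathfinish_def)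
  qed
  moreover have "g ` closure {0<..<1} \<subseteq> closure (g ` {0<..<1})"
    by (rule continuous_image_closure_subset[OF cont]) auto
  then have "g 0 \<in> closure (g ` {0<..<1})" by (auto simp: image_subset_iff)
  ultimately show ?thesis unfolding pathstart_def using closure_mono by blast
qed

locale discretization =
  fixes \<Omega> :: "plane set" and \<kappa> h H :: real and D :: fetidp
  assumes polygonal_\<Omega>: "polygonal_domain \<Omega>" and \<kappa>_pos: "\<kappa> > 0"
    and setting: "fetidp_setting \<Omega> \<kappa> h H D"
begin

lemma dom_eq: "dom D = \<Omega>" and h_pos: "0 < h"
  and mesh_ok: "mesh_ok \<kappa> h D" and velocity_ok: "velocity_ok D" and pressure_ok: "pressure_ok D"
  and mass_ok: "mass_ok \<kappa> h D" and kernel_ok: "kernel_ok D" and subdomains_ok: "subdomains_ok \<kappa> H D"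
  and edges_ok: "edges_ok D" and primal_ok: "primal_ok D" and jump_matrix_ok: "jump_matrix_ok D"
  using setting by (simp_all add: fetidp_setting_def)

sublocale plane_mesh "mesh D"
proof
  show "finite (mesh D)" using mesh_ok by (auto simp: mesh_ok_def triangulation_def)
  fix T assume T: "T \<in> mesh D"
  then have "2 simplex T" using mesh_ok by (auto simp: mesh_ok_def)
  then obtain C where "finite C" "T = convex hull C" by (auto simp: simplex)
  then show "convex T" "compact T" by (auto intro: compact_convex_hull finite_imp_compact)
  obtain y where "ball y (diameter T / \<kappa>) \<subseteq> T" "h / \<kappa> \<le> diameter T"
    using mesh_ok T unfolding mesh_ok_def by blast
  moreover have "0 < h / \<kappa>" using h_pos \<kappa>_pos by simp
  ultimately have "y \<in> interior T"
    using \<kappa>_pos by (intro interiorI[of "ball y (diameter T / \<kappa>)"]) auto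
  then show "interior T \<noteq> {}" by blast
qed

lemma region_\<Omega>: "region (mesh D) \<Omega>"
proof -
  have "\<Union>(mesh D) = closure \<Omega>" using mesh_ok dom_eq by (simp add: mesh_ok_def)
  moreover from this have "{T \<in> mesh D. T \<subseteq> closure \<Omega>} = mesh D" by auto
  ultimately show ?thesis
    using polygonal_domain_open[OF polygonal_\<Omega>] polygonal_domain_negligible_frontier[OF polygonal_\<Omega>]
    by (simp add: region_def)
qed

lemma sub_polygonal: "j < nsub D \<Longrightarrow> polygonal_domain (sub D j)"
  and sub_subset: "j < nsub D \<Longrightarrow> sub D j \<subseteq> \<Omega>"
  and sub_disjoint: "disjoint_family_on (sub D) {..<nsub D}"
  and sub_cover: "(\<Union>j<nsub D. closure (sub D j)) = closure \<Omega>"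
  using subdomains_ok dom_eq by (simp_all add: subdomains_ok_def)

lemma region_sub: "j < nsub D \<Longrightarrow> region (mesh D) (sub D j)"
  using subdomains_ok polygonal_domain_open[OF sub_polygonal]
    polygonal_domain_negligible_frontier[OF sub_polygonal]
  by (simp add: subdomains_ok_def region_def)

lemma sub_open: "j < nsub D \<Longrightarrow> open (sub D j)"
  by (rule polygonal_domain_open[OF sub_polygonal])

lemma sub_connected: "j < nsub D \<Longrightarrow> connected (sub D j)"
  using sub_polygonal polygonal_domain_def by blast

lemma integral_sub_decomposition:
  "pw_continuous (mesh D) F \<Longrightarrow> integral \<Omega> F = (\<Sum>j<nsub D. integral (sub D j) F)"
  by (rule integral_decomposition[OF _ region_sub region_\<Omega> sub_subset sub_disjoint sub_cover])

lemma finite_nodes: "finite (nodes D)" and nodes_subset: "nodes D \<subseteq> \<Omega>"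
  using velocity_ok dom_eq by (simp_all add: velocity_ok_def)

lemma phi_continuous: "x \<in> nodes D \<Longrightarrow> continuous_on UNIV (phi D x)"
  and phi_outside: "x \<in> nodes D \<Longrightarrow> y \<notin> \<Omega> \<Longrightarrow> phi D x y = 0"
  and phi_polynomial: "x \<in> nodes D \<Longrightarrow> T \<in> mesh D \<Longrightarrow>
    \<exists>p. real_polynomial_function p \<and> (\<forall>y\<in>T. phi D x y = p y)"
  and phi_node: "x \<in> nodes D \<Longrightarrow> y \<in> nodes D \<Longrightarrow> phi D x y = (if y = x then 1 else 0)"
  and phi_off_cell: "x \<in> nodes D \<Longrightarrow> T \<in> mesh D \<Longrightarrow> x \<notin> T \<Longrightarrow> y \<in> T \<Longrightarrow> phi D x y = 0"
  using velocity_ok dom_eq by (auto simp: velocity_ok_def)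

lemma finite_vidx: "finite (vidx D)"
  using finite_nodes by (simp add: vidx_def)

lemma nodal_continuous: "p \<in> vidx D \<Longrightarrow> continuous_on UNIV (nodal D p)"
  unfolding nodal_def vphi_def vidx_def by (auto intro!: continuous_intros phi_continuous)

lemma nodal_smooth: "p \<in> vidx D \<Longrightarrow> pw_smooth (mesh D) (nodal D p)"
  unfolding nodal_def vphi_def vidx_def by (auto intro!: pw_smooth_polynomial phi_polynomial)

lemma nodal_zero: "phi D (fst p) y = 0 \<Longrightarrow> nodal D p y = 0"
  by (simp add: nodal_def vphi_def)

text \<open>A cell of the subdomain that contains \<open>y\<close> cannot contain \<open>x\<close>.\<close>
lemma phi_off_sub:
  assumes "x \<in> nodes D" "j < nsub D" "x \<notin> closure (sub D j)" "y \<in> closure (sub D j)"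
  shows "phi D x y = 0"
proof -
  obtain T where "T \<in> mesh D" "T \<subseteq> closure (sub D j)" "y \<in> T"
    using region_sub[OF assms(2)] assms(4) unfolding region_def by blast
  then show ?thesis using phi_off_cell assms(1,3) by blast
qed

definition fe_space :: "(plane \<Rightarrow> plane) set" where
  "fe_space = fe_function D ` vecs (vidx D)"

lemma fe_space_zero: "(\<lambda>_. 0) \<in> fe_space"
  unfolding fe_space_def by (rule image_eqI[of _ _ "\<lambda>_. 0"]) (simp_all add: fe_function_def)

lemma fe_space_add: "f \<in> fe_space \<Longrightarrow> g \<in> fe_space \<Longrightarrow> (\<lambda>y. f y + g y) \<in> fe_space"
  unfolding fe_space_def
  by (auto simp: fe_function_def scaleR_left_distrib sum.distrib intro!: image_eqI[OF _ vecs_add])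

lemma fe_space_scale: "f \<in> fe_space \<Longrightarrow> (\<lambda>y. c *\<^sub>R f y) \<in> fe_space"
  unfolding fe_space_def
  by (auto simp: fe_function_def scaleR_sum_right intro!: image_eqI[OF _ vecs_scale[of _ _ c]])

lemma fe_space_sum:
  "(\<And>i. i \<in> I \<Longrightarrow> f i \<in> fe_space) \<Longrightarrow> (\<lambda>y. \<Sum>i\<in>I. c i *\<^sub>R f i y) \<in> fe_space"
  by (induction I rule: infinite_finite_induct)
    (simp_all add: fe_space_zero fe_space_add fe_space_scale)

lemma nodal_in_fe_space: "p \<in> vidx D \<Longrightarrow> nodal D p \<in> fe_space"
  unfolding fe_space_def
  by (rule image_eqI[of _ _ "\<lambda>q. if q = p then 1 else 0"])
    (auto simp: fe_function_def vecs_def finite_vidx if_distrib[of "\<lambda>c. c *\<^sub>R _"] cong: if_cong)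

lemma fe_space_smooth: "f \<in> fe_space \<Longrightarrow> pw_smooth (mesh D) f"
  unfolding fe_space_def fe_function_def by (auto intro!: pw_smooth_sum nodal_smooth)

lemma fe_space_continuous: "f \<in> fe_space \<Longrightarrow> continuous_on UNIV f"
  unfolding fe_space_def fe_function_def by (auto intro!: continuous_intros nodal_continuous)

lemma edge_nodes_vidx: "edge_nodes D e \<times> UNIV \<subseteq> vidx D"
  by (auto simp: edge_nodes_def vidx_def)

lemma edge_space_subset: "edge_space D e \<subseteq> fe_space"
  using edge_nodes_vidx unfolding edge_space_alt by (auto intro!: fe_space_sum nodal_in_fe_space)

lemma corners_nodes: "corners D \<subseteq> nodes D"
  using primal_ok by (simp add: primal_ok_def)

lemma edge_sides:
  assumes "e < nedge D"
  shows "\<exists>i<nsub D. \<exists>j<nsub D. i \<noteq> j \<and>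
    (\<forall>k<nsub D. \<forall>x\<in>open_edge D e. x \<in> closure (sub D k) \<longleftrightarrow> k = i \<or> k = j)"
proof -
  have "\<exists>i<nsub D. \<exists>j<nsub D. i \<noteq> j \<and>
      open_edge D e \<subseteq> frontier (sub D i) \<inter> frontier (sub D j) \<and>
      (\<forall>k<nsub D. k \<noteq> i \<longrightarrow> k \<noteq> j \<longrightarrow> open_edge D e \<inter> closure (sub D k) = {})"
    using edges_ok assms by (simp add: edges_ok_def)
  then obtain i j where ij: "i < nsub D" "j < nsub D" "i \<noteq> j"
    and sub: "open_edge D e \<subseteq> frontier (sub D i) \<inter> frontier (sub D j)"
    and other: "\<forall>k<nsub D. k \<noteq> i \<longrightarrow> k \<noteq> j \<longrightarrow> open_edge D e \<inter> closure (sub D k) = {}"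
    by blast
  have "x \<in> closure (sub D k) \<longleftrightarrow> k = i \<or> k = j" if "k < nsub D" "x \<in> open_edge D e" for k x
    using sub other that by (auto simp: frontier_def)
  with ij show ?thesis by blast
qed

lemma open_edge_disjoint:
  assumes "e < nedge D" "e' < nedge D" "x \<in> open_edge D e" "x \<in> open_edge D e'"
  shows "e = e'"
proof -
  have "disjoint_family_on (open_edge D) {..<nedge D}"
    using edges_ok by (simp add: edges_ok_def)
  then show ?thesis using assms unfolding disjoint_family_on_def by blast
qed

lemma open_edge_corner:
  assumes "e < nedge D" "x \<in> open_edge D e"
  shows "x \<notin> corners D"
proof -
  have "(\<Union>e<nedge D. open_edge D e) \<inter> corners D = {}"
    using edges_ok by (simp add: edges_ok_def)
  then show ?thesis using assms by blast
qed

text \<open>A node outside all open subdomains lies on one of their boundaries but not on the boundary of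
  the domain, hence on the interface.\<close>
lemma node_cases:
  assumes "x \<in> nodes D"
  obtains i where "i < nsub D" "x \<in> sub D i" | "x \<in> corners D"
    | e where "e < nedge D" "x \<in> edge_nodes D e"
proof -
  have x: "x \<in> \<Omega>" using assms nodes_subset by blast
  then have "x \<in> closure \<Omega>" using closure_subset by blast
  then obtain j where j: "j < nsub D" "x \<in> closure (sub D j)" using sub_cover by blast
  show ?thesis
  proof (cases "x \<in> sub D j")
    case True
    with j that(1) show ?thesis by blast
  next
    case False
    then have "x \<in> frontier (sub D j)" using j sub_open by (simp add: frontier_def interior_open)
    moreover have "x \<notin> frontier (dom D)"
      using x polygonal_domain_open[OF polygonal_\<Omega>] dom_eq by (simp add: frontier_def interior_open)
    ultimately have "x \<in> interface D" using j by (auto simp: interface_def)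
    then have "x \<in> (\<Union>e<nedge D. open_edge D e) \<union> corners D"
      using edges_ok by (simp add: edges_ok_def)
    then show ?thesis using that assms by (auto simp: edge_nodes_def)
  qed
qed

lemma endpoint_in_closure:
  assumes "e < nedge D" "j < nsub D" "x \<in> open_edge D e" "x \<in> closure (sub D j)"
  shows "pathstart (edge D e) \<in> closure (sub D j)"
proof -
  have "open_edge D e \<subseteq> closure (sub D j)" using edge_sides[OF assms(1)] assms by blast
  moreover have "arc (edge D e)" using edges_ok assms(1) by (simp add: edges_ok_def)
  then have "pathstart (edge D e) \<in> closure (open_edge D e)"
    unfolding open_edge_def by (rule pathstart_in_closure_open_edge)
  ultimately show ?thesis using closure_minimal by blast
qed

text \<open>An end point of an edge is either a corner, which is a node different from \<open>x\<close>, or a boundary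
  point of the domain, where the Dirichlet condition holds. This is the anchor for the
  definiteness of the dual block.\<close>
lemma phi_endpoint:
  assumes "e < nedge D" "e' < nedge D" "x \<in> edge_nodes D e'"
  shows "phi D x (pathstart (edge D e)) = 0"
proof (cases "pathstart (edge D e) \<in> corners D")
  case True
  then have "pathstart (edge D e) \<in> nodes D" "pathstart (edge D e) \<noteq> x"
    using corners_nodes open_edge_corner[OF assms(2)] assms(3) by (auto simp: edge_nodes_def)
  then show ?thesis using phi_node assms(3) by (auto simp: edge_nodes_def)
next
  case False
  then have "pathstart (edge D e) \<in> frontier (dom D)" using assms(1) by (auto simp: corners_def)
  then have "pathstart (edge D e) \<notin> \<Omega>"
    using polygonal_domain_open[OF polygonal_\<Omega>] dom_eq by (simp add: frontier_def interior_open)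
  then show ?thesis using phi_outside assms(3) by (auto simp: edge_nodes_def)
qed


section \<open>Primal and dual basis functions of an edge\<close>

lemma edge_space_node_zero:
  assumes "e < nedge D" "v \<in> edge_space D e" "\<And>x. x \<in> edge_nodes D e \<Longrightarrow> phi D x y = 0"
  shows "v y = 0"
  using assms(2,3) by (auto simp: edge_space_alt intro!: sum.neutral nodal_zero)

lemma edge_space_sum:
  assumes "\<And>i. i \<in> I \<Longrightarrow> f i \<in> edge_space D e"
  shows "(\<lambda>y. \<Sum>i\<in>I. c i *\<^sub>R f i y) \<in> edge_space D e"
proof -
  have "\<forall>i\<in>I. \<exists>b. f i = (\<lambda>y. \<Sum>p\<in>edge_nodes D e \<times> UNIV. b p *\<^sub>R nodal D p y)"
    using assms by (simp add: edge_space_alt)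
  then obtain b where b: "\<forall>i\<in>I. f i = (\<lambda>y. \<Sum>p\<in>edge_nodes D e \<times> UNIV. b i p *\<^sub>R nodal D p y)"
    by (rule bchoice[THEN exE])
  have "(\<Sum>i\<in>I. c i *\<^sub>R f i y) = (\<Sum>p\<in>edge_nodes D e \<times> UNIV. (\<Sum>i\<in>I. c i * b i p) *\<^sub>R nodal D p y)" for y
  proof -
    have "(\<Sum>i\<in>I. c i *\<^sub>R f i y) = (\<Sum>i\<in>I. \<Sum>p\<in>edge_nodes D e \<times> UNIV. (c i * b i p) *\<^sub>R nodal D p y)"
      by (rule sum.cong) (use b in \<open>simp_all add: scaleR_sum_right\<close>)
    also have "\<dots> = (\<Sum>p\<in>edge_nodes D e \<times> UNIV. \<Sum>i\<in>I. (c i * b i p) *\<^sub>R nodal D p y)"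
      by (rule sum.swap)
    finally show ?thesis by (simp add: scaleR_sum_left)
  qed
  then show ?thesis unfolding edge_space_alt
    by (intro CollectI exI[of _ "\<lambda>p. \<Sum>i\<in>I. c i * b i p"]) auto
qed

lemma edge_space_eq_0:
  assumes "v \<in> edge_space D e" "\<And>x. x \<in> edge_nodes D e \<Longrightarrow> v x = 0"
  shows "v = (\<lambda>_. 0)"
proof -
  obtain c where v: "v = (\<lambda>y. \<Sum>p\<in>edge_nodes D e \<times> UNIV. c p *\<^sub>R nodal D p y)"
    using assms(1) by (auto simp: edge_space_alt)
  have fin: "finite (edge_nodes D e)" using finite_nodes by (simp add: edge_nodes_def)
  have "c (x, k) = 0" if x: "x \<in> edge_nodes D e" for x k
  proof -
    have "v x $ k = (\<Sum>p\<in>edge_nodes D e \<times> UNIV. c p * nodal D p x $ k)" by (simp add: v)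
    also have "\<dots> = (\<Sum>p\<in>edge_nodes D e \<times> UNIV. if p = (x, k) then c p else 0)"
      by (rule sum.cong)
        (use x phi_node in \<open>auto simp: nodal_def vphi_def axis_def edge_nodes_def split: if_splits\<close>)
    also have "\<dots> = c (x, k)" using x fin by simp
    finally show ?thesis using assms(2)[OF x] by simp
  qed
  then show ?thesis unfolding v by (auto intro!: sum.neutral)
qed

lemma dual_edge:
  assumes "d \<in> dual D"
  obtains e where "e < nedge D" "fst d \<in> edge_nodes D e"
proof -
  have "dual D \<subseteq> (\<Union>e<nedge D. edge_nodes D e) \<times> UNIV"
    using primal_ok unfolding primal_ok_def first_choice_def second_choice_def
    by (auto split: if_splits)
  then have "d \<in> (\<Union>e<nedge D. edge_nodes D e) \<times> UNIV" using assms by blast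
  then show ?thesis using that by auto
qed

lemma finite_dual: "finite (dual D)"
proof (rule finite_subset[OF _ finite_vidx])
  show "dual D \<subseteq> vidx D"
  proof
    fix d assume "d \<in> dual D"
    then obtain e where "fst d \<in> edge_nodes D e" by (rule dual_edge)
    then show "d \<in> vidx D" by (cases d) (auto simp: vidx_def edge_nodes_def)
  qed
qed

lemma first_choice_edge_dual:
  "first_choice D \<Longrightarrow> e < nedge D \<Longrightarrow> edge_dual D e = edge_nodes D e \<times> UNIV"
  by (auto simp: first_choice_def edge_dual_def)

lemma first_choice_psi: "first_choice D \<Longrightarrow> d \<in> dual D \<Longrightarrow> psi D d = nodal D d"
  by (auto simp: first_choice_def nodal_def split_beta)

lemma psi_edge_space:
  assumes "e < nedge D" "d \<in> edge_dual D e"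
  shows "psi D d \<in> edge_space D e"
proof (cases "use_avg D")
  case True
  moreover have "edge_nodes D e \<noteq> {}" using assms by (auto simp: edge_dual_def)
  ultimately show ?thesis using primal_ok assms by (simp add: primal_ok_def second_choice_def)
next
  case False
  then have fc: "first_choice D" using primal_ok by (simp add: primal_ok_def)
  have fin: "finite (edge_nodes D e)" using finite_nodes by (simp add: edge_nodes_def)
  have d: "d \<in> edge_nodes D e \<times> UNIV" using assms first_choice_edge_dual[OF fc] by simp
  have "psi D d = nodal D d" using first_choice_psi[OF fc] assms by (simp add: edge_dual_def)
  also have "\<dots> = (\<lambda>y. \<Sum>p\<in>edge_nodes D e \<times> UNIV. (if p = d then 1 else 0) *\<^sub>R nodal D p y)"
    using d fin by (simp add: if_distrib[of "\<lambda>c. c *\<^sub>R _"] cong: if_cong)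
  finally show ?thesis unfolding edge_space_alt
    by (intro CollectI exI[of _ "\<lambda>p. if p = d then 1 else 0"])
qed

lemma theta_edge_space:
  assumes "EdgeV e \<in> vdofs D"
  shows "theta D e \<in> edge_space D e"
  using assms primal_ok by (auto simp: vdofs_def primal_ok_def second_choice_def)

text \<open>The two choices of the primal space are unified by allowing the coefficient of the edge
  average function to be nonzero only when it is a degree of freedom.\<close>
lemma edge_space_decomposition:
  assumes "e < nedge D" "v \<in> edge_space D e"
  obtains s t where "v = (\<lambda>y. s *\<^sub>R theta D e y + (\<Sum>d\<in>edge_dual D e. t d *\<^sub>R psi D d y))"
    "s = 0 \<or> EdgeV e \<in> vdofs D"
proof (cases "use_avg D \<and> edge_nodes D e \<noteq> {}")
  case True
  then have "\<exists>!(s, t). t \<in> vecs (edge_dual D e) \<and>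
      v = (\<lambda>y. s *\<^sub>R theta D e y + (\<Sum>d\<in>edge_dual D e. t d *\<^sub>R psi D d y))"
    using primal_ok assms by (simp add: primal_ok_def second_choice_def)
  then obtain s t where "v = (\<lambda>y. s *\<^sub>R theta D e y + (\<Sum>d\<in>edge_dual D e. t d *\<^sub>R psi D d y))"
    by auto
  then show ?thesis using that True assms(1) by (simp add: vdofs_def)
next
  case False
  obtain c where v: "v = (\<lambda>y. \<Sum>p\<in>edge_nodes D e \<times> UNIV. c p *\<^sub>R nodal D p y)"
    using assms by (auto simp: edge_space_alt)
  have "v = (\<lambda>y. 0 *\<^sub>R theta D e y + (\<Sum>d\<in>edge_dual D e. c d *\<^sub>R psi D d y))"
  proof (cases "edge_nodes D e = {}")
    case True
    then show ?thesis by (simp add: v edge_dual_def)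
  next
    case nonempty: False
    then have fc: "first_choice D" using False primal_ok by (simp add: primal_ok_def)
    have "psi D d = nodal D d" if "d \<in> edge_nodes D e \<times> UNIV" for d
      using that first_choice_psi[OF fc] first_choice_edge_dual[OF fc assms(1)]
      by (auto simp: edge_dual_def)
    then show ?thesis using first_choice_edge_dual[OF fc assms(1)] by (simp add: v cong: sum.cong)
  qed
  then show ?thesis using that by blast
qed

text \<open>Under the second choice this is the uniqueness of the representation of zero; under the first
  one the functions are nodal and the coefficients are read off at the nodes.\<close>
lemma edge_dual_independent:
  assumes e: "e < nedge D" and zero: "(\<lambda>y. \<Sum>d\<in>edge_dual D e. t d *\<^sub>R psi D d y) = (\<lambda>_. 0)"
    and d: "d \<in> edge_dual D e"
  shows "t d = 0"
proof (cases "use_avg D")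
  case True
  define t' where "t' = (\<lambda>d. if d \<in> edge_dual D e then t d else 0)"
  have "edge_nodes D e \<noteq> {}" using d by (auto simp: edge_dual_def)
  moreover have "(\<lambda>_. 0) \<in> edge_space D e"
    unfolding edge_space_alt by (intro CollectI exI[of _ "\<lambda>_. 0"]) simp
  ultimately have "\<exists>!(s, t). t \<in> vecs (edge_dual D e) \<and>
      (\<lambda>_. 0) = (\<lambda>y. s *\<^sub>R theta D e y + (\<Sum>d\<in>edge_dual D e. t d *\<^sub>R psi D d y))"
    using primal_ok e True by (simp add: primal_ok_def second_choice_def)
  then have uniq: "p = q" if
    "case p of (s, t) \<Rightarrow> t \<in> vecs (edge_dual D e) \<and>
      (\<lambda>_. 0) = (\<lambda>y. s *\<^sub>R theta D e y + (\<Sum>d\<in>edge_dual D e. t d *\<^sub>R psi D d y))"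
    "case q of (s, t) \<Rightarrow> t \<in> vecs (edge_dual D e) \<and>
      (\<lambda>_. 0) = (\<lambda>y. s *\<^sub>R theta D e y + (\<Sum>d\<in>edge_dual D e. t d *\<^sub>R psi D d y))" for p q
    using that by blast
  have "(\<Sum>d\<in>edge_dual D e. t' d *\<^sub>R psi D d y) = 0" for y
    using fun_cong[OF zero, of y] by (simp add: t'_def)
  then have "(0 :: real, t') = (0, \<lambda>_. 0)" by (intro uniq) (simp_all add: t'_def vecs_def)
  then have "t' d = 0" by simp
  then show ?thesis using d by (simp add: t'_def)
next
  case False
  then have fc: "first_choice D" using primal_ok by (simp add: primal_ok_def)
  obtain x k where xk: "d = (x, k)" by (cases d)
  have fin: "finite (edge_nodes D e)" using finite_nodes by (simp add: edge_nodes_def)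
  note ed = first_choice_edge_dual[OF fc e]
  have x: "x \<in> edge_nodes D e" using d xk by (simp add: ed)
  have "(\<Sum>p\<in>edge_dual D e. t p *\<^sub>R psi D p x) $ k = (\<Sum>p\<in>edge_dual D e. if p = d then t p else 0)"
    unfolding sum_component
  proof (rule sum.cong)
    fix p assume p: "p \<in> edge_dual D e"
    then have "psi D p = nodal D p" using first_choice_psi[OF fc] by (simp add: edge_dual_def)
    then show "(t p *\<^sub>R psi D p x) $ k = (if p = d then t p else 0)"
      using p x phi_node unfolding ed xk
      by (cases p) (auto simp: nodal_def vphi_def axis_def edge_nodes_def split: if_splits)
  qed simp
  also have "\<dots> = t d" using d fin by (simp add: ed)
  finally show ?thesis using fun_cong[OF zero, of x] by simp
qed

lemma psi_continuous: "d \<in> dual D \<Longrightarrow> continuous_on UNIV (psi D d)"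
  and psi_smooth: "d \<in> dual D \<Longrightarrow> pw_smooth (mesh D) (psi D d)"
  and psi_fe_space: "d \<in> dual D \<Longrightarrow> psi D d \<in> fe_space"
proof -
  show "psi D d \<in> fe_space" if "d \<in> dual D" for d
    using dual_edge[OF that] psi_edge_space edge_space_subset that
    by (metis (mono_tags, lifting) edge_dual_def mem_Collect_eq subsetD)
  then show "d \<in> dual D \<Longrightarrow> continuous_on UNIV (psi D d)"
    and "d \<in> dual D \<Longrightarrow> pw_smooth (mesh D) (psi D d)"
    using fe_space_continuous fe_space_smooth by blast+
qed


section \<open>Velocities of sub-assembled vectors\<close>

lemma finite_wdelta: "finite (wdelta D)"
  by (rule finite_subset[of _ "{..<nsub D} \<times> dual D"]) (auto simp: wdelta_def finite_dual)

lemma finite_dofs: "finite (dofs D)"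
proof (rule finite_subset)
  show "dofs D \<subseteq> (\<lambda>(x, k). IntV x k) ` (nodes D \<times> UNIV) \<union> (\<lambda>(i, d). Dual i d) ` wdelta D
      \<union> (\<lambda>(x, k). CornerV x k) ` (corners D \<times> UNIV) \<union> EdgeV ` {..<nedge D} \<union> IntP ` {..<npres D}"
    by (auto simp: dofs_def vdofs_def)
  show "finite \<dots>"
    using finite_wdelta finite_nodes finite_subset[OF corners_nodes] by simp
qed

lemma Dual_dofs: "Dual i d \<in> dofs D \<longleftrightarrow> (i, d) \<in> wdelta D"
  by (cases d) (auto simp: dofs_def vdofs_def)

lemma IntP_dofs: "IntP m \<in> dofs D \<longleftrightarrow> m < npres D"
  by (auto simp: dofs_def vdofs_def)

lemma wdelta_dual: "(i, d) \<in> wdelta D \<Longrightarrow> d \<in> dual D"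
  and wdelta_nsub: "(i, d) \<in> wdelta D \<Longrightarrow> i < nsub D"
  by (simp_all add: wdelta_def)

lemma Rop_apply: "(i, d) \<in> wdelta D \<Longrightarrow> Rop D w (i, d) = w (Dual i d)"
  using finite_dofs Dual_dofs[of i d]
  by (simp add: Rop_def mv_def Rdelta_def if_distrib[of "\<lambda>c. c * _"] cong: if_cong)

lemma RopT_Dual: "RopT D v (Dual i d) = (if (i, d) \<in> wdelta D then v (i, d) else 0)"
proof -
  have "(\<Sum>c\<in>wdelta D. tr Rdelta (Dual i d) c * v c) = (\<Sum>c\<in>wdelta D. if c = (i, d) then v c else 0)"
    by (rule sum.cong) (auto simp: tr_def Rdelta_def split: prod.splits)
  then show ?thesis using finite_wdelta by (simp add: RopT_def mv_def Dual_dofs)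
qed

lemma RopT_other: "(\<And>i d. u \<noteq> Dual i d) \<Longrightarrow> RopT D v u = 0"
  by (auto simp: RopT_def mv_def tr_def Rdelta_def split: prod.splits intro!: sum.neutral)

lemma Rop_RopT: "v \<in> vecs (wdelta D) \<Longrightarrow> Rop D (RopT D v) = v"
  by (rule vecs_eqI[of _ "wdelta D"]) (auto simp: Rop_apply RopT_Dual, simp add: Rop_def)

lemma RopT_vecs [simp]: "RopT D v \<in> vecs (dofs D)"
  by (simp add: RopT_def)

lemma Rop_add: "Rop D (\<lambda>u. v u + w u) = (\<lambda>c. Rop D v c + Rop D w c)"
  and Rop_diff: "Rop D (\<lambda>u. v u - w u) = (\<lambda>c. Rop D v c - Rop D w c)"
  and Rop_scale: "Rop D (\<lambda>u. a * w u) = (\<lambda>c. a * Rop D w c)"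
  and BDelta_add: "BDelta D (\<lambda>c. x c + y c) = (\<lambda>r. BDelta D x r + BDelta D y r)"
  and BDelta_diff: "BDelta D (\<lambda>c. x c - y c) = (\<lambda>r. BDelta D x r - BDelta D y r)"
  and BDelta_scale: "BDelta D (\<lambda>c. a * x c) = (\<lambda>r. a * BDelta D x r)"
  by (simp_all add: Rop_def BDelta_def mv_add mv_diff mv_scale)

text \<open>The two closed subdomains that meet an open edge contain all of it, and the other ones are
  disjoint from it. A subdomain that misses one node of an edge therefore does not see any basis
  function of that edge.\<close>
lemma dual_psi_off_sub:
  assumes "d \<in> dual D" "j < nsub D" "(j, d) \<notin> wdelta D" "y \<in> closure (sub D j)"
  shows "psi D d y = 0"
proof -
  obtain e where e: "e < nedge D" "fst d \<in> edge_nodes D e" using dual_edge[OF assms(1)] .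
  have nd: "fst d \<notin> closure (sub D j)" using assms by (auto simp: wdelta_def)
  show ?thesis
  proof (rule edge_space_node_zero[OF e(1) psi_edge_space[OF e(1)]])
    show "d \<in> edge_dual D e" using assms(1) e(2) by (simp add: edge_dual_def)
    fix x assume x: "x \<in> edge_nodes D e"
    have "x \<notin> closure (sub D j)"
      using edge_sides[OF e(1)] assms(2) nd x e(2) unfolding edge_nodes_def by blast
    then show "phi D x y = 0" using phi_off_sub x assms(2,4) by (simp add: edge_nodes_def)
  qed
qed

lemma vel_smooth: "u \<in> dofs D \<Longrightarrow> pw_smooth (mesh D) (vel D u j)"
proof (cases u)
  case (EdgeV e)
  then show "u \<in> dofs D \<Longrightarrow> ?thesis"
    using theta_edge_space edge_space_subset fe_space_smooth by (auto simp: dofs_def)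
qed (use corners_nodes psi_smooth wdelta_dual nodal_smooth[unfolded nodal_def vidx_def] Dual_dofs in
  \<open>auto simp: dofs_def vdofs_def pw_smooth_zero\<close>)

lemma prs_continuous: "u \<in> dofs D \<Longrightarrow> pw_continuous (mesh D) (prs D u)"
proof (cases u)
  case (IntP m)
  assume "u \<in> dofs D"
  then have "m < npres D" using IntP IntP_dofs by simp
  then have "\<exists>p. real_polynomial_function p \<and> (\<forall>y\<in>interior T. pfn D m y = p y)" if "T \<in> mesh D" for T
    using pressure_ok that by (simp add: pressure_ok_def)
  then show ?thesis
    using IntP unfolding pw_continuous_def
    by (metis differentiable_imp_continuous_on differentiable_on_real_polynomial_function prs.simps(1))
qed (auto intro: pw_continuous_const)

lemma pfn_continuous: "m < npres D \<Longrightarrow> pw_continuous (mesh D) (pfn D m)"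
  using prs_continuous[of "IntP m"] by (simp add: IntP_dofs)

lemma velocity_smooth: "pw_smooth (mesh D) (velocity D w j)"
  unfolding velocity_def by (intro pw_smooth_sum vel_smooth)

lemma pressure_continuous: "pw_continuous (mesh D) (pressure D w)"
  unfolding pressure_def by (intro pw_continuous_intros prs_continuous)

lemma velocity_add: "velocity D (\<lambda>u. v u + w u) j = (\<lambda>y. velocity D v j y + velocity D w j y)"
  and velocity_scale: "velocity D (\<lambda>u. a * w u) j = (\<lambda>y. a *\<^sub>R velocity D w j y)"
  by (simp_all add: velocity_def scaleR_left_distrib sum.distrib scaleR_sum_right)

text \<open>The part of the velocity that may jump is isolated: the first sum is the same in every
  subdomain.\<close>
lemma velocity_split:
  "velocity D w j y =
    (\<Sum>u\<in>{u\<in>dofs D. \<forall>i d. u \<noteq> Dual i d}. w u *\<^sub>R vel D u 0 y)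
    + (\<Sum>d\<in>{d. (j, d) \<in> wdelta D}. w (Dual j d) *\<^sub>R psi D d y)"
proof -
  let ?N = "{u\<in>dofs D. \<forall>i d. u \<noteq> Dual i d}" and ?J = "{d. (j, d) \<in> wdelta D}"
  let ?V = "\<lambda>u. w u *\<^sub>R vel D u j y"
  have fin: "finite ?J"
    by (rule finite_subset[OF _ finite_dual]) (auto simp: wdelta_dual)
  have "sum ?V (dofs D) = sum ?V (?N \<union> Dual j ` ?J)"
  proof (rule sum.mono_neutral_right[OF finite_dofs])
    show "?N \<union> Dual j ` ?J \<subseteq> dofs D" using Dual_dofs by blast
    show "\<forall>u\<in>dofs D - (?N \<union> Dual j ` ?J). ?V u = 0"
    proof
      fix u assume u: "u \<in> dofs D - (?N \<union> Dual j ` ?J)"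
      then obtain i d where id: "u = Dual i d" by blast
      with u have "i \<noteq> j" using Dual_dofs by blast
      then show "?V u = 0" using id by simp
    qed
  qed
  also have "\<dots> = sum ?V ?N + sum ?V (Dual j ` ?J)"
    by (rule sum.union_disjoint) (use finite_dofs fin in auto)
  also have "sum ?V ?N = (\<Sum>u\<in>?N. w u *\<^sub>R vel D u 0 y)"
  proof (rule sum.cong)
    fix u assume "u \<in> ?N"
    then show "?V u = w u *\<^sub>R vel D u 0 y" by (cases u) auto
  qed simp
  also have "sum ?V (Dual j ` ?J) = (\<Sum>d\<in>?J. w (Dual j d) *\<^sub>R psi D d y)"
    by (subst sum.reindex) (auto simp: inj_on_def)
  finally show ?thesis by (simp add: velocity_def)
qed

lemma velocity_RopT:
  "velocity D (RopT D v) j = (\<lambda>y. \<Sum>d\<in>{d. (j, d) \<in> wdelta D}. v (j, d) *\<^sub>R psi D d y)"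
proof
  fix y
  have "(\<Sum>u\<in>{u\<in>dofs D. \<forall>i d. u \<noteq> Dual i d}. RopT D v u *\<^sub>R vel D u 0 y) = 0"
    by (rule sum.neutral) (metis (mono_tags, lifting) RopT_other mem_Collect_eq scaleR_zero_left)
  then show "velocity D (RopT D v) j y = (\<Sum>d\<in>{d. (j, d) \<in> wdelta D}. v (j, d) *\<^sub>R psi D d y)"
    unfolding velocity_split by (simp add: RopT_Dual)
qed

lemma pressure_eq_pres: "pressure D w = pres D (\<lambda>m. w (IntP m))"
proof
  fix y
  have "pressure D w y = (\<Sum>u\<in>IntP ` {..<npres D}. w u * prs D u y)"
    unfolding pressure_def
    by (rule sum.mono_neutral_right[OF finite_dofs]) (auto simp: dofs_def vdofs_def)
  then show "pressure D w y = pres D (\<lambda>m. w (IntP m)) y"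
    by (simp add: pres_def sum.reindex inj_on_def)
qed

lemma no_jump_iff:
  "BDelta D (Rop D w) = (\<lambda>_. 0) \<longleftrightarrow>
    (\<forall>d i j. (i, d) \<in> wdelta D \<longrightarrow> (j, d) \<in> wdelta D \<longrightarrow> w (Dual i d) = w (Dual j d))"
proof -
  have "\<forall>w\<in>vecs (wdelta D). BDelta D w = (\<lambda>_. 0) \<longleftrightarrow>
        (\<forall>d i j. (i, d) \<in> wdelta D \<longrightarrow> (j, d) \<in> wdelta D \<longrightarrow> w (i, d) = w (j, d))"
    using jump_matrix_ok by (simp add: jump_matrix_ok_def)
  moreover have "Rop D w \<in> vecs (wdelta D)" by (simp add: Rop_def)
  ultimately have "BDelta D (Rop D w) = (\<lambda>_. 0) \<longleftrightarrow>
    (\<forall>d i j. (i, d) \<in> wdelta D \<longrightarrow> (j, d) \<in> wdelta D \<longrightarrow> Rop D w (i, d) = Rop D w (j, d))" by blast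
  then show ?thesis by (auto simp: Rop_apply)
qed

lemma vel_fe_space:
  assumes "u \<in> dofs D" "\<And>i d. u \<noteq> Dual i d"
  shows "vel D u j \<in> fe_space"
proof (cases u)
  case (IntV x k)
  then show ?thesis
    using assms nodal_in_fe_space[of "(x, k)"] by (auto simp: dofs_def vdofs_def nodal_def vidx_def)
next
  case (CornerV x k)
  then show ?thesis
    using assms nodal_in_fe_space[of "(x, k)"] corners_nodes
    by (auto simp: dofs_def vdofs_def nodal_def vidx_def)
next
  case (EdgeV e)
  then show ?thesis
    using assms theta_edge_space edge_space_subset by (auto simp: dofs_def)
next
  case (IntP m)
  then show ?thesis using fe_space_zero by simp
qed (use assms in auto)

text \<open>If the copies of each dual degree of freedom agree, their common values define a continuous
  function. In a subdomain \<open>j\<close> the sum over all dual functions adds only terms that vanish there.\<close>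
lemma no_jump_imp_fe_function:
  assumes "BDelta D (Rop D w) = (\<lambda>_. 0)"
  shows "\<exists>u\<in>vecs (vidx D). \<forall>j<nsub D. \<forall>y\<in>sub D j. velocity D w j y = fe_function D u y"
proof -
  define t where "t = (\<lambda>d. w (Dual (SOME i. (i, d) \<in> wdelta D) d))"
  have t: "w (Dual i d) = t d" if "(i, d) \<in> wdelta D" for i d
  proof -
    have "(SOME i. (i, d) \<in> wdelta D, d) \<in> wdelta D" using that by (rule someI)
    then show ?thesis using assms that unfolding no_jump_iff t_def by blast
  qed
  define f where "f = (\<lambda>y. (\<Sum>u\<in>{u\<in>dofs D. \<forall>i d. u \<noteq> Dual i d}. w u *\<^sub>R vel D u 0 y)
    + (\<Sum>d\<in>dual D. t d *\<^sub>R psi D d y))"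
  have "f \<in> fe_space"
    unfolding f_def by (intro fe_space_add fe_space_sum psi_fe_space vel_fe_space) auto
  then obtain u where u: "u \<in> vecs (vidx D)" "f = fe_function D u" by (auto simp: fe_space_def)
  have "velocity D w j y = f y" if j: "j < nsub D" and y: "y \<in> sub D j" for j y
  proof -
    have y': "y \<in> closure (sub D j)" using y closure_subset by blast
    have "(\<Sum>d\<in>{d. (j, d) \<in> wdelta D}. w (Dual j d) *\<^sub>R psi D d y)
        = (\<Sum>d\<in>{d. (j, d) \<in> wdelta D}. t d *\<^sub>R psi D d y)"
      by (rule sum.cong) (simp_all add: t)
    also have "\<dots> = (\<Sum>d\<in>dual D. t d *\<^sub>R psi D d y)"
      by (rule sum.mono_neutral_left[OF finite_dual])
        (auto simp: wdelta_dual dual_psi_off_sub[OF _ j _ y'])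
    finally show ?thesis by (simp add: velocity_split f_def)
  qed
  then show ?thesis using u by blast
qed

text \<open>Finite element functions embed into the partially sub-assembled space as vectors without
  jumps. The embedding is a relation since the change of basis on the edges is given
  only implicitly; it is linear in both arguments.\<close>
definition represents :: "(dof \<Rightarrow> real) \<Rightarrow> (plane \<Rightarrow> plane) \<Rightarrow> bool" where
  "represents w f \<longleftrightarrow> w \<in> vecs (dofs D) \<and> (\<forall>m. w (IntP m) = 0) \<and> BDelta D (Rop D w) = (\<lambda>_. 0) \<and>
     (\<forall>j<nsub D. \<forall>y\<in>sub D j. velocity D w j y = f y)"

lemma represents_add:
  "represents v f \<Longrightarrow> represents w g \<Longrightarrow> represents (\<lambda>u. v u + w u) (\<lambda>y. f y + g y)"
  by (simp add: represents_def vecs_add Rop_add BDelta_add velocity_add)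

lemma represents_scale: "represents w f \<Longrightarrow> represents (\<lambda>u. a * w u) (\<lambda>y. a *\<^sub>R f y)"
  by (simp add: represents_def vecs_scale Rop_scale BDelta_scale velocity_scale)

lemma represents_zero: "represents (\<lambda>_. 0) (\<lambda>_. 0)"
  by (simp add: represents_def no_jump_iff velocity_def)

lemma represents_sum:
  "(\<And>i. i \<in> I \<Longrightarrow> \<exists>w. represents w (f i)) \<Longrightarrow> \<exists>w. represents w (\<lambda>y. \<Sum>i\<in>I. c i *\<^sub>R f i y)"
proof (induction I rule: infinite_finite_induct)
  case (insert i I)
  then obtain v w where "represents v (f i)" "represents w (\<lambda>y. \<Sum>i\<in>I. c i *\<^sub>R f i y)" by blast
  then have "represents (\<lambda>u. c i * v u + w u) (\<lambda>y. c i *\<^sub>R f i y + (\<Sum>i\<in>I. c i *\<^sub>R f i y))"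
    by (intro represents_add represents_scale)
  then show ?case using insert.hyps by auto
qed (use represents_zero in auto)

lemma represents_primal:
  assumes "u \<in> vdofs D" "\<And>i d. u \<noteq> Dual i d"
  shows "\<exists>w. represents w (vel D u 0)"
proof -
  define w where "w = (\<lambda>v. if v = u then 1 else 0 :: real)"
  have u: "u \<in> dofs D" and notP: "u \<noteq> IntP m" for m
    using assms(1) by (auto simp: dofs_def vdofs_def)
  have "velocity D w j = vel D u j" for j
    using u finite_dofs
    by (simp add: velocity_def w_def if_distrib[of "\<lambda>c. c *\<^sub>R _"] cong: if_cong)
  also have "vel D u j = vel D u 0" for j using assms(2) by (cases u) auto
  finally have "represents w (vel D u 0)"
    unfolding represents_def no_jump_iff
    using u notP assms(2)[symmetric] by (simp add: w_def vecs_def) (use notP in blast)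
  then show ?thesis by blast
qed

lemma represents_dual:
  assumes d: "d \<in> dual D"
  shows "\<exists>w. represents w (psi D d)"
proof -
  define v where "v = (\<lambda>(i :: nat, d'). if d' = d then 1 else 0 :: real)"
  have "velocity D (RopT D v) j y = psi D d y" if j: "j < nsub D" and y: "y \<in> sub D j" for j y
  proof -
    have fin: "finite {d. (j, d) \<in> wdelta D}"
      by (rule finite_subset[OF _ finite_dual]) (auto simp: wdelta_dual)
    have "y \<in> closure (sub D j)" using y closure_subset by blast
    then show ?thesis
      using dual_psi_off_sub[OF d j] fin
      by (simp add: velocity_RopT v_def if_distrib[of "\<lambda>c. c *\<^sub>R _"] cong: if_cong)
  qed
  then have "represents (RopT D v) (psi D d)"
    unfolding represents_def no_jump_iff by (simp add: RopT_other RopT_Dual v_def)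
  then show ?thesis by blast
qed

text \<open>By linearity one nodal function at a time: interior and corner functions are themselves basis
  functions, and an edge function is expanded in the primal and dual functions of its edge.\<close>
lemma fe_function_represented: "\<exists>w. represents w (fe_function D u)"
  unfolding fe_function_def
proof (rule represents_sum)
  fix p assume p: "p \<in> vidx D"
  obtain x k where xk: "p = (x, k)" by (cases p)
  then have x: "x \<in> nodes D" using p by (simp add: vidx_def)
  show "\<exists>w. represents w (nodal D p)"
  proof (rule node_cases[OF x])
    fix i assume "i < nsub D" "x \<in> sub D i"
    then have "IntV x k \<in> vdofs D" using x by (auto simp: vdofs_def)
    then show ?thesis using represents_primal[of "IntV x k"] by (simp add: nodal_def xk)
  next
    assume "x \<in> corners D"
    then have "CornerV x k \<in> vdofs D" by (auto simp: vdofs_def)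
    then show ?thesis using represents_primal[of "CornerV x k"] by (simp add: nodal_def xk)
  next
    fix e assume e: "e < nedge D" "x \<in> edge_nodes D e"
    have fin: "finite (edge_nodes D e)" using finite_nodes by (simp add: edge_nodes_def)
    have "nodal D p = (\<lambda>y. \<Sum>q\<in>edge_nodes D e \<times> UNIV. (if q = p then 1 else 0) *\<^sub>R nodal D q y)"
      using e fin xk by (simp add: if_distrib[of "\<lambda>c. c *\<^sub>R _"] cong: if_cong)
    then have "nodal D p \<in> edge_space D e"
      unfolding edge_space_alt by (intro CollectI exI[of _ "\<lambda>q. if q = p then 1 else 0"])
    then obtain s t where
      st: "nodal D p = (\<lambda>y. s *\<^sub>R theta D e y + (\<Sum>d\<in>edge_dual D e. t d *\<^sub>R psi D d y))"
        "s = 0 \<or> EdgeV e \<in> vdofs D"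
      by (rule edge_space_decomposition[OF e(1)])
    have "\<exists>w. represents w (\<lambda>y. s *\<^sub>R theta D e y)"
    proof (cases "s = 0")
      case True
      then show ?thesis using represents_zero by auto
    next
      case False
      then obtain w where "represents w (theta D e)" using st(2) represents_primal[of "EdgeV e"] by auto
      then show ?thesis using represents_scale by blast
    qed
    moreover have "\<exists>w. represents w (\<lambda>y. \<Sum>d\<in>edge_dual D e. t d *\<^sub>R psi D d y)"
      by (rule represents_sum) (auto simp: edge_dual_def intro: represents_dual)
    ultimately show ?thesis unfolding st(1) using represents_add by blast
  qed
qed


section \<open>The sub-assembled form and the divergence constraint\<close>

text \<open>The matrix entries are forms of basis functions, so bilinearity turns the matrix form into the
  Stokes form of the velocities and pressures.\<close>
lemma Aform_eq:
  "Aform D v w = (\<Sum>j<nsub D. form_a (sub D j) (velocity D w j) (velocity D v j)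
     + form_b (sub D j) (velocity D w j) (pressure D v)
     + form_b (sub D j) (velocity D v j) (pressure D w))"
proof -
  let ?t = "\<lambda>j u u'. form_a (sub D j) (vel D u j) (vel D u' j)
      + form_b (sub D j) (vel D u j) (prs D u') + form_b (sub D j) (vel D u' j) (prs D u)"
  have expand: "form_a (sub D j) (velocity D w j) (velocity D v j)
     + form_b (sub D j) (velocity D w j) (pressure D v)
     + form_b (sub D j) (velocity D v j) (pressure D w)
     = (\<Sum>u\<in>dofs D. \<Sum>u'\<in>dofs D. w u * v u' * ?t j u u')" if j: "j < nsub D" for j
  proof -
    note reg = region_sub[OF j]
    have a: "form_a (sub D j) (velocity D w j) (velocity D v j)
        = (\<Sum>u\<in>dofs D. \<Sum>u'\<in>dofs D. w u * v u' * form_a (sub D j) (vel D u j) (vel D u' j))"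
      using velocity_smooth[unfolded velocity_def, of v j] unfolding velocity_def
      by (simp add: form_a_sum_left[OF reg vel_smooth] form_a_sum_right[OF reg vel_smooth] vel_smooth
          sum_distrib_left mult.assoc)
    have b: "form_b (sub D j) (velocity D w j) (pressure D v)
        = (\<Sum>u\<in>dofs D. \<Sum>u'\<in>dofs D. w u * v u' * form_b (sub D j) (vel D u j) (prs D u'))" for w v
      using pressure_continuous[unfolded pressure_def, of v] unfolding velocity_def pressure_def
      by (simp add: form_b_sum_left[OF reg vel_smooth] form_b_sum_right[OF reg vel_smooth prs_continuous]
          sum_distrib_left mult.assoc)
    have b': "form_b (sub D j) (velocity D v j) (pressure D w)
        = (\<Sum>u\<in>dofs D. \<Sum>u'\<in>dofs D. w u * v u' * form_b (sub D j) (vel D u' j) (prs D u))"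
      unfolding b by (subst sum.swap) (simp add: mult_ac)
    show ?thesis unfolding a b[of w v] b' by (simp add: sum.distrib distrib_left)
  qed
  have "Aform D v w = (\<Sum>u\<in>dofs D. \<Sum>u'\<in>dofs D. \<Sum>j<nsub D. w u * v u' * ?t j u u')"
    unfolding Aform_def Aop_def dot_def mv_def Atilde_def
    by (auto simp: sum_distrib_right sum_distrib_left mult_ac intro!: sum.cong)
  also have "\<dots> = (\<Sum>u\<in>dofs D. \<Sum>j<nsub D. \<Sum>u'\<in>dofs D. w u * v u' * ?t j u u')"
    by (rule sum.cong[OF refl], rule sum.swap)
  also have "\<dots> = (\<Sum>j<nsub D. \<Sum>u\<in>dofs D. \<Sum>u'\<in>dofs D. w u * v u' * ?t j u u')"
    by (rule sum.swap)
  finally show ?thesis by (simp add: expand)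
qed

lemma Aform_commute: "Aform D v w = Aform D w v"
  unfolding Aform_eq by (rule sum.cong) (simp_all add: form_a_commute)

lemma Atilde_IntP_row:
  assumes "m < npres D"
  shows "(\<Sum>u\<in>vdofs D. Atilde D (IntP m) u * w u)
    = (\<Sum>j<nsub D. form_b (sub D j) (velocity D w j) (pfn D m))"
    and "Aop D w (IntP m) = (\<Sum>j<nsub D. form_b (sub D j) (velocity D w j) (pfn D m))"
proof -
  have sub: "vdofs D \<subseteq> dofs D" by (auto simp: dofs_def)
  have A: "Atilde D (IntP m) u = (\<Sum>j<nsub D. form_b (sub D j) (vel D u j) (pfn D m))" for u
    by (simp add: Atilde_def)
  have V: "form_b (sub D j) (velocity D w j) (pfn D m)
      = (\<Sum>u\<in>dofs D. w u * form_b (sub D j) (vel D u j) (pfn D m))" if "j < nsub D" for j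
    unfolding velocity_def
    by (rule form_b_sum_left[OF region_sub[OF that] vel_smooth pfn_continuous[OF assms]])
  have rhs: "(\<Sum>j<nsub D. form_b (sub D j) (velocity D w j) (pfn D m))
      = (\<Sum>u\<in>dofs D. Atilde D (IntP m) u * w u)"
    by (simp add: V A sum_distrib_right mult.commute[of "w _"]) (rule sum.swap)
  show "Aop D w (IntP m) = (\<Sum>j<nsub D. form_b (sub D j) (velocity D w j) (pfn D m))"
    unfolding rhs using assms by (simp add: Aop_def mv_def IntP_dofs)
  have "(\<Sum>u\<in>vdofs D. Atilde D (IntP m) u * w u) = (\<Sum>u\<in>dofs D. Atilde D (IntP m) u * w u)"
  proof (rule sum.mono_neutral_left[OF finite_dofs sub], rule ballI)
    fix u assume "u \<in> dofs D - vdofs D"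
    then obtain n where "u = IntP n" by (auto simp: dofs_def)
    then show "Atilde D (IntP m) u * w u = 0" by (simp add: A)
  qed
  then show "(\<Sum>u\<in>vdofs D. Atilde D (IntP m) u * w u)
    = (\<Sum>j<nsub D. form_b (sub D j) (velocity D w j) (pfn D m))" using rhs by simp
qed

lemma W0_iff: "w \<in> W0 D \<longleftrightarrow> w \<in> vecs (dofs D) \<and>
    (\<forall>m<npres D. (\<Sum>j<nsub D. form_b (sub D j) (velocity D w j) (pfn D m)) = 0)"
  by (auto simp: W0_def Atilde_IntP_row)

text \<open>Membership in the constrained space is tested with the pressure basis, hence with all
  discrete pressures.\<close>
lemma W0_orthogonal_pres:
  assumes "w \<in> W0 D"
  shows "(\<Sum>j<nsub D. form_b (sub D j) (velocity D w j) (pres D q)) = 0"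
proof -
  have "(\<Sum>j<nsub D. form_b (sub D j) (velocity D w j) (pres D q))
      = (\<Sum>j<nsub D. \<Sum>m<npres D. q m * form_b (sub D j) (velocity D w j) (pfn D m))"
    unfolding pres_def
    by (rule sum.cong[OF refl], subst form_b_sum_right)
      (auto intro: region_sub velocity_smooth pfn_continuous)
  also have "\<dots> = (\<Sum>m<npres D. q m * (\<Sum>j<nsub D. form_b (sub D j) (velocity D w j) (pfn D m)))"
    by (subst sum.swap) (simp add: sum_distrib_left)
  also have "\<dots> = 0" using assms by (simp add: W0_iff)
  finally show ?thesis .
qed

text \<open>The indefinite Stokes form becomes a Dirichlet energy, as the pressure terms cancel.\<close>
lemma Aform_W0:
  assumes "v \<in> W0 D" "w \<in> W0 D"
  shows "Aform D v w = (\<Sum>j<nsub D. form_a (sub D j) (velocity D w j) (velocity D v j))"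
  using W0_orthogonal_pres[OF assms(1)] W0_orthogonal_pres[OF assms(2)]
  by (simp add: Aform_eq pressure_eq_pres sum.distrib)

lemma Aform_nonneg_W0: "w \<in> W0 D \<Longrightarrow> 0 \<le> Aform D w w"
  by (auto simp: Aform_W0 intro!: sum_nonneg form_a_nonneg region_sub velocity_smooth)

lemma Aform_pressure_free:
  assumes "\<And>m. w (IntP m) = 0"
  shows "Aform D w w = (\<Sum>j<nsub D. form_a (sub D j) (velocity D w j) (velocity D w j))"
  by (simp add: Aform_eq pressure_eq_pres pres_def assms)

lemma Aform_pressure_free_nonneg:
  assumes "\<And>m. w (IntP m) = 0"
  shows "0 \<le> Aform D w w"
  unfolding Aform_pressure_free[of w, OF assms]
  by (auto intro!: sum_nonneg form_a_nonneg region_sub velocity_smooth)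

lemma Aform_RopT_nonneg: "0 \<le> Aform D (RopT D v) (RopT D v)"
  by (rule Aform_pressure_free_nonneg) (simp add: RopT_other)

lemma Aop_add: "Aop D (\<lambda>u. v u + w u) = (\<lambda>u. Aop D v u + Aop D w u)"
  and Aop_scale: "Aop D (\<lambda>u. c * w u) = (\<lambda>u. c * Aop D w u)"
  by (simp_all add: Aop_def mv_add mv_scale)

lemma Aform_add_scale:
  "Aform D (\<lambda>u. v u + t * w u) (\<lambda>u. v u + t * w u) = Aform D v v + 2 * t * Aform D v w + t\<^sup>2 * Aform D w w"
proof -
  have left: "Aform D (\<lambda>u. v u + t * w u) z = Aform D v z + t * Aform D w z" for z
    by (simp add: Aform_def Aop_add Aop_scale dot_add_left dot_scale_left)
  show ?thesis
    unfolding left Aform_commute[of _ "\<lambda>u. v u + t * w u"]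
    by (simp add: left Aform_commute[of w v] power2_eq_square algebra_simps)
qed

lemma W0_add_scale: "v \<in> W0 D \<Longrightarrow> w \<in> W0 D \<Longrightarrow> (\<lambda>u. v u + t * w u) \<in> W0 D"
  by (simp add: W0_def vecs_add vecs_scale distrib_left sum.distrib mult.left_commute
      flip: sum_distrib_left)

lemma Aform_cauchy_schwarz_W0:
  assumes "v \<in> W0 D" "w \<in> W0 D"
  shows "(Aform D v w)\<^sup>2 \<le> Aform D v v * Aform D w w"
  by (rule discriminant_le)
    (use Aform_nonneg_W0[OF W0_add_scale[OF assms]] in \<open>simp add: Aform_add_scale\<close>)

lemma RopT_add_scale: "RopT D (\<lambda>c. x c + t * y c) = (\<lambda>u. RopT D x u + t * RopT D y u)"
  by (simp add: RopT_def mv_add mv_scale)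

lemma Aform_cauchy_schwarz_RopT:
  "(Aform D (RopT D x) (RopT D y))\<^sup>2 \<le> Aform D (RopT D x) (RopT D x) * Aform D (RopT D y) (RopT D y)"
  by (rule discriminant_le)
    (use Aform_RopT_nonneg[of "\<lambda>c. x c + _ * y c"] in \<open>simp add: Aform_add_scale RopT_add_scale\<close>)

lemma dot_Rop: "dot (dofs D) w (RopT D v) = dot (wdelta D) (Rop D w) v"
  and dot_BDelta: "dot (wdelta D) v (BDeltaT D x) = dot {..<nmult D} (BDelta D v) x"
  and dot_BDeltaD: "dot (wdelta D) v (BDeltaDT D x) = dot {..<nmult D} (BDeltaD D v) x"
  by (simp_all add: Rop_def RopT_def BDelta_def BDeltaT_def BDeltaD_def BDeltaDT_def dot_mv_tr)

lemma BDeltaDT_vecs: "BDeltaDT D y \<in> vecs (wdelta D)"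
  by (simp add: BDeltaDT_def)


section \<open>The jump matrices\<close>

lemma delta_dagger_edge:
  assumes "e < nedge D" "x \<in> open_edge D e"
  shows "delta_dagger D x = 1 / 2"
proof -
  obtain i j where "i < nsub D" "j < nsub D" "i \<noteq> j"
    "\<And>k. k < nsub D \<Longrightarrow> x \<in> closure (sub D k) \<longleftrightarrow> k = i \<or> k = j"
    using edge_sides[OF assms(1)] assms(2) by blast
  then have "{k. k < nsub D \<and> x \<in> closure (sub D k)} = {i, j}" by auto
  then show ?thesis using \<open>i \<noteq> j\<close> by (simp add: delta_dagger_def)
qed

lemma jump_row:
  assumes "r < nmult D"
  shows "\<exists>d i j. i \<noteq> j \<and> (i, d) \<in> wdelta D \<and> (j, d) \<in> wdelta D \<and>
    (\<forall>c\<in>wdelta D. Bdelta D r c = (if c = (i, d) then 1 else if c = (j, d) then -1 else 0))"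
  using jump_matrix_ok assms by (simp add: jump_matrix_ok_def)

text \<open>Two constraints on the same degree of freedom would be linearly dependent, as only two
  subdomains share it, which contradicts the full row rank.\<close>
lemma jump_row_unique:
  assumes r: "r < nmult D" "r' < nmult D" and ne: "r \<noteq> r'"
    and c: "(i, d) \<in> wdelta D" "Bdelta D r (i, d) \<noteq> 0"
  shows "Bdelta D r' (i, d) = 0"
proof (rule ccontr)
  assume c': "Bdelta D r' (i, d) \<noteq> 0"
  obtain a p q where row: "p \<noteq> q" "(p, a) \<in> wdelta D" "(q, a) \<in> wdelta D"
    "\<And>c. c \<in> wdelta D \<Longrightarrow> Bdelta D r c = (if c = (p, a) then 1 else if c = (q, a) then -1 else 0)"
    using jump_row[OF r(1)] by blast
  obtain a' p' q' where row': "p' \<noteq> q'" "(p', a') \<in> wdelta D" "(q', a') \<in> wdelta D"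
    "\<And>c. c \<in> wdelta D \<Longrightarrow> Bdelta D r' c = (if c = (p', a') then 1 else if c = (q', a') then -1 else 0)"
    using jump_row[OF r(2)] by blast
  have a: "a = d" "a' = d" using c c' row(4)[OF c(1)] row'(4)[OF c(1)] by (auto split: if_splits)
  obtain e where e: "e < nedge D" "fst d \<in> edge_nodes D e" using dual_edge[OF wdelta_dual[OF c(1)]] .
  then have "fst d \<in> open_edge D e" by (simp add: edge_nodes_def)
  then obtain k l where "\<And>s. s < nsub D \<Longrightarrow> fst d \<in> closure (sub D s) \<longleftrightarrow> s = k \<or> s = l"
    using edge_sides[OF e(1)] by blast
  then have kl: "s = k \<or> s = l" if "(s, d) \<in> wdelta D" for s using that by (auto simp: wdelta_def)
  have pq: "p' = p \<and> q' = q \<or> p' = q \<and> q' = p"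
    using kl[of p] kl[of q] kl[of p'] kl[of q'] row(1-3) row'(1-3) a by blast
  \<comment> \<open>Both rows compare the same two copies of \<open>d\<close>, so they agree up to the sign \<open>s\<close>.\<close>
  define s :: real where "s = (if p' = p then 1 else -1)"
  define y where "y = (\<lambda>t. if t = r then 1 else if t = r' then - s else 0)"
  have "BDeltaT D y c = 0" if "c \<in> wdelta D" for c
  proof -
    have "BDeltaT D y c = (\<Sum>t<nmult D. (if t = r then Bdelta D r c else 0)
        + (if t = r' then - s * Bdelta D r' c else 0))"
      using that ne by (auto simp: BDeltaT_def mv_def tr_def y_def intro!: sum.cong)
    also have "\<dots> = Bdelta D r c - s * Bdelta D r' c"
      using r by (simp add: sum.distrib)
    also have "\<dots> = 0"
      using pq row(1) unfolding row(4)[OF that] row'(4)[OF that] a s_def by auto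
    finally show ?thesis .
  qed
  then have "BDeltaT D y = (\<lambda>_. 0)"
    by (intro vecs_eqI[of _ "wdelta D"]) (simp_all add: BDeltaT_def)
  moreover have "y \<in> vecs {..<nmult D}" using r by (simp add: y_def vecs_def)
  ultimately have "y = (\<lambda>_. 0)" using jump_matrix_ok by (simp add: jump_matrix_ok_def)
  then have "y r = 0" by simp
  then show False by (simp add: y_def)
qed

text \<open>Each row meets its two columns alone, and there the scaling is \<open>1 / 2\<close>: the two contributions
  of size \<open>1 / 2\<close> add up to the identity.\<close>
lemma BDelta_BDeltaDT:
  assumes "y \<in> vecs {..<nmult D}"
  shows "BDelta D (BDeltaDT D y) = y"
proof (rule vecs_eqI[OF _ assms])
  show "BDelta D (BDeltaDT D y) \<in> vecs {..<nmult D}" by (simp add: BDelta_def)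
  fix r assume "r \<in> {..<nmult D}"
  then have r: "r < nmult D" by simp
  obtain d i j where row: "i \<noteq> j" "(i, d) \<in> wdelta D" "(j, d) \<in> wdelta D"
    "\<And>c. c \<in> wdelta D \<Longrightarrow> Bdelta D r c = (if c = (i, d) then 1 else if c = (j, d) then -1 else 0)"
    using jump_row[OF r] by blast
  obtain e where e: "e < nedge D" "fst d \<in> edge_nodes D e" using dual_edge[OF wdelta_dual[OF row(2)]] .
  have half: "delta_dagger D (fst d) = 1 / 2"
    using delta_dagger_edge[OF e(1)] e(2) by (simp add: edge_nodes_def)
  have col: "BDeltaDT D y (k, d) = Bdelta D r (k, d) * y r / 2"
    if k: "(k, d) \<in> wdelta D" "Bdelta D r (k, d) \<noteq> 0" for k
  proof -
    have "BDeltaDT D y (k, d) = (\<Sum>t<nmult D. Bdelta D t (k, d) * y t / 2)"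
      using k(1) by (simp add: BDeltaDT_def mv_def tr_def BdeltaD_def half)
    also have "\<dots> = (\<Sum>t<nmult D. if t = r then Bdelta D r (k, d) * y r / 2 else 0)"
      by (rule sum.cong) (use jump_row_unique[OF r _ _ k] in auto)
    finally show ?thesis using r by simp
  qed
  have "BDelta D (BDeltaDT D y) r = (\<Sum>c\<in>wdelta D. Bdelta D r c * BDeltaDT D y c)"
    using r by (simp add: BDelta_def mv_def)
  also have "\<dots> = (\<Sum>c\<in>{(i, d), (j, d)}. Bdelta D r c * BDeltaDT D y c)"
    by (rule sum.mono_neutral_right[OF finite_wdelta]) (use row in auto)
  also have "\<dots> = y r"
    using row col[of i] col[of j] by simp
  finally show "BDelta D (BDeltaDT D y) r = y r" .
qed


section \<open>Definiteness of the dual block and solvability\<close>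

lemma edge_dual_wdelta:
  assumes "e < nedge D" "j < nsub D" "x \<in> edge_nodes D e" "x \<in> closure (sub D j)" "d \<in> edge_dual D e"
  shows "(j, d) \<in> wdelta D"
  using edge_sides[OF assms(1)] assms unfolding wdelta_def edge_dual_def edge_nodes_def by blast

text \<open>Evaluating at a node of one edge separates its dual functions from those of the other edges.\<close>
lemma psi_other_edge:
  assumes "d \<in> dual D" "d \<notin> edge_dual D e" "e < nedge D" "x \<in> edge_nodes D e"
  shows "psi D d x = 0"
proof -
  obtain e' where e': "e' < nedge D" "fst d \<in> edge_nodes D e'" using dual_edge[OF assms(1)] .
  have "e' \<noteq> e" using assms e' by (auto simp: edge_dual_def)
  show ?thesis
  proof (rule edge_space_node_zero[OF e'(1) psi_edge_space[OF e'(1)]])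
    show "d \<in> edge_dual D e'" using assms(1) e' by (simp add: edge_dual_def)
    fix x' assume x': "x' \<in> edge_nodes D e'"
    then have "x' \<noteq> x"
      using open_edge_disjoint[OF e'(1) assms(3)] \<open>e' \<noteq> e\<close> assms(4) by (auto simp: edge_nodes_def)
    then show "phi D x' x = 0" using phi_node x' assms(4) by (auto simp: edge_nodes_def)
  qed
qed

lemma psi_endpoint:
  assumes "d \<in> dual D" "e < nedge D"
  shows "psi D d (pathstart (edge D e)) = 0"
proof -
  obtain e' where e': "e' < nedge D" "fst d \<in> edge_nodes D e'" using dual_edge[OF assms(1)] .
  then show ?thesis
    using assms by (intro edge_space_node_zero[OF e'(1) psi_edge_space[OF e'(1)]] phi_endpoint)
      (auto simp: edge_dual_def)
qed

text \<open>A dual velocity without energy is constant on each subdomain. The constant is zero, because all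
  dual functions vanish at the end points of an edge of the subdomain. Evaluation at the nodes of
  one edge at a time then shows that the coefficients vanish.\<close>
lemma dual_block_definite:
  assumes v: "v \<in> vecs (wdelta D)" and zero: "Aform D (RopT D v) (RopT D v) = 0"
  shows "v = (\<lambda>_. 0)"
proof (rule vecs_eqI[OF v vecs_zero])
  fix c assume "c \<in> wdelta D"
  moreover obtain j d where jd: "c = (j, d)" by (cases c)
  ultimately have c: "(j, d) \<in> wdelta D" by simp
  define J where "J = {d. (j, d) \<in> wdelta D}"
  have fin: "finite J" unfolding J_def
    by (rule finite_subset[OF _ finite_dual]) (auto simp: wdelta_dual)
  define V where "V = (\<lambda>y. \<Sum>d\<in>J. v (j, d) *\<^sub>R psi D d y)"
  have VR: "velocity D (RopT D v) j = V" by (simp add: velocity_RopT V_def J_def)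
  note j = wdelta_nsub[OF c]
  obtain e where e: "e < nedge D" "fst d \<in> edge_nodes D e" using dual_edge[OF wdelta_dual[OF c]] .
  have cl: "fst d \<in> closure (sub D j)" using c by (simp add: wdelta_def)
  have "form_a (sub D j) V V = 0"
    using zero j unfolding Aform_pressure_free[of "RopT D v", OF RopT_other, simplified]
    by (subst (asm) sum_nonneg_eq_0_iff)
      (auto simp: VR[symmetric] intro!: form_a_nonneg region_sub velocity_smooth)
  moreover have "continuous_on UNIV V"
    unfolding V_def J_def by (auto intro!: continuous_intros psi_continuous wdelta_dual)
  moreover have "pw_smooth (mesh D) V" using velocity_smooth VR by metis
  ultimately obtain a where a: "\<forall>y\<in>closure (sub D j). V y = a"
    using form_a_eq_0_imp_constant[OF region_sub[OF j] sub_connected[OF j]] by blast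
  have "V (pathstart (edge D e)) = 0"
    unfolding V_def J_def by (auto intro!: sum.neutral simp: psi_endpoint[OF wdelta_dual e(1)])
  moreover have "pathstart (edge D e) \<in> closure (sub D j)"
    using endpoint_in_closure[OF e(1) j _ cl] e(2) by (simp add: edge_nodes_def)
  ultimately have a0: "a = 0" using a by auto
  have "(\<lambda>y. \<Sum>d\<in>edge_dual D e. v (j, d) *\<^sub>R psi D d y) = (\<lambda>_. 0)"
  proof (rule edge_space_eq_0[OF edge_space_sum[OF psi_edge_space[OF e(1)]]])
    fix x assume x: "x \<in> edge_nodes D e"
    have "x \<in> closure (sub D j)"
      using edge_sides[OF e(1)] j cl e(2) x unfolding edge_nodes_def by blast
    then have "0 = V x" using a a0 by simp
    also have "\<dots> = (\<Sum>d\<in>edge_dual D e. v (j, d) *\<^sub>R psi D d x)"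
      unfolding V_def
    proof (rule sum.mono_neutral_right[OF fin])
      show "edge_dual D e \<subseteq> J" using edge_dual_wdelta[OF e(1) j e(2) cl] by (auto simp: J_def)
      show "\<forall>i\<in>J - edge_dual D e. v (j, i) *\<^sub>R psi D i x = 0"
        using psi_other_edge[OF wdelta_dual _ e(1) x] by (auto simp: J_def)
    qed
    finally show "(\<Sum>d\<in>edge_dual D e. v (j, d) *\<^sub>R psi D d x) = 0" by simp
  qed
  moreover have "d \<in> edge_dual D e" using wdelta_dual[OF c] e(2) by (simp add: edge_dual_def)
  ultimately show "v c = 0" using edge_dual_independent[OF e(1), of "\<lambda>d. v (j, d)"] jd by simp
qed

lemma Atilde_commute: "Atilde D u v = Atilde D v u"
  unfolding Atilde_def
  by (rule sum.cong) (simp_all add: form_a_commute[of _ "vel D u _"] add.commute add.left_commute)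

lemma Aop_zero_imp_W0: "w \<in> vecs (dofs D) \<Longrightarrow> (\<And>m. Aop D w (IntP m) = 0) \<Longrightarrow> w \<in> W0 D"
  unfolding W0_iff by (metis Atilde_IntP_row(2))

text \<open>A kernel vector \<open>k\<close> satisfies the constraint and has zero energy, so jump stability forces the
  energy of its image under the jump operator to vanish. By definiteness of the dual block that
  image is zero, and so is the jump of \<open>k\<close>; the right-hand side pairs with \<open>k\<close> through this jump.\<close>
lemma subassembled_problem_solvable:
  assumes stable: "jump_stable b D"
  shows "Asolve D (RopT D (BDeltaT D x)) \<in> vecs (dofs D)"
    and "Aop D (Asolve D (RopT D (BDeltaT D x))) = RopT D (BDeltaT D x)"
proof -
  have "\<exists>z\<in>vecs (dofs D). mv (dofs D) (dofs D) (Atilde D) z = RopT D (BDeltaT D x)"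
  proof (rule symmetric_system_solvable[OF finite_dofs Atilde_commute RopT_vecs])
    fix k assume k: "k \<in> vecs (dofs D)" and "mv (dofs D) (dofs D) (Atilde D) k = (\<lambda>_. 0)"
    then have Ak: "Aop D k = (\<lambda>_. 0)" by (simp add: Aop_def)
    then have kW: "k \<in> W0 D" using Aop_zero_imp_W0[OF k] by simp
    have "Aform D k k = 0" by (simp add: Aform_def Ak dot_def)
    then have "Aform D (jump_op D k) (jump_op D k) \<le> 0"
      using stable kW unfolding jump_stable_def by fastforce
    then have "Aform D (jump_op D k) (jump_op D k) = 0"
      using Aform_RopT_nonneg unfolding jump_op_def by (simp add: order_antisym)
    then have "BDeltaDT D (BDelta D (Rop D k)) = (\<lambda>_. 0)"
      unfolding jump_op_def by (rule dual_block_definite[rotated]) (simp add: BDeltaDT_def)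
    moreover have "BDelta D (\<lambda>_. 0) = (\<lambda>_. 0)" by (simp add: BDelta_def mv_def fun_eq_iff)
    ultimately have "BDelta D (BDeltaDT D (BDelta D (Rop D k))) = (\<lambda>_. 0)" by simp
    then have "BDelta D (Rop D k) = (\<lambda>_. 0)"
      using BDelta_BDeltaDT[of "BDelta D (Rop D k)"] by (simp add: BDelta_def)
    then show "dot (dofs D) k (RopT D (BDeltaT D x)) = 0"
      unfolding dot_Rop dot_BDelta by (simp add: dot_def)
  qed
  then have "\<exists>z. z \<in> vecs (dofs D) \<and> Aop D z = RopT D (BDeltaT D x)" by (auto simp: Aop_def)
  then have "Asolve D (RopT D (BDeltaT D x)) \<in> vecs (dofs D) \<and>
      Aop D (Asolve D (RopT D (BDeltaT D x))) = RopT D (BDeltaT D x)"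
    unfolding Asolve_def by (rule someI_ex)
  then show "Asolve D (RopT D (BDeltaT D x)) \<in> vecs (dofs D)"
    and "Aop D (Asolve D (RopT D (BDeltaT D x))) = RopT D (BDeltaT D x)" by auto
qed


section \<open>Consequences of inf-sup stability\<close>

abbreviation pidx :: "nat set" where
  "pidx \<equiv> {..<npres D}"

lemma fe_function_smooth: "pw_smooth (mesh D) (fe_function D u)"
  unfolding fe_function_def by (intro pw_smooth_sum nodal_smooth)

lemma pres_continuous: "pw_continuous (mesh D) (pres D q)"
  unfolding pres_def by (intro pw_continuous_intros pfn_continuous) simp

lemma matA_eq: "matA D p q = form_a \<Omega> (nodal D p) (nodal D q)"
  and matB_eq: "matB D m p = form_b \<Omega> (nodal D p) (pfn D m)"
  by (simp_all add: matA_def matB_def dom_eq nodal_def case_prod_beta)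

lemma dot_matA: "dot (vidx D) w (mv (vidx D) (vidx D) (matA D) u) = form_a \<Omega> (fe_function D w) (fe_function D u)"
proof -
  have "form_a \<Omega> (fe_function D w) (fe_function D u)
      = (\<Sum>p\<in>vidx D. w p * (\<Sum>q\<in>vidx D. u q * form_a \<Omega> (nodal D p) (nodal D q)))"
    using fe_function_smooth[unfolded fe_function_def, of u] unfolding fe_function_def
    by (simp add: form_a_sum_left[OF region_\<Omega> nodal_smooth] form_a_sum_right[OF region_\<Omega> nodal_smooth]
        nodal_smooth)
  then show ?thesis by (simp add: dot_def mv_def matA_eq mult.commute)
qed

lemma matB_apply:
  "m < npres D \<Longrightarrow> mv pidx (vidx D) (matB D) u m = form_b \<Omega> (fe_function D u) (pfn D m)"
  unfolding fe_function_def
  by (simp add: form_b_sum_left[OF region_\<Omega> nodal_smooth] pfn_continuous mv_def matB_eq mult.commute)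

lemma dot_matB: "dot pidx q (mv pidx (vidx D) (matB D) u) = form_b \<Omega> (fe_function D u) (pres D q)"
  unfolding pres_def dot_def
  by (subst form_b_sum_right[OF region_\<Omega> fe_function_smooth]) (simp_all add: pfn_continuous matB_apply)

lemma integral_pres: "pw_continuous (mesh D) F \<Longrightarrow>
    integral \<Omega> (\<lambda>y. F y * pres D q y) = (\<Sum>m<npres D. q m * integral \<Omega> (\<lambda>y. F y * pfn D m y))"
proof -
  assume F: "pw_continuous (mesh D) F"
  have "integral \<Omega> (\<lambda>y. F y * pres D q y) = integral \<Omega> (\<lambda>y. \<Sum>m<npres D. q m * (F y * pfn D m y))"
    by (simp add: pres_def sum_distrib_left mult.left_commute)
  also have "\<dots> = (\<Sum>m<npres D. integral \<Omega> (\<lambda>y. q m * (F y * pfn D m y)))"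
    by (rule integral_sum) (auto intro!: pw_continuous_integrable[OF _ region_\<Omega>]
        pw_continuous_intros pfn_continuous F)
  finally show ?thesis by simp
qed

lemma dot_matZ: "dot pidx q (mv pidx pidx (matZ D) q) = integral \<Omega> (\<lambda>y. pres D q y * pres D q y)"
proof -
  have "integral \<Omega> (\<lambda>y. pres D q y * pres D q y)
      = (\<Sum>m<npres D. q m * integral \<Omega> (\<lambda>y. pfn D m y * pres D q y))"
    by (simp add: integral_pres[OF pres_continuous] mult.commute[of _ "pfn D _ _"])
  also have "\<dots> = (\<Sum>m<npres D. q m * (\<Sum>n<npres D. q n * integral \<Omega> (\<lambda>y. pfn D m y * pfn D n y)))"
    by (simp add: integral_pres[OF pfn_continuous])
  finally show ?thesis by (simp add: dot_def mv_def matZ_def dom_eq mult.commute)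
qed

lemma pres_diff_scale: "pres D (\<lambda>m. q m - c * q' m) = (\<lambda>y. pres D q y - c * pres D q' y)"
  by (simp add: pres_def left_diff_distrib sum_subtractf sum_distrib_left mult.assoc)

lemma integral_pres_diff_scale:
  "integral \<Omega> (pres D (\<lambda>m. q m - c * q' m)) = integral \<Omega> (pres D q) - c * integral \<Omega> (pres D q')"
  unfolding pres_diff_scale
  using region_integral_lin[OF pres_continuous pres_continuous region_\<Omega>, of 1 q "- c" q'] by simp

text \<open>Subtracting a multiple of this pressure normalizes the average of a pressure \<open>p\<close> without
  changing \<open>B\<^sup>T p\<close>.\<close>
lemma constant_pressure:
  obtains q where "q \<in> vecs pidx" "mv (vidx D) pidx (tr (matB D)) q = (\<lambda>_. 0)"
    "\<And>T y. T \<in> mesh D \<Longrightarrow> y \<in> interior T \<Longrightarrow> pres D q y = 1"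
    "0 < integral \<Omega> (pres D q)"
proof -
  obtain q where q: "q \<in> vecs pidx" "pres_const D q 1" using kernel_ok by (auto simp: kernel_ok_def)
  then have B: "mv (vidx D) pidx (tr (matB D)) q = (\<lambda>_. 0)"
    using kernel_ok unfolding kernel_ok_def by blast
  have one: "pres D q y = 1" if "T \<in> mesh D" "y \<in> interior T" for T y
    using q(2) that by (simp add: pres_const_def)
  have "integral \<Omega> (pres D q) = integral \<Omega> (\<lambda>_. 1)"
    by (rule region_integral_cong[OF region_\<Omega>]) (simp add: one)
  moreover have "0 < integral \<Omega> (\<lambda>_. 1 :: real)"
  proof -
    have "\<Omega> \<in> lmeasurable"
      using polygonal_\<Omega> polygonal_domain_open by (simp add: lmeasurable_open polygonal_domain_def)
    moreover have "\<not> negligible \<Omega>"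
      using polygonal_\<Omega> polygonal_domain_open by (simp add: open_not_negligible polygonal_domain_def)
    ultimately have "measure lebesgue \<Omega> \<noteq> 0" by (simp add: negligible_iff_measure)
    then show ?thesis
      using \<open>\<Omega> \<in> lmeasurable\<close> measure_nonneg[of lebesgue \<Omega>]
      by (simp add: lmeasure_integral less_le del: measure_nonneg)
  qed
  ultimately show ?thesis using that q(1) B one by simp
qed

text \<open>The solution is a velocity of least energy with the given divergence data. Its Lagrange
  multiplier \<open>p\<close>, normalized to zero average, satisfies \<open>A u = - B\<^sup>T p\<close>. Hence the supremum in the
  inf-sup condition for \<open>p\<close> is at most the energy \<open>E\<close> of \<open>u\<close>, that is, \<open>\<beta>\<^sup>2 \<langle>p, Z p\<rangle> \<le> E\<close>.
  Since \<open>E = - \<langle>p, B v\<rangle>\<close>, the hypothesis on \<open>v\<close> closes the estimate.\<close>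
lemma inf_sup_lifting:
  assumes "inf_sup_stable \<beta> D" and K: "0 \<le> K"
    and bound: "\<And>q. q \<in> vecs pidx \<Longrightarrow>
      (dot pidx q (mv pidx (vidx D) (matB D) v))\<^sup>2 \<le> K * dot pidx q (mv pidx pidx (matZ D) q)"
  obtains u where "mv pidx (vidx D) (matB D) u = mv pidx (vidx D) (matB D) v"
    "\<beta>\<^sup>2 * dot (vidx D) u (mv (vidx D) (vidx D) (matA D) u) \<le> K"
proof -
  let ?I = "vidx D" and ?A = "mv (vidx D) (vidx D) (matA D)" and ?B = "mv pidx (vidx D) (matB D)"
  let ?BT = "mv (vidx D) pidx (tr (matB D))"
  have sym: "matA D i j = matA D j i" for i j by (simp add: matA_eq form_a_commute[of _ "nodal D i"])
  have psd: "0 \<le> dot ?I u (?A u)" for u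
    by (simp add: dot_matA form_a_nonneg region_\<Omega> fe_function_smooth)
  obtain u p where u: "u \<in> vecs ?I" and p: "p \<in> vecs pidx" and Bu: "?B u = ?B v"
    and up: "\<And>i. i \<in> ?I \<Longrightarrow> ?A u i + ?BT p i = 0"
    using saddle_point_solvable[OF finite_vidx finite_lessThan[of "npres D"] sym psd, of "matB D" v]
    by metis
  obtain q1 where q1: "q1 \<in> vecs pidx" "?BT q1 = (\<lambda>_. 0)" "0 < integral \<Omega> (pres D q1)"
    using constant_pressure by metis
  \<comment> \<open>The inf-sup condition applies to pressures of zero average.\<close>
  define p' where "p' = (\<lambda>m. p m - integral \<Omega> (pres D p) / integral \<Omega> (pres D q1) * q1 m)"
  have p': "p' \<in> vecs pidx" unfolding p'_def by (intro vecs_diff vecs_scale p q1)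
  have mean: "integral (dom D) (pres D p') = 0"
    unfolding dom_eq p'_def integral_pres_diff_scale using q1(3) by simp
  have "?BT p' = ?BT p"
    unfolding p'_def by (simp only: mv_diff mv_scale q1(2)) simp
  then have Au: "?A u i = - ?BT p' i" if "i \<in> ?I" for i using up[OF that] by simp
  have dual: "dot pidx p' (?B w) = - dot ?I w (?A u)" for w
  proof -
    have "dot pidx p' (?B w) = dot ?I w (?BT p')"
      by (subst dot_commute) (simp add: dot_mv_tr)
    also have "\<dots> = - dot ?I w (?A u)"
      unfolding dot_def sum_negf[symmetric] by (rule sum.cong) (simp_all add: Au)
    finally show ?thesis .
  qed
  define E where "E = dot ?I u (?A u)"
  define Z where "Z = dot pidx p' (mv pidx pidx (matZ D) p')"
  have E0: "0 \<le> E" unfolding E_def by (rule psd)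
  have "\<beta>\<^sup>2 * Z \<le> (SUP w\<in>vecs ?I. (dot pidx p' (?B w))\<^sup>2 / dot ?I w (?A w))"
    using assms(1) p' mean unfolding inf_sup_stable_def Z_def by blast
  also have "\<dots> \<le> E"
  proof (rule cSUP_least)
    show "vecs ?I \<noteq> {}" using vecs_zero by blast
    fix w assume w: "w \<in> vecs ?I"
    have "(dot pidx p' (?B w))\<^sup>2 \<le> dot ?I w (?A w) * E"
      using psd_cauchy_schwarz[OF sym psd u w] by (simp add: dual E_def)
    then show "(dot pidx p' (?B w))\<^sup>2 / dot ?I w (?A w) \<le> E"
      using psd[of w] E0 by (cases "dot ?I w (?A w) = 0") (auto simp: divide_le_eq mult.commute)
  qed
  finally have ZE: "\<beta>\<^sup>2 * Z \<le> E" .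
  have "E\<^sup>2 \<le> K * Z"
    using bound[OF p'] dual[of u] by (simp add: Bu[symmetric] E_def Z_def)
  then have "\<beta>\<^sup>2 * E\<^sup>2 \<le> \<beta>\<^sup>2 * (K * Z)" by (intro mult_left_mono) simp_all
  also have "\<dots> \<le> K * E" using mult_left_mono[OF ZE K] by (simp add: mult.left_commute)
  finally have "(\<beta>\<^sup>2 * E) * E \<le> K * E" by (simp add: power2_eq_square mult.assoc)
  then have "\<beta>\<^sup>2 * E \<le> K" using E0 K by (cases "E = 0") (auto simp: mult_le_cancel_right)
  then show ?thesis using that Bu E_def by blast
qed


lemma sub_not_negligible: "j < nsub D \<Longrightarrow> \<not> negligible (sub D j)"
  using sub_polygonal sub_open by (simp add: open_not_negligible polygonal_domain_def)

lemma sub_point_off_skeleton: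
  assumes "j < nsub D"
  obtains y T where "y \<in> sub D j" "T \<in> mesh D" "y \<in> interior T"
proof -
  have "\<not> sub D j \<subseteq> skeleton"
    using sub_not_negligible[OF assms] negligible_skeleton negligible_subset by blast
  then obtain y where "y \<in> sub D j" "y \<notin> skeleton" by blast
  with that show ?thesis using region_off_skeleton[OF region_sub[OF assms]] by metis
qed

text \<open>Pressure basis functions live on single subdomains, so cutting the coefficients of the constant
  pressure down to one subdomain gives the indicator function of that subdomain. Subtracting its
  average leaves a function that takes different values on the two subdomains.\<close>
lemma nonconstant_pressure:
  assumes ij: "i < nsub D" "j < nsub D" "i \<noteq> j"
  obtains q where "q \<in> vecs pidx" "integral \<Omega> (pres D q) = 0"
    "0 < dot pidx q (mv pidx pidx (matZ D) q)"
proof -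
  obtain q1 where q1: "q1 \<in> vecs pidx" "\<And>T y. T \<in> mesh D \<Longrightarrow> y \<in> interior T \<Longrightarrow> pres D q1 y = 1"
    "0 < integral \<Omega> (pres D q1)"
    using constant_pressure by metis
  have "\<forall>m\<in>pidx. \<exists>k<nsub D. \<forall>y. y \<notin> sub D k \<longrightarrow> pfn D m y = 0"
    using pressure_ok by (simp add: pressure_ok_def)
  then obtain s where s: "\<And>m. m < npres D \<Longrightarrow> s m < nsub D"
    "\<And>m y. m < npres D \<Longrightarrow> y \<notin> sub D (s m) \<Longrightarrow> pfn D m y = 0"
    by (metis lessThan_iff)
  define qi where "qi = (\<lambda>m. if s m = i then q1 m else 0)"
  define c where "c = integral \<Omega> (pres D qi) / integral \<Omega> (pres D q1)"
  define q where "q = (\<lambda>m. qi m - c * q1 m)"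
  have qi: "qi \<in> vecs pidx" using q1(1) by (simp add: qi_def vecs_def)
  have q: "q \<in> vecs pidx" unfolding q_def by (intro vecs_diff vecs_scale qi q1)
  have mean: "integral \<Omega> (pres D q) = 0"
    unfolding q_def integral_pres_diff_scale c_def using q1(3) by simp
  have on_i: "pres D qi y = pres D q1 y" if "y \<in> sub D i" for y
    unfolding pres_def
  proof (rule sum.cong)
    fix m assume "m \<in> pidx"
    then have m: "m < npres D" by simp
    show "qi m * pfn D m y = q1 m * pfn D m y"
    proof (cases "s m = i")
      case False
      then have "y \<notin> sub D (s m)"
        using sub_disjoint s(1)[OF m] ij(1) that unfolding disjoint_family_on_def by blast
      then show ?thesis using s(2)[OF m] by simp
    qed (simp add: qi_def)
  qed simp
  have on_j: "pres D qi y = 0" if "y \<in> sub D j" for y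
  proof -
    have "y \<notin> sub D i" using sub_disjoint ij that unfolding disjoint_family_on_def by blast
    then show ?thesis unfolding pres_def using s(2) by (auto simp: qi_def intro!: sum.neutral)
  qed
  have "\<exists>m\<in>pidx. q m \<noteq> 0"
  proof (rule ccontr)
    assume "\<not> ?thesis"
    then have "pres D q y = 0" for y by (simp add: pres_def)
    then have qc: "pres D qi y = c * pres D q1 y" for y
      using pres_diff_scale[of qi c q1] by (simp add: q_def fun_eq_iff)
    obtain y T where "y \<in> sub D i" "T \<in> mesh D" "y \<in> interior T"
      by (rule sub_point_off_skeleton[OF ij(1)])
    then have "c = 1" using qc[of y] on_i q1(2) by simp
    obtain y T where "y \<in> sub D j" "T \<in> mesh D" "y \<in> interior T"
      by (rule sub_point_off_skeleton[OF ij(2)])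
    then have "c = 0" using qc[of y] on_j q1(2) by simp
    with \<open>c = 1\<close> show False by simp
  qed
  then have "dot pidx q q \<noteq> 0" using dot_self_eq_0[of pidx q] by blast
  then have "0 < h\<^sup>2 / \<kappa> * dot pidx q q"
    using h_pos \<kappa>_pos dot_self_nonneg[of pidx q] by simp
  also have "\<dots> \<le> dot pidx q (mv pidx pidx (matZ D) q)"
    using mass_ok q by (simp add: mass_ok_def Let_def)
  finally show ?thesis using that q mean by blast
qed

text \<open>With at least one multiplier there are two subdomains, hence a pressure of zero average and
  positive norm to test with. If all pressures were constant, the condition would hold for every
  \<open>\<beta>\<close>.\<close>
lemma inf_sup_constant_le:
  assumes "inf_sup_stable \<beta> D" and "0 < nmult D"
  shows "\<beta>\<^sup>2 \<le> 2"
proof -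
  obtain d i j where "i \<noteq> j" "(i, d) \<in> wdelta D" "(j, d) \<in> wdelta D"
    using jump_row[OF assms(2)] by blast
  then obtain q where q: "q \<in> vecs pidx" "integral \<Omega> (pres D q) = 0"
    "0 < dot pidx q (mv pidx pidx (matZ D) q)"
    using nonconstant_pressure wdelta_nsub by metis
  let ?z = "dot pidx q (mv pidx pidx (matZ D) q)"
  have "\<beta>\<^sup>2 * ?z \<le> (SUP w\<in>vecs (vidx D). (dot pidx q (mv pidx (vidx D) (matB D) w))\<^sup>2
      / dot (vidx D) w (mv (vidx D) (vidx D) (matA D) w))"
    using assms(1) q(1,2) dom_eq unfolding inf_sup_stable_def by simp
  also have "\<dots> \<le> 2 * ?z"
  proof (rule cSUP_least)
    show "vecs (vidx D) \<noteq> {}" using vecs_zero by blast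
    fix w
    let ?a = "form_a \<Omega> (fe_function D w) (fe_function D w)"
    have "(form_b \<Omega> (fe_function D w) (pres D q))\<^sup>2 \<le> 2 * ?a * ?z"
      unfolding dot_matZ by (rule form_b_square_le[OF region_\<Omega> fe_function_smooth pres_continuous])
    moreover have "0 \<le> ?a" by (rule form_a_nonneg[OF region_\<Omega> fe_function_smooth])
    ultimately show "(dot pidx q (mv pidx (vidx D) (matB D) w))\<^sup>2
      / dot (vidx D) w (mv (vidx D) (vidx D) (matA D) w) \<le> 2 * ?z"
      unfolding dot_matA dot_matB using q(3)
      by (cases "?a = 0") (auto simp: divide_le_eq mult_ac)
  qed
  finally show ?thesis using q(3) by simp
qed


section \<open>The two bounds\<close>

text \<open>The constrained vector that represents the functional \<open>w \<mapsto> \<langle>B\<^sub>\<Delta> w\<^sub>\<Delta>, x\<rangle>\<close> in the sub-assembled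
  form; see \<open>dot_jump_eq_Aform\<close>.\<close>
definition multiplier_response :: "(nat \<Rightarrow> real) \<Rightarrow> dof \<Rightarrow> real" where
  "multiplier_response x = Asolve D (RopT D (BDeltaT D x))"

definition lumped_form :: "(nat \<Rightarrow> real) \<Rightarrow> (nat \<Rightarrow> real) \<Rightarrow> real" where
  "lumped_form x y = Aform D (RopT D (BDeltaDT D x)) (RopT D (BDeltaDT D y))"

lemma dot_lumped: "dot {..<nmult D} (lumped D x) y = lumped_form x y"
  by (simp add: lumped_def lumped_form_def Aform_def flip: dot_BDeltaD dot_Rop)

lemma lumped_form_commute: "lumped_form x y = lumped_form y x"
  by (simp add: lumped_form_def Aform_commute)

lemma lumped_form_nonneg: "0 \<le> lumped_form x x"
  by (simp add: lumped_form_def Aform_RopT_nonneg)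

lemma lumped_form_cauchy_schwarz: "(lumped_form x y)\<^sup>2 \<le> lumped_form x x * lumped_form y y"
  unfolding lumped_form_def by (rule Aform_cauchy_schwarz_RopT)

text \<open>The value depends only on \<open>M\<^sub>L\<^sup>-\<^sup>1 \<mu>\<close>: another preimage \<open>\<nu>\<close> gives the same pairing by symmetry of
  the lumped form.\<close>
lemma dot_lumped_inv:
  assumes "\<mu> \<in> mult_space D"
  shows "dot {..<nmult D} (lumped_inv D (lumped D \<mu>)) (lumped D \<mu>) = lumped_form \<mu> \<mu>"
proof -
  define \<nu> where "\<nu> = lumped_inv D (lumped D \<mu>)"
  have \<nu>: "lumped D \<nu> = lumped D \<mu>"
    unfolding \<nu>_def lumped_inv_def by (rule f_inv_into_f[OF imageI[OF assms]])
  have "dot {..<nmult D} \<nu> (lumped D \<mu>) = lumped_form \<mu> \<nu>"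
    by (subst dot_commute) (rule dot_lumped)
  also have "\<dots> = lumped_form \<mu> \<mu>"
    using dot_lumped[of \<nu> \<mu>] dot_lumped[of \<mu> \<mu>] \<nu> by (simp add: lumped_form_commute[of \<mu> \<nu>])
  finally show ?thesis by (simp add: \<nu>_def)
qed

lemma multiplier_response_W0:
  assumes "jump_stable b D"
  shows "multiplier_response x \<in> W0 D"
proof (rule Aop_zero_imp_W0)
  show "multiplier_response x \<in> vecs (dofs D)"
    unfolding multiplier_response_def by (rule subassembled_problem_solvable(1)[OF assms])
  show "Aop D (multiplier_response x) (IntP m) = 0" for m
    unfolding multiplier_response_def subassembled_problem_solvable(2)[OF assms] by (simp add: RopT_other)
qed

lemma dot_jump_eq_Aform:
  assumes "jump_stable b D"
  shows "dot {..<nmult D} (BDelta D (Rop D w)) x = Aform D (multiplier_response x) w"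
  unfolding Aform_def multiplier_response_def subassembled_problem_solvable(2)[OF assms]
  by (subst dot_commute) (simp add: dot_Rop dot_BDelta)

lemma Gop_eq: "Gop D x = BDelta D (Rop D (multiplier_response x))"
  by (simp add: Gop_def multiplier_response_def)

lemma Gop_mult_space: "Gop D x \<in> mult_space D"
  unfolding Gop_eq mult_space_def by (simp add: Rop_def)

lemma lumped_form_jump:
  "lumped_form (BDelta D (Rop D w)) (BDelta D (Rop D w)) = Aform D (jump_op D w) (jump_op D w)"
  by (simp add: lumped_form_def jump_op_def)

lemma form_b_decomposition:
  "pw_smooth (mesh D) u \<Longrightarrow> pw_continuous (mesh D) q \<Longrightarrow> form_b \<Omega> u q = (\<Sum>j<nsub D. form_b (sub D j) u q)"
  by (simp add: form_b_def integral_sub_decomposition pw_continuous_mult pw_continuous_divergence sum_negf)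

lemma form_a_decomposition:
  "pw_smooth (mesh D) u \<Longrightarrow> form_a \<Omega> u u = (\<Sum>j<nsub D. form_a (sub D j) u u)"
  by (simp add: form_a_def integral_sub_decomposition pw_continuous_jacobian_inner)

text \<open>Summation of the bounds on the subdomains by the discrete Cauchy-Schwarz inequality; the
  velocity may jump across the interface.\<close>
lemma broken_form_b_square_le:
  assumes u: "\<And>j. pw_smooth (mesh D) (u j)" and q: "pw_continuous (mesh D) q"
  shows "(\<Sum>j<nsub D. form_b (sub D j) (u j) q)\<^sup>2
    \<le> 2 * (\<Sum>j<nsub D. form_a (sub D j) (u j) (u j)) * integral \<Omega> (\<lambda>y. q y * q y)"
proof -
  let ?a = "\<lambda>j. sqrt (2 * form_a (sub D j) (u j) (u j))"
  let ?q = "\<lambda>j. sqrt (integral (sub D j) (\<lambda>y. q y * q y))"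
  have qq: "pw_continuous (mesh D) (\<lambda>y. q y * q y)" by (rule pw_continuous_mult[OF q q])
  have a0: "0 \<le> form_a (sub D j) (u j) (u j)" if "j < nsub D" for j
    by (rule form_a_nonneg[OF region_sub[OF that] u])
  have q0: "0 \<le> integral (sub D j) (\<lambda>y. q y * q y)" if "j < nsub D" for j
    by (rule region_integral_nonneg[OF qq region_sub[OF that]]) simp
  have "\<bar>form_b (sub D j) (u j) q\<bar> \<le> ?a j * ?q j" if "j < nsub D" for j
    using real_sqrt_le_mono[OF form_b_square_le[OF region_sub[OF that] u q, of j]]
    by (simp add: real_sqrt_mult)
  then have "\<bar>\<Sum>j<nsub D. form_b (sub D j) (u j) q\<bar> \<le> (\<Sum>j<nsub D. ?a j * ?q j)"
    by (intro order_trans[OF sum_abs] sum_mono) simp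
  then have "\<bar>\<Sum>j<nsub D. form_b (sub D j) (u j) q\<bar>\<^sup>2 \<le> (\<Sum>j<nsub D. ?a j * ?q j)\<^sup>2"
    by (rule power_mono) simp
  also have "\<dots> \<le> (\<Sum>j<nsub D. (?a j)\<^sup>2) * (\<Sum>j<nsub D. (?q j)\<^sup>2)"
    by (rule Cauchy_Schwarz_ineq_sum)
  also have "\<dots> = 2 * (\<Sum>j<nsub D. form_a (sub D j) (u j) (u j)) * integral \<Omega> (\<lambda>y. q y * q y)"
    using a0 q0 by (simp add: integral_sub_decomposition[OF qq] sum_distrib_left)
  finally show ?thesis by simp
qed

lemma broken_form_b_add_scale:
  assumes "pw_continuous (mesh D) q"
  shows "(\<Sum>j<nsub D. form_b (sub D j) (velocity D (\<lambda>u. v u + t * w u) j) q)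
    = (\<Sum>j<nsub D. form_b (sub D j) (velocity D v j) q) + t * (\<Sum>j<nsub D. form_b (sub D j) (velocity D w j) q)"
proof -
  have "form_b (sub D j) (velocity D (\<lambda>u. v u + t * w u) j) q
      = form_b (sub D j) (velocity D v j) q + t * form_b (sub D j) (velocity D w j) q" if "j < nsub D" for j
    using form_b_lin_left[OF region_sub[OF that] velocity_smooth velocity_smooth assms, of 1 v j t w j]
    by (simp add: velocity_add velocity_scale)
  then show ?thesis by (simp add: sum.distrib sum_distrib_left)
qed

text \<open>The scaled jump vector \<open>r\<close> has the prescribed jump but not the prescribed divergence. As
  \<open>r - z\<close> has no jump, it is a finite element function \<open>v\<close>, and the divergence of \<open>r\<close> tested with
  pressures is that of \<open>v\<close>, since \<open>z\<close> is constrained. The correction is a velocity of small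
  energy with the same tested divergence as \<open>v\<close>; it is continuous and leaves the jump unchanged.\<close>
lemma divergence_free_extension:
  assumes inf_sup: "inf_sup_stable \<beta> D" and \<beta>: "\<beta>\<^sup>2 \<le> 2"
    and z: "z \<in> W0 D" and \<mu>: "\<mu> = BDelta D (Rop D z)"
  obtains w where "w \<in> W0 D" "BDelta D (Rop D w) = \<mu>" "\<beta>\<^sup>2 * Aform D w w \<le> 8 * lumped_form \<mu> \<mu>"
proof -
  define r where "r = RopT D (BDeltaDT D \<mu>)"
  have r: "r \<in> vecs (dofs D)" by (simp add: r_def)
  have rP: "r (IntP m) = 0" for m by (simp add: r_def RopT_other)
  have rr: "Aform D r r = lumped_form \<mu> \<mu>" by (simp add: r_def lumped_form_def)
  have "\<mu> \<in> vecs {..<nmult D}" by (simp add: \<mu> BDelta_def)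
  then have jump_r: "BDelta D (Rop D r) = \<mu>"
    by (simp add: r_def Rop_RopT BDelta_BDeltaDT BDeltaDT_vecs)
  have "BDelta D (Rop D (\<lambda>u. r u + (-1) * z u)) = (\<lambda>_. 0)"
    by (simp add: Rop_diff BDelta_diff jump_r \<mu>)
  then obtain v where v: "v \<in> vecs (vidx D)"
    "\<And>j y. j < nsub D \<Longrightarrow> y \<in> sub D j \<Longrightarrow> velocity D (\<lambda>u. r u + (-1) * z u) j y = fe_function D v y"
    using no_jump_imp_fe_function by blast
  have Bv: "form_b \<Omega> (fe_function D v) q = (\<Sum>j<nsub D. form_b (sub D j) (velocity D r j) q)"
    if q: "pw_continuous (mesh D) q" and zq: "(\<Sum>j<nsub D. form_b (sub D j) (velocity D z j) q) = 0" for q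
  proof -
    have "form_b \<Omega> (fe_function D v) q
        = (\<Sum>j<nsub D. form_b (sub D j) (velocity D (\<lambda>u. r u + (-1) * z u) j) q)"
      unfolding form_b_decomposition[OF fe_function_smooth q]
      by (rule sum.cong[OF refl], rule form_b_cong[OF sub_open v(2)[symmetric]]) simp_all
    also have "\<dots> = (\<Sum>j<nsub D. form_b (sub D j) (velocity D r j) q)"
      unfolding broken_form_b_add_scale[OF q] zq by simp
    finally show ?thesis .
  qed
  have "(dot pidx q (mv pidx (vidx D) (matB D) v))\<^sup>2
      \<le> (2 * lumped_form \<mu> \<mu>) * dot pidx q (mv pidx pidx (matZ D) q)" for q
    unfolding dot_matB dot_matZ Bv[OF pres_continuous W0_orthogonal_pres[OF z]]
      rr[symmetric] Aform_pressure_free[of r, OF rP]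
    by (rule broken_form_b_square_le[OF velocity_smooth pres_continuous])
  then obtain u where u: "mv pidx (vidx D) (matB D) u = mv pidx (vidx D) (matB D) v"
    "\<beta>\<^sup>2 * dot (vidx D) u (mv (vidx D) (vidx D) (matA D) u) \<le> 2 * lumped_form \<mu> \<mu>"
    using inf_sup_lifting[OF inf_sup, of "2 * lumped_form \<mu> \<mu>" v] lumped_form_nonneg by auto
  obtain e where e: "represents e (fe_function D u)" using fe_function_represented by blast
  then have eP: "e (IntP m) = 0" for m by (simp add: represents_def)
  have ev: "velocity D e j y = fe_function D u y" if "j < nsub D" "y \<in> sub D j" for j y
    using e that by (simp add: represents_def)
  have ee: "Aform D e e = dot (vidx D) u (mv (vidx D) (vidx D) (matA D) u)"
    unfolding dot_matA form_a_decomposition[OF fe_function_smooth] Aform_pressure_free[of e, OF eP]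
    by (rule sum.cong) (simp_all add: form_a_cong[OF sub_open ev ev])
  define w where "w = (\<lambda>u. r u + (-1) * e u)"
  have "w \<in> W0 D"
    unfolding W0_iff
  proof (intro conjI allI impI)
    show "w \<in> vecs (dofs D)" using r e by (simp add: w_def represents_def vecs_diff)
    fix m assume m: "m < npres D"
    note q = pfn_continuous[OF m]
    have "(\<Sum>j<nsub D. form_b (sub D j) (velocity D e j) (pfn D m)) = form_b \<Omega> (fe_function D u) (pfn D m)"
      unfolding form_b_decomposition[OF fe_function_smooth q]
      by (rule sum.cong) (simp_all add: form_b_cong[OF sub_open ev])
    also have "\<dots> = form_b \<Omega> (fe_function D v) (pfn D m)"
      using fun_cong[OF u(1), of m] by (simp add: matB_apply[OF m])
    also have "\<dots> = (\<Sum>j<nsub D. form_b (sub D j) (velocity D r j) (pfn D m))"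
      using z m by (intro Bv[OF q]) (simp add: W0_iff)
    finally show "(\<Sum>j<nsub D. form_b (sub D j) (velocity D w j) (pfn D m)) = 0"
      unfolding w_def broken_form_b_add_scale[OF q] by simp
  qed
  moreover have "BDelta D (Rop D w) = \<mu>"
    using e jump_r by (simp add: w_def Rop_diff BDelta_diff represents_def)
  moreover have "\<beta>\<^sup>2 * Aform D w w \<le> 8 * lumped_form \<mu> \<mu>"
  proof -
    \<comment> \<open>The energies of \<open>r - e\<close> and \<open>r + e\<close> add up to twice those of \<open>r\<close> and \<open>e\<close>.\<close>
    have "0 \<le> Aform D (\<lambda>u. r u + 1 * e u) (\<lambda>u. r u + 1 * e u)"
      using rP eP by (intro Aform_pressure_free_nonneg) simp
    then have "Aform D w w \<le> 2 * lumped_form \<mu> \<mu> + 2 * Aform D e e"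
      unfolding w_def Aform_add_scale rr by simp
    then have "\<beta>\<^sup>2 * Aform D w w \<le> \<beta>\<^sup>2 * (2 * lumped_form \<mu> \<mu> + 2 * Aform D e e)"
      by (rule mult_left_mono) simp
    \<comment> \<open>\<open>8 = 2 \<cdot> 2 + 2 \<cdot> 2\<close>: one \<open>2\<close> is the bound on \<open>\<beta>\<^sup>2\<close>, one is the constant of \<open>u(2)\<close>.\<close>
    also have "\<dots> \<le> 8 * lumped_form \<mu> \<mu>"
      using mult_right_mono[OF \<beta> lumped_form_nonneg[of \<mu>]] u(2) by (simp add: ee algebra_simps)
    finally show ?thesis .
  qed
  ultimately show ?thesis using that by blast
qed

text \<open>With \<open>\<gamma> = \<langle>G x, x\<rangle>\<close> and \<open>m = \<langle>\<mu>, x\<rangle>\<close> the Cauchy-Schwarz inequality gives \<open>m\<^sup>2 \<le> \<gamma> \<cdot> 8 m / \<beta>\<^sup>2\<close>. The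
  case without multipliers is separated because the bound on \<open>\<beta>\<close> needs two subdomains.\<close>
lemma lumped_lower_bound:
  assumes stable: "jump_stable b D" and inf_sup: "inf_sup_stable \<beta> D"
    and x: "x = lumped D (Gop D y)"
  shows "1 / 8 * \<beta>\<^sup>2 * dot {..<nmult D} (lumped_inv D x) x \<le> dot {..<nmult D} (Gop D x) x"
proof (cases "nmult D = 0")
  case True
  then show ?thesis by (simp add: dot_def)
next
  case False
  define \<mu> where "\<mu> = Gop D y"
  define \<gamma> where "\<gamma> = dot {..<nmult D} (Gop D x) x"
  have \<gamma>: "\<gamma> = Aform D (multiplier_response x) (multiplier_response x)"
    by (simp add: \<gamma>_def Gop_eq dot_jump_eq_Aform[OF stable])
  have \<gamma>0: "0 \<le> \<gamma>" unfolding \<gamma> by (rule Aform_nonneg_W0[OF multiplier_response_W0[OF stable]])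
  obtain w where w: "w \<in> W0 D" "BDelta D (Rop D w) = \<mu>" "\<beta>\<^sup>2 * Aform D w w \<le> 8 * lumped_form \<mu> \<mu>"
    using divergence_free_extension[OF inf_sup inf_sup_constant_le[OF inf_sup] multiplier_response_W0[OF stable]]
      False \<mu>_def Gop_eq by blast
  have "lumped_form \<mu> \<mu> = dot {..<nmult D} \<mu> x"
    by (simp add: x \<mu>_def[symmetric] dot_lumped[symmetric] dot_commute[of _ \<mu>])
  also have "\<dots> = Aform D (multiplier_response x) w"
    unfolding w(2)[symmetric] by (rule dot_jump_eq_Aform[OF stable])
  finally have "(lumped_form \<mu> \<mu>)\<^sup>2 \<le> \<gamma> * Aform D w w"
    unfolding \<gamma> using Aform_cauchy_schwarz_W0[OF multiplier_response_W0[OF stable] w(1)] by simp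
  then have "\<beta>\<^sup>2 * (lumped_form \<mu> \<mu>)\<^sup>2 \<le> \<gamma> * (\<beta>\<^sup>2 * Aform D w w)"
    using mult_left_mono[of "(lumped_form \<mu> \<mu>)\<^sup>2" "\<gamma> * Aform D w w" "\<beta>\<^sup>2"]
    by (simp add: mult.left_commute)
  also have "\<dots> \<le> \<gamma> * (8 * lumped_form \<mu> \<mu>)" by (rule mult_left_mono[OF w(3) \<gamma>0])
  finally have "(\<beta>\<^sup>2 * lumped_form \<mu> \<mu>) * lumped_form \<mu> \<mu> \<le> (8 * \<gamma>) * lumped_form \<mu> \<mu>"
    by (simp add: power2_eq_square mult_ac)
  then have "\<beta>\<^sup>2 * lumped_form \<mu> \<mu> \<le> 8 * \<gamma>"
    using \<gamma>0 lumped_form_nonneg[of \<mu>] by (cases "lumped_form \<mu> \<mu> = 0") (auto simp: mult_le_cancel_right)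
  then show ?thesis
    unfolding x dot_lumped_inv[OF Gop_mult_space] unfolding x[symmetric] \<gamma>_def \<mu>_def by simp
qed

text \<open>With \<open>\<gamma> = \<langle>G x, x\<rangle>\<close> and \<open>m = \<langle>\<mu>, x\<rangle>\<close> the Cauchy-Schwarz inequality gives \<open>\<gamma>\<^sup>2 \<le> m \<cdot> b \<gamma>\<close>.\<close>
lemma lumped_upper_bound:
  assumes stable: "jump_stable b D" and x: "x = lumped D (Gop D y)"
  shows "dot {..<nmult D} (Gop D x) x \<le> b * dot {..<nmult D} (lumped_inv D x) x"
proof -
  define \<mu> where "\<mu> = Gop D y"
  define \<gamma> where "\<gamma> = dot {..<nmult D} (Gop D x) x"
  have \<gamma>: "\<gamma> = Aform D (multiplier_response x) (multiplier_response x)"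
    by (simp add: \<gamma>_def Gop_eq dot_jump_eq_Aform[OF stable])
  have \<gamma>0: "0 \<le> \<gamma>" unfolding \<gamma> by (rule Aform_nonneg_W0[OF multiplier_response_W0[OF stable]])
  have jump: "lumped_form (Gop D t) (Gop D t) \<le> b * Aform D (multiplier_response t) (multiplier_response t)" for t
    using stable multiplier_response_W0[OF stable] unfolding jump_stable_def Gop_eq lumped_form_jump by blast
  have "\<gamma> = lumped_form \<mu> (Gop D x)"
    by (simp add: \<gamma>_def x \<mu>_def dot_lumped[symmetric] dot_commute[of _ "Gop D _"])
  then have "\<gamma>\<^sup>2 \<le> lumped_form \<mu> \<mu> * lumped_form (Gop D x) (Gop D x)"
    using lumped_form_cauchy_schwarz by simp
  also have "\<dots> \<le> lumped_form \<mu> \<mu> * (b * \<gamma>)"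
    unfolding \<gamma> by (rule mult_left_mono[OF jump lumped_form_nonneg])
  finally have sq: "\<gamma> * \<gamma> \<le> (b * lumped_form \<mu> \<mu>) * \<gamma>" by (simp add: power2_eq_square mult_ac)
  have "\<gamma> \<le> b * lumped_form \<mu> \<mu>"
  proof (cases "\<gamma> = 0")
    case True
    \<comment> \<open>For \<open>b < 0\<close> the jump bound is nonpositive, whereas the lumped energy of \<open>\<mu>\<close> is nonnegative.\<close>
    have "0 \<le> b * lumped_form \<mu> \<mu>"
    proof (cases "0 \<le> b")
      case False
      then have "b * Aform D (multiplier_response y) (multiplier_response y) \<le> 0"
        using Aform_nonneg_W0[OF multiplier_response_W0[OF stable, of y]] by (simp add: mult_nonpos_nonneg)
      then have "lumped_form \<mu> \<mu> = 0"
        using jump[of y] lumped_form_nonneg[of \<mu>] by (simp add: \<mu>_def)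
      then show ?thesis by simp
    qed (simp add: lumped_form_nonneg)
    with True show ?thesis by simp
  next
    case False
    with sq \<gamma>0 show ?thesis by (simp add: mult_le_cancel_right)
  qed
  then show ?thesis
    unfolding x dot_lumped_inv[OF Gop_mult_space] unfolding x[symmetric] \<gamma>_def \<mu>_def by simp
qed

end

theorem theorem1:
  fixes \<Omega> :: "plane set" and \<kappa> :: real
  assumes "polygonal_domain \<Omega>" and "\<kappa> > 0"
  shows "\<exists>c>0. \<forall>\<beta>>0. \<forall>\<Phi>\<^sub>1 :: real \<Rightarrow> real. \<forall>h H D.
           fetidp_setting \<Omega> \<kappa> h H D \<longrightarrow> inf_sup_stable \<beta> D \<longrightarrow> jump_stable (\<Phi>\<^sub>1 (H / h)) D \<longrightarrow>
           (\<forall>x \<in> (\<lambda>y. lumped D (Gop D y)) ` mult_space D.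
              c * \<beta>\<^sup>2 * dot {..<nmult D} (lumped_inv D x) x \<le> dot {..<nmult D} (Gop D x) x \<and>
              dot {..<nmult D} (Gop D x) x
                \<le> \<Phi>\<^sub>1 (H / h) * dot {..<nmult D} (lumped_inv D x) x)"
proof (intro exI[of _ "1 / 8"] conjI allI impI ballI)
  fix \<beta> :: real and \<Phi> :: "real \<Rightarrow> real" and h H D x
  assume setting: "fetidp_setting \<Omega> \<kappa> h H D" and inf_sup: "inf_sup_stable \<beta> D"
    and stable: "jump_stable (\<Phi> (H / h)) D"
    and "x \<in> (\<lambda>y. lumped D (Gop D y)) ` mult_space D"
  then obtain y where x: "x = lumped D (Gop D y)" by blast
  interpret discretization \<Omega> \<kappa> h H D
    using assms setting by unfold_locales
  show "1 / 8 * \<beta>\<^sup>2 * dot {..<nmult D} (lumped_inv D x) x \<le> dot {..<nmult D} (Gop D x) x"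
    by (rule lumped_lower_bound[OF stable inf_sup x])
  show "dot {..<nmult D} (Gop D x) x \<le> \<Phi> (H / h) * dot {..<nmult D} (lumped_inv D x) x"
    by (rule lumped_upper_bound[OF stable x])
qed simp

end
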